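(* Let $\mathcal{M}$ be a Quillen model category, and let $\mathrm{Cof}(\mathcal{M})$, $\mathrm{Fib}(\mathcal{M})$, $\mathrm{Bif}(\mathcal{M})$ denote its full subcategories of cofibrant, fibrant, and bifibrant (i.e. cofibrant and fibrant) objects. Then each $\mathcal{C}\in\{\mathcal{M},\mathrm{Cof}(\mathcal{M}),\mathrm{Fib}(\mathcal{M}),\mathrm{Bif}(\mathcal{M})\}$ carries the structure of a uni-fractionable category, where $$\mathrm{Den}\,\mathcal{C}=\{w\in\mathrm{Mor}\,\mathcal{C}\mid w\text{ is a weak equivalence}\},$$ $$\mathrm{SDen}\,\mathcal{C}=\{i\in\mathrm{Mor}\,\mathcal{C}\mid i\text{ is an acyclic cofibration}\},$$ $$\mathrm{TDen}\,\mathcal{C}=\{p\in\mathrm{Mor}\,\mathcal{C}\mid p\text{ is an acyclic fibration}\}.$$ In particular, the homotopy category $\mathrm{Ho}\,\mathcal{M}$ is isomorphic to $\mathrm{Frac}\,\mathcal{M}$. If $\mathcal{M}$ is a closed Quillen model category, then $\mathrm{Den}\,\mathcal{C}$ is saturated for each $\mathcal{C}\in\{\mathcal{M},\mathrm{Cof}(\mathcal{M}),\mathrm{Fib}(\mathcal{M}),\mathrm{Bif}(\mathcal{M})\}$. The localisation functor $\mathrm{loc}\colon\mathcal{C}\to\mathrm{Frac}\,\mathcal{C}$ preserves finite coproducts for $\mathcal{C}\in\{\mathrm{Cof}(\mathcal{M}),\mathrm{Bif}(\mathcal{M})\}$ and finite products for $\mathcal{C}\in\{\mathrm{Fib}(\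mathcal{M}),\mathrm{Bif}(\mathcal{M})\}$.
   Context: Quillen model category is meant in Quillen's original sense: a category $\mathcal{M}$ with three distinguished classes of morphisms (cofibrations, fibrations, weak equivalences; "acyclic" means additionally a weak equivalence) such that: $\mathcal{M}$ has finite limits and colimits; cofibrations have the left lifting property against fibrations whenever at least one of the two is acyclic; every morphism factors as a cofibration followed by an acyclic fibration and as an acyclic cofibration followed by a fibration (no functoriality is required); fibrations are closed under composition and pullback and contain all isomorphisms, and dually cofibrations are closed under composition and pushout and contain all isomorphisms; pullbacks of acyclic fibrations are weak equivalences, and pushouts of acyclic cofibrations are weak equivalences; isomorphisms are weak equivalences, and weak equivalences satisfy two-out-of-three. It is closed if, moreover, any two of the three classes determine the third: fibrations are exactly the morphisms with the right lifting property against acyclic cofibrations, cofibrations are exactly the morphisms with the left lifting property against acyclic fibrations, and weak equivalences are exactly the composites of a morphism with the left lifting property against all fibrations followed by a morphism with the right lifting property against all cofibrations. An object is cofibrant if the morphism from the initial object is a cofibration, and fibrant if the morphism to the terminal object is a fibration. The homotopy category $\mathrm{Ho}\,\mathcal{M}$ is the localisation of $\mathcal{M}$ with respect to the weak equivalences. Composition is written diagrammatically: for $f\colon X\to Y$, $g\colon Y\to Z$ the composite is $fg\colon X\to Z$. A category with denominators is a category $\mathcal{C}$ together with a subset $\mathrm{Den}\,\mathcal{C}\subseteq\mathrm{Mor}\,\mathcal{C}$ of denominators. A subset $D\subseteq\mathrm{Mor}\,\mathcal{C}$ is multiplicative if it contains all identities and is closed under composition; it is semi-saturated if it is multiplicative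 and, for composable $f,g$, whenever two of $f,g,fg$ are in $D$, so is the third. A uni-fractionable category is a category with denominators $\mathcal{C}$ with $\mathrm{Den}\,\mathcal{C}$ semi-saturated, together with multiplicative subsets $\mathrm{SDen}\,\mathcal{C},\mathrm{TDen}\,\mathcal{C}\subseteq\mathrm{Den}\,\mathcal{C}$ (S-denominators, T-denominators) such that: (WU) for $i\in\mathrm{SDen}\,\mathcal{C}$ and a morphism $f$ with the same source as $i$ there is a weak pushout square $if'=fi'$ of $i$ and $f$ with $i'\in\mathrm{SDen}\,\mathcal{C}$; dually, for $p\in\mathrm{TDen}\,\mathcal{C}$ and a morphism $f$ with the same target as $p$ there is a weak pullback square $f'p=p'f$ of $f$ and $p$ with $p'\in\mathrm{TDen}\,\mathcal{C}$; (Fac) for every $d\in\mathrm{Den}\,\mathcal{C}$ there are $i\in\mathrm{SDen}\,\mathcal{C}$, $p\in\mathrm{TDen}\,\mathcal{C}$ with $d=ip$. (Weak pushout/pullback: universal property without uniqueness.) A $3$-arrow $(b,f,a)\colon X\leftarrow\tilde X\to\tilde Y\leftarrow Y$ in $\mathcal{C}$ consists of denominators $b\colon\tilde X\to X$, $a\colon Y\to\tilde Y$ and a morphism $f\colon\tilde X\to\tilde Y$; its source is $X$, its target is $Y$. Fraction equality is the equivalence relation on $3$-arrows generated by $(b,f,a)\equiv(b,fc,ac)$ for $ac\in\mathrm{Den}\,\mathcal{C}$ and $(b,f,a)\equiv(cb,cf,a)$ for $cb\in\mathrm{Den}\,\mathcal{C}$; the class of $(b,f,a)$ is the double fraction $b\backslash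 f/a$. The fraction category $\mathrm{Frac}\,\mathcal{C}$ has the objects of $\mathcal{C}$, double fractions as morphisms, identities $1\backslash1/1$, and composition (independent of choices): choose an S-denominator $j$ and a T-denominator $q$ with $b_2a_1=jq$, a T-denominator $q'$ and $f_1'$ with $f_1'q=q'f_1$, an S-denominator $j'$ and $f_2'$ with $jf_2'=f_2j'$; then $(b_1\backslash f_1/a_1)(b_2\backslash f_2/a_2)=q'b_1\backslash f_1'f_2'/a_2j'$. It is a localisation of $\mathcal{C}$ with respect to $\mathrm{Den}\,\mathcal{C}$ via $\mathrm{loc}(X)=X$, $\mathrm{loc}(f)=1\backslash f/1$. $\mathrm{Den}\,\mathcal{C}$ is saturated if every morphism $f$ of $\mathcal{C}$ with $\mathrm{loc}(f)$ invertible lies in $\mathrm{Den}\,\mathcal{C}$. For a category $\mathcal{C}$ admitting finite coproducts, a functor $F\colon\mathcal{C}\to\mathcal{D}$ preserves finite coproducts if it sends an initial object to an initial object and $F(X_1\amalg X_2)$ is a coproduct of $FX_1,FX_2$ with the images of the embeddings as embeddings; dually for finite products. *)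

theory Defs
  imports Main
begin

section \<open>Categories\<close>

text \<open>Composition is diagrammatic: \<open>cmp C f g\<close> is ``first \<open>f\<close>, then \<open>g\<close>''. Values of the
  operations outside \<open>objs C\<close> and \<open>arrs C\<close> are irrelevant.\<close>

record ('o, 'a) cat =
  objs :: "'o set"
  arrs :: "'a set"
  src :: "'a \<Rightarrow> 'o"
  tgt :: "'a \<Rightarrow> 'o"
  ident :: "'o \<Rightarrow> 'a"
  cmp :: "'a \<Rightarrow> 'a \<Rightarrow> 'a"

definition hom :: "('o, 'a) cat \<Rightarrow> 'o \<Rightarrow> 'o \<Rightarrow> 'a set" where
  "hom C X Y = {f \<in> arrs C. src C f = X \<and> tgt C f = Y}"

locale category =
  fixes C :: "('o, 'a) cat"
  assumes src_obj: "f \<in> arrs C \<Longrightarrow> src C f \<in> objs C"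
    and tgt_obj: "f \<in> arrs C \<Longrightarrow> tgt C f \<in> objs C"
    and ident_hom: "X \<in> objs C \<Longrightarrow> ident C X \<in> hom C X X"
    and cmp_hom: "\<lbrakk>f \<in> arrs C; g \<in> arrs C; tgt C f = src C g\<rbrakk>
      \<Longrightarrow> cmp C f g \<in> hom C (src C f) (tgt C g)"
    and ident_cmp: "f \<in> arrs C \<Longrightarrow> cmp C (ident C (src C f)) f = f"
    and cmp_ident: "f \<in> arrs C \<Longrightarrow> cmp C f (ident C (tgt C f)) = f"
    and cmp_assoc: "\<lbrakk>f \<in> arrs C; g \<in> arrs C; h \<in> arrs C; tgt C f = src C g; tgt C g = src C h\<rbrakk>
      \<Longrightarrow> cmp C (cmp C f g) h = cmp C f (cmp C g h)"

definition op_cat :: "('o, 'a) cat \<Rightarrow> ('o, 'a) cat" where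
  "op_cat C = \<lparr>objs = objs C, arrs = arrs C, src = tgt C, tgt = src C,
     ident = ident C, cmp = (\<lambda>f g. cmp C g f)\<rparr>"

definition full_subcat :: "('o, 'a) cat \<Rightarrow> 'o set \<Rightarrow> ('o, 'a) cat" where
  "full_subcat C S = \<lparr>objs = objs C \<inter> S, arrs = {f \<in> arrs C. src C f \<in> S \<and> tgt C f \<in> S},
     src = src C, tgt = tgt C, ident = ident C, cmp = cmp C\<rparr>"

definition is_iso :: "('o, 'a) cat \<Rightarrow> 'a \<Rightarrow> bool" where
  "is_iso C f \<longleftrightarrow> f \<in> arrs C \<and> (\<exists>g \<in> hom C (tgt C f) (src C f).
     cmp C f g = ident C (src C f) \<and> cmp C g f = ident C (tgt C f))"

section \<open>Functors\<close>

record ('o, 'a, 'p, 'b) functr =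
  fobj :: "'o \<Rightarrow> 'p"
  farr :: "'a \<Rightarrow> 'b"

definition is_functor :: "('o, 'a) cat \<Rightarrow> ('p, 'b) cat \<Rightarrow> ('o, 'a, 'p, 'b) functr \<Rightarrow> bool" where
  "is_functor C D F \<longleftrightarrow> category C \<and> category D \<and>
     (\<forall>X \<in> objs C. fobj F X \<in> objs D) \<and>
     (\<forall>f \<in> arrs C. farr F f \<in> hom D (fobj F (src C f)) (fobj F (tgt C f))) \<and>
     (\<forall>X \<in> objs C. farr F (ident C X) = ident D (fobj F X)) \<and>
     (\<forall>f \<in> arrs C. \<forall>g \<in> arrs C. tgt C f = src C g \<longrightarrow>
        farr F (cmp C f g) = cmp D (farr F f) (farr F g))"

definition functor_id :: "('o, 'a, 'o, 'a) functr" where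
  "functor_id = \<lparr>fobj = (\<lambda>X. X), farr = (\<lambda>f. f)\<rparr>"

text \<open>Diagrammatic as well: first \<open>F\<close>, then \<open>G\<close>.\<close>

definition functor_cmp ::
    "('o, 'a, 'p, 'b) functr \<Rightarrow> ('p, 'b, 'q, 'c) functr \<Rightarrow> ('o, 'a, 'q, 'c) functr" where
  "functor_cmp F G = \<lparr>fobj = (\<lambda>X. fobj G (fobj F X)), farr = (\<lambda>f. farr G (farr F f))\<rparr>"

text \<open>Equality of functors with source category \<open>C\<close>; values outside \<open>C\<close> carry no meaning.\<close>

definition functor_eq ::
    "('o, 'a) cat \<Rightarrow> ('o, 'a, 'p, 'b) functr \<Rightarrow> ('o, 'a, 'p, 'b) functr \<Rightarrow> bool" where
  "functor_eq C F G \<longleftrightarrow>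
     (\<forall>X \<in> objs C. fobj F X = fobj G X) \<and> (\<forall>f \<in> arrs C. farr F f = farr G f)"

definition is_cat_iso :: "('o, 'a) cat \<Rightarrow> ('p, 'b) cat \<Rightarrow> ('o, 'a, 'p, 'b) functr \<Rightarrow> bool" where
  "is_cat_iso C D F \<longleftrightarrow> is_functor C D F \<and>
     (\<exists>G. is_functor D C G \<and> functor_eq C (functor_cmp F G) functor_id \<and>
          functor_eq D (functor_cmp G F) functor_id)"

section \<open>Limits and colimits\<close>

definition is_cone ::
    "('j, 'k) cat \<Rightarrow> ('o, 'a) cat \<Rightarrow> ('j, 'k, 'o, 'a) functr \<Rightarrow> 'o \<Rightarrow> ('j \<Rightarrow> 'a) \<Rightarrow> bool" where
  "is_cone J C D L \<pi> \<longleftrightarrow> L \<in> objs C \<and> (\<forall>j \<in> objs J. \<pi> j \<in> hom C L (fobj D j)) \<and>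
     (\<forall>u \<in> arrs J. cmp C (\<pi> (src J u)) (farr D u) = \<pi> (tgt J u))"

definition is_limit ::
    "('j, 'k) cat \<Rightarrow> ('o, 'a) cat \<Rightarrow> ('j, 'k, 'o, 'a) functr \<Rightarrow> 'o \<Rightarrow> ('j \<Rightarrow> 'a) \<Rightarrow> bool" where
  "is_limit J C D L \<pi> \<longleftrightarrow> is_cone J C D L \<pi> \<and>
     (\<forall>L' \<pi>'. is_cone J C D L' \<pi>' \<longrightarrow>
        (\<exists>!h. h \<in> hom C L' L \<and> (\<forall>j \<in> objs J. cmp C h (\<pi> j) = \<pi>' j)))"

text \<open>Every finite category is isomorphic to one whose objects and arrows are natural numbers, so
  it is enough to let the shapes range over these.\<close>

definition has_finite_limits :: "('o, 'a) cat \<Rightarrow> bool" where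
  "has_finite_limits C \<longleftrightarrow>
     (\<forall>(J :: (nat, nat) cat) D. finite (objs J) \<and> finite (arrs J) \<and> is_functor J C D \<longrightarrow>
        (\<exists>L \<pi>. is_limit J C D L \<pi>))"

definition has_finite_colimits :: "('o, 'a) cat \<Rightarrow> bool" where
  "has_finite_colimits C \<longleftrightarrow> has_finite_limits (op_cat C)"

definition is_terminal :: "('o, 'a) cat \<Rightarrow> 'o \<Rightarrow> bool" where
  "is_terminal C T \<longleftrightarrow> T \<in> objs C \<and> (\<forall>X \<in> objs C. \<exists>!f. f \<in> hom C X T)"

definition is_initial :: "('o, 'a) cat \<Rightarrow> 'o \<Rightarrow> bool" where
  "is_initial C I \<longleftrightarrow> is_terminal (op_cat C) I"

definition is_product :: "('o, 'a) cat \<Rightarrow> 'o \<Rightarrow> 'o \<Rightarrow> 'o \<Rightarrow> 'a \<Rightarrow> 'a \<Rightarrow> bool" where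
  "is_product C X1 X2 P p1 p2 \<longleftrightarrow> p1 \<in> hom C P X1 \<and> p2 \<in> hom C P X2 \<and>
     (\<forall>Z. \<forall>f1 \<in> hom C Z X1. \<forall>f2 \<in> hom C Z X2.
        \<exists>!h. h \<in> hom C Z P \<and> cmp C h p1 = f1 \<and> cmp C h p2 = f2)"

definition is_coproduct :: "('o, 'a) cat \<Rightarrow> 'o \<Rightarrow> 'o \<Rightarrow> 'o \<Rightarrow> 'a \<Rightarrow> 'a \<Rightarrow> bool" where
  "is_coproduct C X1 X2 Q e1 e2 \<longleftrightarrow> is_product (op_cat C) X1 X2 Q e1 e2"

definition has_finite_products :: "('o, 'a) cat \<Rightarrow> bool" where
  "has_finite_products C \<longleftrightarrow> (\<exists>T. is_terminal C T) \<and>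
     (\<forall>X1 \<in> objs C. \<forall>X2 \<in> objs C. \<exists>P p1 p2. is_product C X1 X2 P p1 p2)"

definition has_finite_coproducts :: "('o, 'a) cat \<Rightarrow> bool" where
  "has_finite_coproducts C \<longleftrightarrow> has_finite_products (op_cat C)"

text \<open>Preservation of all those finite products that exist in the source category. That the source
  category admits finite products is deliberately not part of the notion: the category of bifibrant
  objects of a model category need not admit them. (For sets with all maps as weak equivalences,
  injections as cofibrations and surjections as fibrations, the bifibrant objects are the nonempty
  sets, which have no initial object.)\<close>

definition preserves_finite_products ::
    "('o, 'a) cat \<Rightarrow> ('p, 'b) cat \<Rightarrow> ('o, 'a, 'p, 'b) functr \<Rightarrow> bool" where
  "preserves_finite_products C D F \<longleftrightarrow> is_functor C D F \<and>
     (\<forall>T. is_terminal C T \<longrightarrow> is_terminal D (fobj F T)) \<and>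
     (\<forall>X1 X2 P p1 p2. is_product C X1 X2 P p1 p2 \<longrightarrow>
        is_product D (fobj F X1) (fobj F X2) (fobj F P) (farr F p1) (farr F p2))"

definition preserves_finite_coproducts ::
    "('o, 'a) cat \<Rightarrow> ('p, 'b) cat \<Rightarrow> ('o, 'a, 'p, 'b) functr \<Rightarrow> bool" where
  "preserves_finite_coproducts C D F \<longleftrightarrow> is_functor C D F \<and>
     (\<forall>I. is_initial C I \<longrightarrow> is_initial D (fobj F I)) \<and>
     (\<forall>X1 X2 Q e1 e2. is_coproduct C X1 X2 Q e1 e2 \<longrightarrow>
        is_coproduct D (fobj F X1) (fobj F X2) (fobj F Q) (farr F e1) (farr F e2))"

section \<open>Squares\<close>

text \<open>The square \<open>f' p = p' f\<close> over the cospan \<open>f\<close>, \<open>p\<close>; thus \<open>p'\<close> is parallel to \<open>p\<close>, and \<open>f'\<close>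
  is parallel to \<open>f\<close>. In the opposite category this reads \<open>p f' = f p'\<close>, a square under the span
  \<open>f\<close>, \<open>p\<close>.\<close>

definition comm_square :: "('o, 'a) cat \<Rightarrow> 'a \<Rightarrow> 'a \<Rightarrow> 'a \<Rightarrow> 'a \<Rightarrow> bool" where
  "comm_square C f p f' p' \<longleftrightarrow>
     f \<in> arrs C \<and> p \<in> arrs C \<and> f' \<in> arrs C \<and> p' \<in> arrs C \<and>
     tgt C f = tgt C p \<and> src C f' = src C p' \<and> tgt C f' = src C p \<and> tgt C p' = src C f \<and>
     cmp C f' p = cmp C p' f"

definition is_weak_pullback :: "('o, 'a) cat \<Rightarrow> 'a \<Rightarrow> 'a \<Rightarrow> 'a \<Rightarrow> 'a \<Rightarrow> bool" where
  "is_weak_pullback C f p f' p' \<longleftrightarrow> comm_square C f p f' p' \<and>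
     (\<forall>u v. comm_square C f p u v \<longrightarrow>
        (\<exists>h. h \<in> hom C (src C u) (src C f') \<and> cmp C h f' = u \<and> cmp C h p' = v))"

definition is_pullback :: "('o, 'a) cat \<Rightarrow> 'a \<Rightarrow> 'a \<Rightarrow> 'a \<Rightarrow> 'a \<Rightarrow> bool" where
  "is_pullback C f p f' p' \<longleftrightarrow> comm_square C f p f' p' \<and>
     (\<forall>u v. comm_square C f p u v \<longrightarrow>
        (\<exists>!h. h \<in> hom C (src C u) (src C f') \<and> cmp C h f' = u \<and> cmp C h p' = v))"

definition is_weak_pushout :: "('o, 'a) cat \<Rightarrow> 'a \<Rightarrow> 'a \<Rightarrow> 'a \<Rightarrow> 'a \<Rightarrow> bool" where
  "is_weak_pushout C f i f' i' \<longleftrightarrow> is_weak_pullback (op_cat C) f i f' i'"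

definition is_pushout :: "('o, 'a) cat \<Rightarrow> 'a \<Rightarrow> 'a \<Rightarrow> 'a \<Rightarrow> 'a \<Rightarrow> bool" where
  "is_pushout C f i f' i' \<longleftrightarrow> is_pullback (op_cat C) f i f' i'"

section \<open>Quillen model categories\<close>

definition lifts_against :: "('o, 'a) cat \<Rightarrow> 'a \<Rightarrow> 'a \<Rightarrow> bool" where
  "lifts_against C i p \<longleftrightarrow>
     (\<forall>f \<in> hom C (src C i) (src C p). \<forall>g \<in> hom C (tgt C i) (tgt C p).
        cmp C f p = cmp C i g \<longrightarrow>
        (\<exists>h \<in> hom C (tgt C i) (src C p). cmp C i h = f \<and> cmp C h p = g))"

definition closed_under_cmp :: "('o, 'a) cat \<Rightarrow> 'a set \<Rightarrow> bool" where
  "closed_under_cmp C D \<longleftrightarrow> (\<forall>f \<in> D. \<forall>g \<in> D. tgt C f = src C g \<longrightarrow> cmp C f g \<in> D)"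

definition two_of_three :: "('o, 'a) cat \<Rightarrow> 'a set \<Rightarrow> bool" where
  "two_of_three C D \<longleftrightarrow> (\<forall>f \<in> arrs C. \<forall>g \<in> arrs C. tgt C f = src C g \<longrightarrow>
     (f \<in> D \<and> g \<in> D \<longrightarrow> cmp C f g \<in> D) \<and>
     (f \<in> D \<and> cmp C f g \<in> D \<longrightarrow> g \<in> D) \<and>
     (g \<in> D \<and> cmp C f g \<in> D \<longrightarrow> f \<in> D))"

record ('o, 'a) model_data =
  ucat :: "('o, 'a) cat"
  cofs :: "'a set"
  fibs :: "'a set"
  weqs :: "'a set"

locale quillen_model_category =
  fixes M :: "('o, 'a) model_data"
  assumes cat: "category (ucat M)"
    and cofs_arrs: "cofs M \<subseteq> arrs (ucat M)"
    and fibs_arrs: "fibs M \<subseteq> arrs (ucat M)"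
    and weqs_arrs: "weqs M \<subseteq> arrs (ucat M)"
    and finite_limits: "has_finite_limits (ucat M)"
    and finite_colimits: "has_finite_colimits (ucat M)"
    and lifting: "\<lbrakk>i \<in> cofs M; p \<in> fibs M; i \<in> weqs M \<or> p \<in> weqs M\<rbrakk>
      \<Longrightarrow> lifts_against (ucat M) i p"
    and fact_cof_acfib: "f \<in> arrs (ucat M) \<Longrightarrow>
      \<exists>i \<in> cofs M. \<exists>p \<in> fibs M \<inter> weqs M. tgt (ucat M) i = src (ucat M) p \<and> f = cmp (ucat M) i p"
    and fact_accof_fib: "f \<in> arrs (ucat M) \<Longrightarrow>
      \<exists>i \<in> cofs M \<inter> weqs M. \<exists>p \<in> fibs M. tgt (ucat M) i = src (ucat M) p \<and> f = cmp (ucat M) i p"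
    and fib_cmp: "closed_under_cmp (ucat M) (fibs M)"
    and fib_pullback: "\<lbrakk>p \<in> fibs M; is_pullback (ucat M) f p f' p'\<rbrakk> \<Longrightarrow> p' \<in> fibs M"
    and fib_iso: "is_iso (ucat M) f \<Longrightarrow> f \<in> fibs M"
    and cof_cmp: "closed_under_cmp (ucat M) (cofs M)"
    and cof_pushout: "\<lbrakk>i \<in> cofs M; is_pushout (ucat M) f i f' i'\<rbrakk> \<Longrightarrow> i' \<in> cofs M"
    and cof_iso: "is_iso (ucat M) f \<Longrightarrow> f \<in> cofs M"
    and acfib_pullback: "\<lbrakk>p \<in> fibs M \<inter> weqs M; is_pullback (ucat M) f p f' p'\<rbrakk> \<Longrightarrow> p' \<in> weqs M"
    and accof_pushout: "\<lbrakk>i \<in> cofs M \<inter> weqs M; is_pushout (ucat M) f i f' i'\<rbrakk> \<Longrightarrow> i' \<in> weqs M"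
    and weq_iso: "is_iso (ucat M) f \<Longrightarrow> f \<in> weqs M"
    and weq_two_of_three: "two_of_three (ucat M) (weqs M)"

locale closed_quillen_model_category = quillen_model_category +
  assumes fibs_determined:
      "fibs M = {p \<in> arrs (ucat M). \<forall>i \<in> cofs M \<inter> weqs M. lifts_against (ucat M) i p}"
    and cofs_determined:
      "cofs M = {i \<in> arrs (ucat M). \<forall>p \<in> fibs M \<inter> weqs M. lifts_against (ucat M) i p}"
    and weqs_determined:
      "weqs M = {cmp (ucat M) j q | j q. j \<in> arrs (ucat M) \<and> q \<in> arrs (ucat M) \<and>
         tgt (ucat M) j = src (ucat M) q \<and>
         (\<forall>p \<in> fibs M. lifts_against (ucat M) j p) \<and> (\<forall>i \<in> cofs M. lifts_against (ucat M) i q)}"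

definition cofibrant :: "('o, 'a) model_data \<Rightarrow> 'o \<Rightarrow> bool" where
  "cofibrant M X \<longleftrightarrow> X \<in> objs (ucat M) \<and>
     (\<exists>I f. is_initial (ucat M) I \<and> f \<in> hom (ucat M) I X \<and> f \<in> cofs M)"

definition fibrant :: "('o, 'a) model_data \<Rightarrow> 'o \<Rightarrow> bool" where
  "fibrant M X \<longleftrightarrow> X \<in> objs (ucat M) \<and>
     (\<exists>T f. is_terminal (ucat M) T \<and> f \<in> hom (ucat M) X T \<and> f \<in> fibs M)"

definition Cof :: "('o, 'a) model_data \<Rightarrow> ('o, 'a) cat" where
  "Cof M = full_subcat (ucat M) {X. cofibrant M X}"

definition Fib :: "('o, 'a) model_data \<Rightarrow> ('o, 'a) cat" where
  "Fib M = full_subcat (ucat M) {X. fibrant M X}"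

definition Bif :: "('o, 'a) model_data \<Rightarrow> ('o, 'a) cat" where
  "Bif M = full_subcat (ucat M) {X. cofibrant M X \<and> fibrant M X}"

section \<open>Localisations\<close>

text \<open>The universal property quantifies over all categories \<open>E\<close>. A single formula of HOL can only
  quantify over the categories of one type, so the types of the objects and arrows of \<open>E\<close> are
  parameters.\<close>

definition is_localisation ::
    "'q itself \<Rightarrow> 'c itself \<Rightarrow> ('o, 'a) cat \<Rightarrow> 'a set \<Rightarrow>
     ('p, 'b) cat \<Rightarrow> ('o, 'a, 'p, 'b) functr \<Rightarrow> bool" where
  "is_localisation (_ :: 'q itself) (_ :: 'c itself) C Den L l \<longleftrightarrow>
     is_functor C L l \<and> (\<forall>d \<in> Den. is_iso L (farr l d)) \<and>
     (\<forall>(E :: ('q, 'c) cat) F. is_functor C E F \<and> (\<forall>d \<in> Den. is_iso E (farr F d)) \<longrightarrow>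
        (\<exists>G. is_functor L E G \<and> functor_eq C (functor_cmp l G) F \<and>
           (\<forall>G'. is_functor L E G' \<and> functor_eq C (functor_cmp l G') F \<longrightarrow> functor_eq L G' G)))"

section \<open>Uni-fractionable categories\<close>

definition multiplicative :: "('o, 'a) cat \<Rightarrow> 'a set \<Rightarrow> bool" where
  "multiplicative C D \<longleftrightarrow> D \<subseteq> arrs C \<and> (\<forall>X \<in> objs C. ident C X \<in> D) \<and> closed_under_cmp C D"

definition semi_saturated :: "('o, 'a) cat \<Rightarrow> 'a set \<Rightarrow> bool" where
  "semi_saturated C D \<longleftrightarrow> multiplicative C D \<and> two_of_three C D"

record ('o, 'a) den_cat =
  base :: "('o, 'a) cat"
  Den :: "'a set"
  SDen :: "'a set"
  TDen :: "'a set"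

locale uni_fractionable_category =
  fixes U :: "('o, 'a) den_cat"
  assumes cat: "category (base U)"
    and Den_semi_saturated: "semi_saturated (base U) (Den U)"
    and SDen_multiplicative: "multiplicative (base U) (SDen U)"
    and TDen_multiplicative: "multiplicative (base U) (TDen U)"
    and SDen_Den: "SDen U \<subseteq> Den U"
    and TDen_Den: "TDen U \<subseteq> Den U"
    and weak_pushout: "\<lbrakk>i \<in> SDen U; f \<in> arrs (base U); src (base U) f = src (base U) i\<rbrakk>
      \<Longrightarrow> \<exists>f' i'. is_weak_pushout (base U) f i f' i' \<and> i' \<in> SDen U"
    and weak_pullback: "\<lbrakk>p \<in> TDen U; f \<in> arrs (base U); tgt (base U) f = tgt (base U) p\<rbrakk>
      \<Longrightarrow> \<exists>f' p'. is_weak_pullback (base U) f p f' p' \<and> p' \<in> TDen U"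
    and factorisation: "d \<in> Den U \<Longrightarrow>
      \<exists>i \<in> SDen U. \<exists>p \<in> TDen U. tgt (base U) i = src (base U) p \<and> d = cmp (base U) i p"

section \<open>The fraction category\<close>

text \<open>A 3-arrow \<open>(b, f, a)\<close> has source \<open>tgt b\<close> and target \<open>src a\<close>.\<close>

type_synonym 'a three_arrow = "'a \<times> 'a \<times> 'a"

definition three_arrows :: "('o, 'a) den_cat \<Rightarrow> 'a three_arrow set" where
  "three_arrows U = {(b, f, a). b \<in> Den U \<and> f \<in> arrs (base U) \<and> a \<in> Den U \<and>
     src (base U) b = src (base U) f \<and> tgt (base U) f = tgt (base U) a}"

inductive_set frac_equality :: "('o, 'a) den_cat \<Rightarrow> 'a three_arrow rel" for U where
  extend_right: "\<lbrakk>(b, f, a) \<in> three_arrows U; c \<in> arrs (base U); tgt (base U) f = src (base U) c;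
      cmp (base U) a c \<in> Den U\<rbrakk>
    \<Longrightarrow> ((b, f, a), (b, cmp (base U) f c, cmp (base U) a c)) \<in> frac_equality U"
| extend_left: "\<lbrakk>(b, f, a) \<in> three_arrows U; c \<in> arrs (base U); tgt (base U) c = src (base U) f;
      cmp (base U) c b \<in> Den U\<rbrakk>
    \<Longrightarrow> ((b, f, a), (cmp (base U) c b, cmp (base U) c f, a)) \<in> frac_equality U"
| refl: "s \<in> three_arrows U \<Longrightarrow> (s, s) \<in> frac_equality U"
| sym: "(s, t) \<in> frac_equality U \<Longrightarrow> (t, s) \<in> frac_equality U"
| trans: "\<lbrakk>(s, t) \<in> frac_equality U; (t, u) \<in> frac_equality U\<rbrakk> \<Longrightarrow> (s, u) \<in> frac_equality U"

definition double_frac :: "('o, 'a) den_cat \<Rightarrow> 'a \<Rightarrow> 'a \<Rightarrow> 'a \<Rightarrow> 'a three_arrow set" where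
  "double_frac U b f a = frac_equality U `` {(b, f, a)}"

text \<open>\<open>frac_composite U s t r\<close>: the 3-arrow \<open>r\<close> arises from composing the 3-arrows \<open>s\<close> and \<open>t\<close> with
  some choice of \<open>j\<close>, \<open>q\<close>, \<open>q'\<close>, \<open>f1'\<close>, \<open>j'\<close>, \<open>f2'\<close>, where \<open>b2 a1 = j q\<close>, \<open>f1' q = q' f1\<close> and
  \<open>j f2' = f2 j'\<close>.\<close>

definition frac_composite ::
    "('o, 'a) den_cat \<Rightarrow> 'a three_arrow \<Rightarrow> 'a three_arrow \<Rightarrow> 'a three_arrow \<Rightarrow> bool" where
  "frac_composite U = (\<lambda>(b1, f1, a1) (b2, f2, a2) r. let C = base U in
     \<exists>j \<in> SDen U. \<exists>q \<in> TDen U. \<exists>q' \<in> TDen U. \<exists>j' \<in> SDen U. \<exists>f1' f2'.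
       tgt C j = src C q \<and> cmp C b2 a1 = cmp C j q \<and>
       comm_square C f1 q f1' q' \<and> comm_square (op_cat C) f2 j f2' j' \<and>
       r = (cmp C q' b1, cmp C f1' f2', cmp C a2 j'))"

definition Frac :: "('o, 'a) den_cat \<Rightarrow> ('o, 'a three_arrow set) cat" where
  "Frac U = \<lparr>objs = objs (base U),
     arrs = three_arrows U // frac_equality U,
     src = (\<lambda>\<alpha>. THE X. \<exists>(b, f, a) \<in> \<alpha>. X = tgt (base U) b),
     tgt = (\<lambda>\<alpha>. THE Y. \<exists>(b, f, a) \<in> \<alpha>. Y = src (base U) a),
     ident = (\<lambda>X. double_frac U (ident (base U) X) (ident (base U) X) (ident (base U) X)),
     cmp = (\<lambda>\<alpha> \<beta>. THE \<gamma>. \<exists>s \<in> \<alpha>. \<exists>t \<in> \<beta>. \<exists>b f a.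
        frac_composite U s t (b, f, a) \<and> \<gamma> = double_frac U b f a)\<rparr>"

definition loc :: "('o, 'a) den_cat \<Rightarrow> ('o, 'a, 'o, 'a three_arrow set) functr" where
  "loc U = \<lparr>fobj = (\<lambda>X. X),
     farr = (\<lambda>f. double_frac U (ident (base U) (src (base U) f)) f
       (ident (base U) (tgt (base U) f)))\<rparr>"

definition saturated :: "('o, 'a) den_cat \<Rightarrow> bool" where
  "saturated U \<longleftrightarrow> (\<forall>f \<in> arrs (base U). is_iso (Frac U) (farr (loc U) f) \<longrightarrow> f \<in> Den U)"

text \<open>Here \<open>C\<close> is meant to be a full subcategory of \<open>ucat M\<close>.\<close>

definition model_den_cat :: "('o, 'a) model_data \<Rightarrow> ('o, 'a) cat \<Rightarrow> ('o, 'a) den_cat" where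
  "model_den_cat M C = \<lparr>base = C,
     Den = {w \<in> arrs C. w \<in> weqs M},
     SDen = {i \<in> arrs C. i \<in> cofs M \<inter> weqs M},
     TDen = {p \<in> arrs C. p \<in> fibs M \<inter> weqs M}\<rparr>"

end

(*
Let F(X, Y) be the set of double fractions from X to Y. Postcomposition with a morphism f acts on
F(X, -): after factoring the right denominator of a 3-arrow as an S-denominator followed by a
T-denominator and moving the latter to the left by a weak pullback, a weak pushout along f can be
formed. Once this is well defined, F(X, -) is a functor that inverts denominators, and the class of
(b, f, a) acts as "undo b, apply f, undo a"; the composition of double fractions is this action.

Saturation: the middle part of a 3-arrow equal to an identity is a denominator. So if f has an
inverse represented by g, then f g and g f are denominators up to changes of f and g by
denominators, and two-out-of-six suffices. In a closed model category it reduces, by one pullback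
and one pushout, to the closure of weak equivalences under retracts.

Coproducts: for Y cofibrant and an acyclic cofibration r from Y to a fibrant R, the morphisms from X
to Y in the fraction category are the homotopy classes of morphisms from X to R with respect to a
fixed path object of R, and such homotopies can be glued along a coproduct. Products are dual.
*)

theory Submission
  imports Defs
begin

text \<open>Only S-denominators are assumed to have weak pushouts, and these are not unique, so two
  composites of the same fractions differ in several choices at once. The action isolates one choice
  at a time: a morphism is compared along different completions of a single square, and all
  completions factor through a weak pushout. Afterwards denominators act bijectively, every
  composite 3-arrow turns out to represent the value of the action, and associativity, units and
  independence of choices become formal.

  Weak squares are unavoidable in the subcategories: a pushout may leave the fibrant objects, and a
  fibrant replacement brings it back at the price of non-unique extensions.

  Homotopies use a path object of the target rather than a cylinder of the source, because the
  source of interest is a coproduct formed in the subcategory. The target \<open>R\<close> can be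
  chosen bifibrant; then its path object is bifibrant as well and lies in the subcategory, so the
  universal property of the coproduct applies to morphisms into it.\<close>

context category
begin

abbreviation seq (infixr ";;" 70) where "f ;; g \<equiv> cmp C f g"

lemma seq_arr [simp]: "\<lbrakk>f \<in> arrs C; g \<in> arrs C; tgt C f = src C g\<rbrakk> \<Longrightarrow> f ;; g \<in> arrs C"
  and src_seq [simp]: "\<lbrakk>f \<in> arrs C; g \<in> arrs C; tgt C f = src C g\<rbrakk> \<Longrightarrow> src C (f ;; g) = src C f"
  and tgt_seq [simp]: "\<lbrakk>f \<in> arrs C; g \<in> arrs C; tgt C f = src C g\<rbrakk> \<Longrightarrow> tgt C (f ;; g) = tgt C g"
  using cmp_hom unfolding hom_def by blast+

lemma ident_arr [simp]: "X \<in> objs C \<Longrightarrow> ident C X \<in> arrs C"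
  and src_ident [simp]: "X \<in> objs C \<Longrightarrow> src C (ident C X) = X"
  and tgt_ident [simp]: "X \<in> objs C \<Longrightarrow> tgt C (ident C X) = X"
  using ident_hom unfolding hom_def by blast+

lemma ident_seq [simp]: "\<lbrakk>f \<in> arrs C; src C f = X\<rbrakk> \<Longrightarrow> ident C X ;; f = f"
  and seq_ident [simp]: "\<lbrakk>f \<in> arrs C; tgt C f = X\<rbrakk> \<Longrightarrow> f ;; ident C X = f"
  using ident_cmp cmp_ident by blast+

lemmas seq_assoc [simp] = cmp_assoc

lemma src_obj' [simp]: "f \<in> arrs C \<Longrightarrow> src C f \<in> objs C"
  and tgt_obj' [simp]: "f \<in> arrs C \<Longrightarrow> tgt C f \<in> objs C"
  by (rule src_obj tgt_obj; assumption)+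

text \<open>Simplification nests composites to the right, so an equation of two composites no longer
  matches once a further arrow follows; this form applies there.\<close>

lemma seq_eq_extend:
  assumes "f ;; g = h ;; k" "f \<in> arrs C" "g \<in> arrs C" "h \<in> arrs C" "k \<in> arrs C" "x \<in> arrs C"
    "tgt C f = src C g" "tgt C h = src C k" "tgt C g = src C x" "tgt C k = src C x"
  shows "f ;; g ;; x = h ;; k ;; x"
  using assms by (metis cmp_assoc)

end

section \<open>Opposite categories\<close>

lemma op_cat_simps [simp]:
  "objs (op_cat C) = objs C" "arrs (op_cat C) = arrs C" "src (op_cat C) = tgt C"
  "tgt (op_cat C) = src C" "ident (op_cat C) = ident C" "cmp (op_cat C) f g = cmp C g f"
  by (simp_all add: op_cat_def)

lemma op_cat_op_cat [simp]: "op_cat (op_cat C) = C"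
  by (simp add: op_cat_def)

lemma hom_op_cat [simp]: "hom (op_cat C) X Y = hom C Y X"
  by (auto simp: hom_def)

section \<open>The fraction category of a uni-fractionable category\<close>

context uni_fractionable_category
begin

sublocale category "base U" by (rule cat)

notation seq (infixr ";;" 70)

abbreviation arr where "arr \<equiv> arrs (base U)"
abbreviation dom where "dom \<equiv> src (base U)"
abbreviation cod where "cod \<equiv> tgt (base U)"
abbreviation one where "one \<equiv> ident (base U)"
abbreviation T3 where "T3 \<equiv> three_arrows U"
abbreviation eqv (infix "\<approx>" 50) where "s \<approx> t \<equiv> (s, t) \<in> frac_equality U"

lemma Den_arr [simp]: "d \<in> Den U \<Longrightarrow> d \<in> arr"
  using Den_semi_saturated unfolding semi_saturated_def multiplicative_def by blast

lemma one_Den [simp]: "X \<in> objs (base U) \<Longrightarrow> one X \<in> Den U"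
  using Den_semi_saturated unfolding semi_saturated_def multiplicative_def by blast

lemma Den_seq [simp]: "\<lbrakk>d \<in> Den U; e \<in> Den U; cod d = dom e\<rbrakk> \<Longrightarrow> d ;; e \<in> Den U"
  using Den_semi_saturated
  unfolding semi_saturated_def multiplicative_def closed_under_cmp_def by blast

lemma Den_cancel_left: "\<lbrakk>d ;; e \<in> Den U; d \<in> Den U; e \<in> arr; cod d = dom e\<rbrakk> \<Longrightarrow> e \<in> Den U"
  using Den_semi_saturated Den_arr unfolding semi_saturated_def two_of_three_def by blast

lemma Den_cancel_right: "\<lbrakk>d ;; e \<in> Den U; e \<in> Den U; d \<in> arr; cod d = dom e\<rbrakk> \<Longrightarrow> d \<in> Den U"
  using Den_semi_saturated Den_arr unfolding semi_saturated_def two_of_three_def by blast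

lemma SDen_Den' [simp]: "i \<in> SDen U \<Longrightarrow> i \<in> Den U"
  and TDen_Den' [simp]: "i \<in> TDen U \<Longrightarrow> i \<in> Den U"
  using SDen_Den TDen_Den by blast+

lemma SDen_seq [simp]: "\<lbrakk>i \<in> SDen U; j \<in> SDen U; cod i = dom j\<rbrakk> \<Longrightarrow> i ;; j \<in> SDen U"
  using SDen_multiplicative unfolding multiplicative_def closed_under_cmp_def by blast

lemma one_SDen [simp]: "X \<in> objs (base U) \<Longrightarrow> one X \<in> SDen U"
  and one_TDen [simp]: "X \<in> objs (base U) \<Longrightarrow> one X \<in> TDen U"
  using SDen_multiplicative TDen_multiplicative unfolding multiplicative_def by blast+

lemma SDen_pushout:
  assumes "i \<in> SDen U" "f \<in> arr" "dom f = dom i"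
  obtains f' i' where "f' \<in> arr" "i' \<in> SDen U" "dom f' = cod i" "dom i' = cod f"
    "cod i' = cod f'" "i ;; f' = f ;; i'"
    "\<And>u v. \<lbrakk>u \<in> arr; v \<in> arr; dom u = cod i; dom v = cod f; cod u = cod v; i ;; u = f ;; v\<rbrakk>
      \<Longrightarrow> \<exists>h \<in> arr. dom h = cod f' \<and> cod h = cod u \<and> f' ;; h = u \<and> i' ;; h = v"
proof -
  obtain f' i' where *: "is_weak_pushout (base U) f i f' i'" "i' \<in> SDen U"
    using weak_pushout[OF assms] by blast
  have univ: "\<exists>h \<in> arr. dom h = cod f' \<and> cod h = cod u \<and> f' ;; h = u \<and> i' ;; h = v"
    if "u \<in> arr" "v \<in> arr" "dom u = cod i" "dom v = cod f" "cod u = cod v" "i ;; u = f ;; v" for u v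
  proof -
    have "comm_square (op_cat (base U)) f i u v"
      using assms that by (simp add: comm_square_def)
    then obtain h where "h \<in> hom (op_cat (base U)) (cod u) (cod f')" "f' ;; h = u" "i' ;; h = v"
      using *(1) unfolding is_weak_pushout_def is_weak_pullback_def by auto
    then show ?thesis by (intro bexI[of _ h]) (auto simp: hom_def)
  qed
  show thesis
    by (rule that[of f' i'])
      (use * univ in \<open>auto simp: is_weak_pushout_def is_weak_pullback_def comm_square_def\<close>)
qed

lemma SDen_square:
  assumes "i \<in> SDen U" "f \<in> arr" "dom f = dom i"
  obtains f' i' where "f' \<in> arr" "i' \<in> SDen U" "dom f' = cod i" "dom i' = cod f"
    "cod f' = cod i'" "i ;; f' = f ;; i'"
proof (rule SDen_pushout[OF assms], goal_cases)
  case (1 f' i')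
  show thesis by (rule that[OF 1(2-5) 1(6)[symmetric] 1(7)])
qed

lemma TDen_pullback:
  assumes "p \<in> TDen U" "f \<in> arr" "cod f = cod p"
  obtains f' p' where "f' \<in> arr" "p' \<in> TDen U" "cod f' = dom p" "cod p' = dom f"
    "dom p' = dom f'" "f' ;; p = p' ;; f"
    "\<And>u v. \<lbrakk>u \<in> arr; v \<in> arr; cod u = dom p; cod v = dom f; dom u = dom v; u ;; p = v ;; f\<rbrakk>
      \<Longrightarrow> \<exists>h \<in> arr. cod h = dom f' \<and> dom h = dom u \<and> h ;; f' = u \<and> h ;; p' = v"
proof -
  obtain f' p' where *: "is_weak_pullback (base U) f p f' p'" "p' \<in> TDen U"
    using weak_pullback[OF assms] by blast
  have univ: "\<exists>h \<in> arr. cod h = dom f' \<and> dom h = dom u \<and> h ;; f' = u \<and> h ;; p' = v"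
    if "u \<in> arr" "v \<in> arr" "cod u = dom p" "cod v = dom f" "dom u = dom v" "u ;; p = v ;; f" for u v
  proof -
    have "comm_square (base U) f p u v"
      using assms that by (simp add: comm_square_def)
    then obtain h where "h \<in> hom (base U) (dom u) (dom f')" "h ;; f' = u" "h ;; p' = v"
      using *(1) unfolding is_weak_pullback_def by auto
    then show ?thesis by (intro bexI[of _ h]) (auto simp: hom_def)
  qed
  show thesis
    by (rule that[of f' p'])
      (use * univ in \<open>auto simp: is_weak_pullback_def comm_square_def\<close>)
qed

lemma TDen_square:
  assumes "p \<in> TDen U" "f \<in> arr" "cod f = cod p"
  obtains f' p' where "f' \<in> arr" "p' \<in> TDen U" "cod f' = dom p" "cod p' = dom f"
    "dom f' = dom p'" "f' ;; p = p' ;; f"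
proof (rule TDen_pullback[OF assms], goal_cases)
  case (1 f' p')
  show thesis by (rule that[OF 1(2-5) 1(6)[symmetric] 1(7)])
qed

lemma Den_factor:
  assumes "d \<in> Den U"
  obtains i p where "i \<in> SDen U" "p \<in> TDen U" "cod i = dom p" "d = i ;; p"
  using factorisation[OF assms] by blast

lemma T3_iff: "(b, f, a) \<in> T3 \<longleftrightarrow>
    b \<in> Den U \<and> f \<in> arr \<and> a \<in> Den U \<and> dom b = dom f \<and> cod f = cod a"
  by (simp add: three_arrows_def)

lemma T3D:
  assumes "(b, f, a) \<in> T3"
  shows "b \<in> Den U" "f \<in> arr" "a \<in> Den U" "dom b = dom f" "cod f = cod a"
  using assms by (simp_all add: T3_iff)

lemma eqv_right:
  assumes "(b, f, a) \<in> T3" "c \<in> arr" "cod f = dom c" "a ;; c \<in> Den U"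
  shows "(b, f, a) \<approx> (b, f ;; c, a ;; c)"
  using assms by (rule frac_equality.extend_right)

lemma eqv_left:
  assumes "(b, f, a) \<in> T3" "c \<in> arr" "cod c = dom f" "c ;; b \<in> Den U"
  shows "(b, f, a) \<approx> (c ;; b, c ;; f, a)"
  using assms by (rule frac_equality.extend_left)

lemma eqv_right_eq:
  assumes "(b, f, a) \<in> T3" "c \<in> arr" "cod f = dom c" "a' \<in> Den U" "f ;; c = f'" "a ;; c = a'"
  shows "(b, f, a) \<approx> (b, f', a')"
  using assms frac_equality.extend_right by metis

lemma eqv_left_eq:
  assumes "(b, f, a) \<in> T3" "c \<in> arr" "cod c = dom f" "b' \<in> Den U" "c ;; b = b'" "c ;; f = f'"
  shows "(b, f, a) \<approx> (b', f', a)"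
  using assms frac_equality.extend_left by metis

lemmas eqv_sym = frac_equality.sym
lemmas eqv_trans [trans] = frac_equality.trans
lemmas eqv_refl = frac_equality.refl

lemma eqv_join: "\<lbrakk>s \<approx> u; t \<approx> u\<rbrakk> \<Longrightarrow> s \<approx> t"
  by (rule eqv_trans[OF _ eqv_sym])

definition src3 where "src3 = (\<lambda>(b, f, a). cod b)"
definition tgt3 where "tgt3 = (\<lambda>(b, f, a). dom a)"

lemma src3_simp [simp]: "src3 (b, f, a) = cod b"
  and tgt3_simp [simp]: "tgt3 (b, f, a) = dom a"
  by (simp_all add: src3_def tgt3_def)

lemma eqv_T3:
  assumes "s \<approx> t"
  shows "s \<in> T3 \<and> t \<in> T3 \<and> src3 s = src3 t \<and> tgt3 s = tgt3 t"
  using assms by (induction) (auto simp: T3_iff)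

lemma equiv_frac: "equiv T3 (frac_equality U)"
proof (rule equivI)
  show "refl_on T3 (frac_equality U)"
    using eqv_T3 eqv_refl by (auto simp: refl_on_def)
  show "sym (frac_equality U)" by (auto simp: sym_def intro: eqv_sym)
  show "trans (frac_equality U)" by (auto simp: trans_def intro: eqv_trans)
  show "frac_equality U \<subseteq> T3 \<times> T3" using eqv_T3 by auto
qed

definition cls where "cls s = frac_equality U `` {s}"

lemma cls_eq_iff: "\<lbrakk>s \<in> T3; t \<in> T3\<rbrakk> \<Longrightarrow> cls s = cls t \<longleftrightarrow> s \<approx> t"
  unfolding cls_def using equiv_frac by (simp add: eq_equiv_class_iff)

lemma cls_eqI: "s \<approx> t \<Longrightarrow> cls s = cls t"
  unfolding cls_def using equiv_frac equiv_class_eq by fast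

lemma in_cls_iff: "t \<in> cls s \<longleftrightarrow> s \<approx> t"
  by (simp add: cls_def)

lemma double_frac_cls: "double_frac U b f a = cls (b, f, a)"
  by (simp add: double_frac_def cls_def)

text \<open>Stands in for \<open>hom (Frac U)\<close>, whose source and target are definite
  descriptions; \<open>Frac_hom\<close> identifies the two.\<close>

definition frac_hom where "frac_hom X Y = {cls s |s. s \<in> T3 \<and> src3 s = X \<and> tgt3 s = Y}"

lemma cls_in_frac_hom [intro]:
  "\<lbrakk>(b, f, a) \<in> T3; cod b = X; dom a = Y\<rbrakk> \<Longrightarrow> cls (b, f, a) \<in> frac_hom X Y"
  unfolding frac_hom_def by force

lemma frac_homE:
  assumes "A \<in> frac_hom X Y"
  obtains b f a where "(b, f, a) \<in> T3" "cod b = X" "dom a = Y" "A = cls (b, f, a)"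
  using assms unfolding frac_hom_def by fastforce

subsection \<open>Postcomposition with a morphism\<close>

text \<open>\<open>push f s t\<close>: the 3-arrow \<open>t\<close> represents \<open>s\<close> followed by \<open>f\<close>. The denominator \<open>a\<close> of
  \<open>s\<close> is replaced by an S-denominator \<open>i\<close>, which can be pushed out along \<open>f\<close>.\<close>

definition push where
  "push f s t \<longleftrightarrow> (\<exists>b g a q g' i p h a'. s = (b, g, a) \<and> t = (q ;; b, g' ;; h, a') \<and>
     s \<in> T3 \<and> f \<in> arr \<and> i \<in> SDen U \<and> p \<in> arr \<and> q \<in> Den U \<and> g' \<in> arr \<and> h \<in> arr \<and> a' \<in> Den U \<and>
     dom f = dom a \<and> cod i = dom p \<and> cod q = dom g \<and> dom g' = dom q \<and> cod g' = cod i \<and>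
     dom h = cod i \<and> dom a' = cod f \<and> cod h = cod a' \<and>
     a = i ;; p \<and> g' ;; p = q ;; g \<and> i ;; h = f ;; a')"

lemma pushI:
  assumes "(b, g, a) \<in> T3" "f \<in> arr" "i \<in> SDen U" "p \<in> arr" "q \<in> Den U" "g' \<in> arr" "h \<in> arr" "a' \<in> Den U"
     "dom f = dom a" "cod i = dom p" "cod q = dom g" "dom g' = dom q" "cod g' = cod i"
     "dom h = cod i" "dom a' = cod f" "cod h = cod a'"
     "a = i ;; p" "g' ;; p = q ;; g" "i ;; h = f ;; a'"
  shows "push f (b, g, a) (q ;; b, g' ;; h, a')"
  unfolding push_def using assms by blast

lemma pushE:
  assumes "push f (b, g, a) t"
  obtains q g' i p h a' where "t = (q ;; b, g' ;; h, a')"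
     "(b, g, a) \<in> T3" "f \<in> arr" "i \<in> SDen U" "p \<in> arr" "q \<in> Den U" "g' \<in> arr" "h \<in> arr" "a' \<in> Den U"
     "dom f = dom a" "cod i = dom p" "cod q = dom g" "dom g' = dom q" "cod g' = cod i"
     "dom h = cod i" "dom a' = cod f" "cod h = cod a'"
     "a = i ;; p" "g' ;; p = q ;; g" "i ;; h = f ;; a'"
  using assms unfolding push_def by auto

text \<open>Factor \<open>a = i p\<close> and pull \<open>g\<close> back along \<open>p\<close> to
  \<open>g'\<close>, with \<open>q\<close> parallel to \<open>p\<close>. Extending
  \<open>(b, g, a)\<close> on the left by \<open>q\<close> and \<open>(q b, g', i)\<close> on the
  right by \<open>p\<close> gives the same 3-arrow.\<close>

lemma S_normal_form:
  assumes "(b, g, a) \<in> T3"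
  obtains q g' i p where "i \<in> SDen U" "p \<in> TDen U" "q \<in> TDen U" "g' \<in> arr"
     "cod i = dom p" "cod q = dom g" "dom g' = dom q" "cod g' = cod i"
     "a = i ;; p" "g' ;; p = q ;; g" "(b, g, a) \<approx> (q ;; b, g', i)"
proof -
  note g = T3D[OF assms]
  obtain i p where ip: "i \<in> SDen U" "p \<in> TDen U" "cod i = dom p" "a = i ;; p"
    using Den_factor[OF g(3)] by blast
  have "cod g = cod p" using g ip by simp
  then obtain g' q where q: "g' \<in> arr" "q \<in> TDen U" "cod g' = dom p" "cod q = dom g"
    "dom g' = dom q" "g' ;; p = q ;; g"
    using TDen_square[OF ip(2) g(2)] by metis
  have "(q ;; b, g', i) \<approx> (q ;; b, q ;; g, a)"
    by (rule eqv_right_eq[where c = p]) (use g ip q in \<open>auto simp: T3_iff\<close>)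
  moreover have "(b, g, a) \<approx> (q ;; b, q ;; g, a)"
    by (rule eqv_left) (use assms g ip q in auto)
  ultimately have "(b, g, a) \<approx> (q ;; b, g', i)" by (rule eqv_sym[OF eqv_join])
  moreover have "cod g' = cod i" using ip q by simp
  ultimately show thesis using that[OF ip(1,2) q(2,1) ip(3) q(4,5) _ ip(4) q(6)] by blast
qed

lemma push_total:
  assumes "s \<in> T3" "f \<in> arr" "dom f = tgt3 s"
  shows "\<exists>t. push f s t"
proof -
  obtain b g a where s: "s = (b, g, a)" by (rule prod_cases3)
  have g: "b \<in> Den U" "g \<in> arr" "a \<in> Den U" "dom b = dom g" "cod g = cod a" "dom f = dom a"
    using assms s by (auto simp: T3_iff)
  obtain q g' i p where n: "i \<in> SDen U" "p \<in> TDen U" "q \<in> TDen U" "g' \<in> arr"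
     "cod i = dom p" "cod q = dom g" "dom g' = dom q" "cod g' = cod i"
     "a = i ;; p" "g' ;; p = q ;; g"
    using assms(1) unfolding s by (rule S_normal_form)
  have "dom f = dom i" using g n by simp
  then obtain h a' where "h \<in> arr" "a' \<in> SDen U" "dom h = cod i" "dom a' = cod f"
    "cod h = cod a'" "i ;; h = f ;; a'"
    using SDen_square[OF n(1) assms(2)] by metis
  then have "push f s (q ;; b, g' ;; h, a')"
    unfolding s by (intro pushI[where p = p and i = i]) (use n g assms(1,2) s in auto)
  then show ?thesis by blast
qed

text \<open>Every completion of the span \<open>i\<close>, \<open>f\<close> factors through a weak
  pushout \<open>(k, c)\<close> of it, so the completion may be changed freely, in particular to one
  coming from \<open>w = i u\<close>. The arrow \<open>m\<close> then absorbs the change of the left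
  denominator.\<close>

lemma push_aux:
  assumes "b \<in> Den U" "q \<in> Den U" "g' \<in> arr" "i \<in> SDen U" "h \<in> arr" "a' \<in> Den U" "f \<in> arr"
    "cod q = dom b" "dom g' = dom q" "cod g' = cod i" "dom i = dom f" "dom h = cod i"
    "dom a' = cod f" "cod h = cod a'" "i ;; h = f ;; a'"
    and "u \<in> arr" "dom u = cod i" "w = i ;; u"
    and "h0 \<in> arr" "a0 \<in> Den U" "dom h0 = cod u" "dom a0 = cod f" "cod h0 = cod a0"
      "w ;; h0 = f ;; a0"
    and "q0 \<in> Den U" "g0 \<in> arr" "m \<in> arr" "dom m = dom q" "cod m = dom q0" "dom g0 = dom q0"
      "cod g0 = cod u" "cod q0 = dom b" "m ;; q0 = q" "m ;; g0 = g' ;; u"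
  shows "(q ;; b, g' ;; h, a') \<approx> (q0 ;; b, g0 ;; h0, a0)"
proof -
  note A = assms
  obtain k c where k: "k \<in> arr" "c \<in> SDen U" "dom k = cod i" "dom c = cod f"
    "cod c = cod k" "i ;; k = f ;; c"
    and univ: "\<And>u v. \<lbrakk>u \<in> arr; v \<in> arr; dom u = cod i; dom v = cod f; cod u = cod v; i ;; u = f ;; v\<rbrakk>
      \<Longrightarrow> \<exists>h \<in> arr. dom h = cod k \<and> cod h = cod u \<and> k ;; h = u \<and> c ;; h = v"
    by (rule SDen_pushout[OF A(4) A(7)]) (use A in auto)
  obtain x where x: "x \<in> arr" "dom x = cod k" "cod x = cod h" "k ;; x = h" "c ;; x = a'"
    using univ[of h a'] A by auto
  have "i ;; (u ;; h0) = f ;; a0" using A by simp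
  then obtain y where y: "y \<in> arr" "dom y = cod k" "cod y = cod h0" "k ;; y = u ;; h0" "c ;; y = a0"
    using univ[of "u ;; h0" a0] A by auto
  have n: "(q ;; b, g' ;; k, c) \<in> T3" using A k by (auto simp: T3_iff)
  have "(q ;; b, g' ;; k, c) \<approx> (q ;; b, g' ;; h, a')"
    by (rule eqv_right_eq[OF n, of x]) (use A k x in auto)
  then have "(q ;; b, g' ;; h, a') \<approx> (q ;; b, g' ;; k, c)" by (rule eqv_sym)
  also have "(q ;; b, g' ;; k, c) \<approx> (q ;; b, g' ;; u ;; h0, a0)"
    by (rule eqv_right_eq[OF n, of y]) (use A k y in auto)
  also have "(q0 ;; b, g0 ;; h0, a0) \<approx> (q ;; b, g' ;; u ;; h0, a0)"
  proof (rule eqv_left_eq[where c = m])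
    show "m ;; q0 ;; b = q ;; b" using A cmp_assoc[of m q0 b] by auto
    show "m ;; g0 ;; h0 = g' ;; u ;; h0" by (rule seq_eq_extend) (use A in auto)
  qed (use A in \<open>auto simp: T3_iff\<close>)
  then have "(q ;; b, g' ;; u ;; h0, a0) \<approx> (q0 ;; b, g0 ;; h0, a0)" by (rule eqv_sym)
  finally show ?thesis .
qed

text \<open>Two factorisations \<open>a = i\<^sub>1 p\<^sub>1 = i\<^sub>2 p\<^sub>2\<close> are dominated by a third one, obtained from a
  weak pushout of \<open>i\<^sub>1\<close> and \<open>i\<^sub>2\<close>.\<close>

lemma push_functional:
  assumes "push f s t1" "push f s t2"
  shows "t1 \<approx> t2"
proof -
  obtain b g a where s: "s = (b, g, a)" by (rule prod_cases3)
  obtain q1 g1 i1 p1 h1 a1 where 1: "t1 = (q1 ;; b, g1 ;; h1, a1)"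
     "(b, g, a) \<in> T3" "f \<in> arr" "i1 \<in> SDen U" "p1 \<in> arr" "q1 \<in> Den U" "g1 \<in> arr" "h1 \<in> arr" "a1 \<in> Den U"
     "dom f = dom a" "cod i1 = dom p1" "cod q1 = dom g" "dom g1 = dom q1" "cod g1 = cod i1"
     "dom h1 = cod i1" "dom a1 = cod f" "cod h1 = cod a1"
     "a = i1 ;; p1" "g1 ;; p1 = q1 ;; g" "i1 ;; h1 = f ;; a1"
    using assms(1) unfolding s by (rule pushE)
  obtain q2 g2 i2 p2 h2 a2 where 2: "t2 = (q2 ;; b, g2 ;; h2, a2)"
     "(b, g, a) \<in> T3" "f \<in> arr" "i2 \<in> SDen U" "p2 \<in> arr" "q2 \<in> Den U" "g2 \<in> arr" "h2 \<in> arr" "a2 \<in> Den U"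
     "dom f = dom a" "cod i2 = dom p2" "cod q2 = dom g" "dom g2 = dom q2" "cod g2 = cod i2"
     "dom h2 = cod i2" "dom a2 = cod f" "cod h2 = cod a2"
     "a = i2 ;; p2" "g2 ;; p2 = q2 ;; g" "i2 ;; h2 = f ;; a2"
    using assms(2) unfolding s by (rule pushE)
  note g = T3D[OF 1(2)]
  have e: "dom i1 = dom f" "dom i2 = dom f" and e': "cod p1 = cod a" "cod p2 = cod a"
    using 1(4,5,10,11) 1(18)[symmetric] 2(4,5,11) 2(18)[symmetric]
      src_seq[of i1 p1] src_seq[of i2 p2] tgt_seq[of i1 p1] tgt_seq[of i2 p2] by auto
  obtain u j where uj: "u \<in> arr" "j \<in> SDen U" "dom u = cod i1" "dom j = cod i2"
    "cod j = cod u" "i1 ;; u = i2 ;; j"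
    and univ: "\<And>x v. \<lbrakk>x \<in> arr; v \<in> arr; dom x = cod i1; dom v = cod i2; cod x = cod v; i1 ;; x = i2 ;; v\<rbrakk>
      \<Longrightarrow> \<exists>h \<in> arr. dom h = cod u \<and> cod h = cod x \<and> u ;; h = x \<and> j ;; h = v"
    by (rule SDen_pushout[of i1 i2]) (use 1(4) 2(4) e in auto)
  obtain v where v: "v \<in> arr" "dom v = cod u" "cod v = cod a" "u ;; v = p1" "j ;; v = p2"
    using univ[of p1 p2] 1(5,11) 2(5,11) 1(18) 2(18) e' by auto
  \<comment> \<open>\<open>v\<close> is the right factor of \<open>a\<close> in the third
    factorisation. It is only a denominator, whereas pulling \<open>g\<close> back needs a
    T-denominator; so \<open>v = k r\<close> is split once more and \<open>k\<close> joins the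
    S-part.\<close>
  have "i2 ;; j \<in> SDen U" using uj 2(4) by auto
  moreover have "(i2 ;; j) ;; v = a" using uj v 2(4,18) by simp
  ultimately have "v \<in> Den U"
    using g uj v 2(4) by (intro Den_cancel_left[of "i2 ;; j" v]) auto
  then obtain k r where kr: "k \<in> SDen U" "r \<in> TDen U" "cod k = dom r" "v = k ;; r"
    using Den_factor by blast
  have dk: "dom k = cod u" "cod r = cod g" using kr v g by auto
  obtain g0 q0 where pb: "g0 \<in> arr" "q0 \<in> TDen U" "cod g0 = dom r" "cod q0 = dom g"
    "dom q0 = dom g0" "g0 ;; r = q0 ;; g"
    and puniv: "\<And>x y. \<lbrakk>x \<in> arr; y \<in> arr; cod x = dom r; cod y = dom g; dom x = dom y; x ;; r = y ;; g\<rbrakk>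
      \<Longrightarrow> \<exists>h \<in> arr. cod h = dom g0 \<and> dom h = dom x \<and> h ;; g0 = x \<and> h ;; q0 = y"
    by (rule TDen_pullback[of r g]) (use kr dk g in auto)
  \<comment> \<open>\<open>u\<close> need not be an S-denominator, but \<open>w\<close> is one: it
    also equals \<open>i2 j k\<close>.\<close>
  define w where "w = i1 ;; u ;; k"
  have w2: "w = i2 ;; j ;; k"
    unfolding w_def by (rule seq_eq_extend) (use uj dk kr 1(4) 2(4) in auto)
  have w: "w \<in> SDen U" unfolding w2 using uj dk kr 2(4) by simp
  have dw: "dom w = dom f" "cod w = cod k" unfolding w2 using uj dk kr 2(4,5,11) e(2) by auto
  obtain h0 a0 where po: "h0 \<in> arr" "a0 \<in> SDen U" "dom h0 = cod w" "dom a0 = cod f"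
    "cod h0 = cod a0" "w ;; h0 = f ;; a0"
    using SDen_square[OF w 1(3)] dw by metis
  have "t1 \<approx> (q0 ;; b, g0 ;; h0, a0)"
  proof -
    have "(g1 ;; u ;; k) ;; r = q1 ;; g"
      using 1(5,7,11,14,19) uj v kr dk by simp
    then obtain m where m: "m \<in> arr" "cod m = dom g0" "dom m = dom g1"
      "m ;; g0 = g1 ;; u ;; k" "m ;; q0 = q1"
      using puniv[of "g1 ;; u ;; k" q1] 1(6,7,11-14) uj kr dk by auto
    show ?thesis
      unfolding 1(1)
      by (rule push_aux[where w = w and u = "u ;; k" and f = f and i = i1 and m = m])
         (simp_all add: 1(3-9,11-17,20) g(1,4) uj kr(1,3) dk m pb po dw e(1) w_def[symmetric])
  qed
  moreover have "t2 \<approx> (q0 ;; b, g0 ;; h0, a0)"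
  proof -
    have "(g2 ;; j ;; k) ;; r = q2 ;; g"
      using 2(5,7,11,14,19) uj v kr dk by simp
    then obtain m where m: "m \<in> arr" "cod m = dom g0" "dom m = dom g2"
      "m ;; g0 = g2 ;; j ;; k" "m ;; q0 = q2"
      using puniv[of "g2 ;; j ;; k" q2] 2(6,7,11-14) uj kr dk by auto
    show ?thesis
      unfolding 2(1)
      by (rule push_aux[where w = w and u = "j ;; k" and f = f and i = i2 and m = m])
         (simp_all add: 2(3-9,11-17,20) g(1,4) uj kr(1,3) dk m pb po dw e(2) w2[symmetric])
  qed
  ultimately show ?thesis by (rule eqv_join)
qed

text \<open>In \<open>push\<close> the factor \<open>p\<close> is an arbitrary arrow and
  \<open>q\<close> an arbitrary denominator. Hence an extension by \<open>c\<close> is absorbed, on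
  the right by taking \<open>p c\<close> for \<open>p\<close> and on the left by taking
  \<open>q c\<close> for \<open>q\<close>, and the result is a push of both 3-arrows.\<close>

lemma push_cong:
  assumes "s \<approx> s'" "push f s t" "push f s' t'"
  shows "t \<approx> t'"
  using assms
proof (induction arbitrary: t t')
  case (extend_right b g a c)
  obtain q g' i p h a' where 1: "t = (q ;; b, g' ;; h, a')"
     "(b, g, a) \<in> T3" "f \<in> arr" "i \<in> SDen U" "p \<in> arr" "q \<in> Den U" "g' \<in> arr" "h \<in> arr" "a' \<in> Den U"
     "dom f = dom a" "cod i = dom p" "cod q = dom g" "dom g' = dom q" "cod g' = cod i"
     "dom h = cod i" "dom a' = cod f" "cod h = cod a'"
     "a = i ;; p" "g' ;; p = q ;; g" "i ;; h = f ;; a'"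
    using extend_right.prems(1) by (rule pushE)
  note g = T3D[OF 1(2)]
  have "push f (b, g ;; c, a ;; c) t"
    unfolding 1(1)
  proof (rule pushI[where p = "p ;; c" and i = i])
    show "g' ;; p ;; c = q ;; g ;; c"
      by (rule seq_eq_extend) (use g 1 extend_right.hyps in auto)
  qed (use g 1(2-17,20) 1(18) extend_right.hyps in \<open>auto simp: T3_iff\<close>)
  then show ?case using extend_right.prems(2) push_functional by blast
next
  case (extend_left b g a c)
  have g: "b \<in> Den U" "g \<in> arr" "a \<in> Den U" "dom b = dom g" "cod g = cod a" "cod c = dom b"
    using extend_left.hyps by (auto simp: T3_iff)
  have c: "c \<in> Den U" using extend_left.hyps g by (intro Den_cancel_right[of c b]) auto
  obtain q g' i p h a' where 1: "t' = (q ;; c ;; b, g' ;; h, a')"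
     "(c ;; b, c ;; g, a) \<in> T3" "f \<in> arr" "i \<in> SDen U" "p \<in> arr" "q \<in> Den U" "g' \<in> arr" "h \<in> arr" "a' \<in> Den U"
     "dom f = dom a" "cod i = dom p" "cod q = dom (c ;; g)" "dom g' = dom q" "cod g' = cod i"
     "dom h = cod i" "dom a' = cod f" "cod h = cod a'"
     "a = i ;; p" "g' ;; p = q ;; c ;; g" "i ;; h = f ;; a'"
    using extend_left.prems(2) by (rule pushE)
  have q: "cod q = dom c" using 1 g extend_left.hyps by auto
  then have t': "t' = ((q ;; c) ;; b, g' ;; h, a')" using 1 g extend_left.hyps by auto
  have "push f (b, g, a) t'"
    unfolding t'
    by (rule pushI[where p = p and i = i])
      (use g q c 1(3-11,13-20) extend_left.hyps in auto)
  then show ?case using extend_left.prems(1) push_functional by blast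
next
  case (refl s)
  then show ?case using push_functional by blast
next
  case (sym s t)
  show ?case by (rule eqv_sym, rule sym.IH) (fact sym.prems)+
next
  case (trans s u s')
  have "f \<in> arr" "dom f = tgt3 s" using trans.prems(1) by (auto simp: push_def)
  moreover have "u \<in> T3" "tgt3 s = tgt3 u" using eqv_T3 trans.hyps by blast+
  ultimately obtain t0 where "push f u t0" using push_total[of u f] by auto
  then show ?case using trans.IH trans.prems by (meson eqv_trans)
qed

end

section \<open>The actions of morphisms and denominators on double fractions\<close>

context uni_fractionable_category
begin

text \<open>Saturated under fraction equality and defined on whole sets, so that no representative
  has to be chosen; the same holds for \<open>inv_act\<close>. The values on classes are computed by
  \<open>act_cls\<close> and \<open>inv_act_cls\<close>.\<close>

definition act where "act f A = {t. \<exists>s \<in> A. \<exists>t'. push f s t' \<and> t' \<approx> t}"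

definition inv_act where
  "inv_act d A = {t. \<exists>b g a. (b, g, a) \<in> A \<and> (b, g, d ;; a) \<approx> t}"

text \<open>Any commuting completion computes the action, even if \<open>a\<close> is not an
  S-denominator: with the normal form \<open>a = i p\<close> the square
  \<open>i (p h) = f a'\<close> is admissible for \<open>push\<close>, and \<open>q\<close>
  disappears by an extension on the left.\<close>

lemma act_cls:
  assumes s: "(b, g, a) \<in> T3" and f: "f \<in> arr" and h: "h \<in> arr" "a' \<in> Den U" "dom h = cod a"
    "dom a' = cod f" "cod h = cod a'" "dom a = dom f" and sq: "a ;; h = f ;; a'"
  shows "act f (cls (b, g, a)) = cls (b, g ;; h, a')"
proof -
  note g = T3D[OF s(1)]
  obtain q g' i p where n: "i \<in> SDen U" "p \<in> TDen U" "q \<in> TDen U" "g' \<in> arr"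
     "cod i = dom p" "cod q = dom g" "dom g' = dom q" "cod g' = cod i"
     "a = i ;; p" "g' ;; p = q ;; g"
    using s by (rule S_normal_form)
  have p: "push f (b, g, a) (q ;; b, g' ;; (p ;; h), a')"
    by (rule pushI[where p = p and i = i]) (use s g n f h(1-5) h(6)[symmetric] sq in auto)
  have "g' ;; (p ;; h) = q ;; (g ;; h)"
    by (rule seq_eq_extend) (use g n h in auto)
  then have "(b, g ;; h, a') \<approx> (q ;; b, g' ;; (p ;; h), a')"
    by (intro eqv_left_eq[where c = q]) (use g n h in \<open>auto simp: T3_iff\<close>)
  then have e: "(q ;; b, g' ;; (p ;; h), a') \<approx> (b, g ;; h, a')" by (rule eqv_sym)
  show ?thesis
  proof (intro set_eqI iffI)
    fix t assume "t \<in> act f (cls (b, g, a))"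
    then obtain s' t' where "(b, g, a) \<approx> s'" "push f s' t'" "t' \<approx> t"
      by (auto simp: act_def in_cls_iff)
    then have "(q ;; b, g' ;; (p ;; h), a') \<approx> t"
      using push_cong[OF _ p] eqv_trans by metis
    then show "t \<in> cls (b, g ;; h, a')"
      unfolding in_cls_iff using eqv_trans[OF eqv_sym[OF e]] by simp
  next
    fix t assume "t \<in> cls (b, g ;; h, a')"
    then have "(q ;; b, g' ;; (p ;; h), a') \<approx> t"
      unfolding in_cls_iff by (rule eqv_trans[OF e])
    then show "t \<in> act f (cls (b, g, a))"
      unfolding act_def mem_Collect_eq using p eqv_refl[OF s] in_cls_iff by blast
  qed
qed

lemma eqv_inv:
  assumes "s \<approx> s'" "d \<in> Den U" "cod d = tgt3 s" "s = (b, g, a)" "s' = (b', g', a')"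
  shows "(b, g, d ;; a) \<approx> (b', g', d ;; a')"
  using assms
proof (induction arbitrary: b g a b' g' a')
  case (extend_right b1 g1 a1 c)
  have "(b1, g1, d ;; a1) \<approx> (b1, g1 ;; c, d ;; (a1 ;; c))"
    by (rule eqv_right_eq[where c = c]) (use extend_right in \<open>auto simp: T3_iff\<close>)
  then show ?case using extend_right.prems by simp
next
  case (extend_left b1 g1 a1 c)
  have "(b1, g1, d ;; a1) \<approx> (c ;; b1, c ;; g1, d ;; a1)"
    by (rule eqv_left_eq[where c = c]) (use extend_left in \<open>auto simp: T3_iff\<close>)
  then show ?case using extend_left.prems by simp
next
  case (refl s)
  then show ?case by (auto simp: T3_iff intro!: eqv_refl)
next
  case (sym s t)
  have "tgt3 s = tgt3 t" using eqv_T3 sym.hyps by blast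
  then have "cod d = tgt3 s" using sym.prems by simp
  from sym.IH[OF sym.prems(1) this sym.prems(4,3)] show ?case by (rule eqv_sym)
next
  case (trans s u s')
  obtain x y z where u: "u = (x, y, z)" by (rule prod_cases3)
  have "tgt3 s = tgt3 u" using eqv_T3 trans.hyps by blast
  then have "cod d = tgt3 u" using trans.prems by simp
  from trans.IH(1)[OF trans.prems(1,2,3) u] trans.IH(2)[OF trans.prems(1) this u trans.prems(4)]
  show ?case by (rule eqv_trans)
qed

lemma inv_act_cls:
  assumes s: "(b, g, a) \<in> T3" and d: "d \<in> Den U" "cod d = dom a"
  shows "inv_act d (cls (b, g, a)) = cls (b, g, d ;; a)"
proof (intro set_eqI iffI)
  fix t assume "t \<in> inv_act d (cls (b, g, a))"
  then obtain b' g' a' where "(b, g, a) \<approx> (b', g', a')" "(b', g', d ;; a') \<approx> t"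
    by (auto simp: inv_act_def in_cls_iff)
  moreover have "(b, g, d ;; a) \<approx> (b', g', d ;; a')"
    using calculation(1) d(1) by (rule eqv_inv) (use d in auto)
  ultimately show "t \<in> cls (b, g, d ;; a)" unfolding in_cls_iff by (metis eqv_trans)
next
  fix t assume "t \<in> cls (b, g, d ;; a)"
  then show "t \<in> inv_act d (cls (b, g, a))"
    unfolding inv_act_def in_cls_iff using eqv_refl[OF s] by blast
qed

lemma S_rep:
  assumes "A \<in> frac_hom X Y"
  obtains b g i where "(b, g, i) \<in> T3" "i \<in> SDen U" "cod b = X" "dom i = Y" "A = cls (b, g, i)"
proof -
  obtain b f a where s: "(b, f, a) \<in> T3" "cod b = X" "dom a = Y" "A = cls (b, f, a)"
    using assms by (rule frac_homE)
  obtain q g' i p where n: "i \<in> SDen U" "p \<in> TDen U" "q \<in> TDen U" "g' \<in> arr"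
     "cod i = dom p" "cod q = dom f" "dom g' = dom q" "cod g' = cod i"
     "a = i ;; p" "g' ;; p = q ;; f" "(b, f, a) \<approx> (q ;; b, g', i)"
    using s(1) by (rule S_normal_form)
  show thesis
  proof (rule that[of "q ;; b" g' i])
    show "(q ;; b, g', i) \<in> T3" using n(11) eqv_T3 by blast
    show "A = cls (q ;; b, g', i)" using s(4) cls_eqI[OF n(11)] by simp
    show "cod (q ;; b) = X" using s n by (auto simp: T3_iff)
    show "dom i = Y" using s n by auto
  qed (fact n)
qed

lemma act_in:
  assumes A: "A \<in> frac_hom X Y" and f: "f \<in> arr" "dom f = Y" "cod f = Z"
  shows "act f A \<in> frac_hom X Z"
proof -
  obtain b g i where s: "(b, g, i) \<in> T3" "i \<in> SDen U" "cod b = X" "dom i = Y" "A = cls (b, g, i)"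
    using A by (rule S_rep)
  obtain h i' where po: "h \<in> arr" "i' \<in> SDen U" "dom h = cod i" "dom i' = cod f"
    "cod h = cod i'" "i ;; h = f ;; i'"
    by (rule SDen_square[OF s(2) f(1)]) (use s f in auto)
  have "act f A = cls (b, g ;; h, i')"
    unfolding s(5) by (rule act_cls) (use s f po in auto)
  then show ?thesis using s f po by (auto simp: T3_iff intro!: cls_in_frac_hom)
qed

lemma inv_act_in:
  assumes A: "A \<in> frac_hom X Y" and d: "d \<in> Den U" "cod d = Y" "dom d = Z"
  shows "inv_act d A \<in> frac_hom X Z"
  using A
proof (rule frac_homE)
  fix b f a assume s: "(b, f, a) \<in> T3" "cod b = X" "dom a = Y" "A = cls (b, f, a)"
  show ?thesis unfolding s(4) using s(1-3) d
    by (subst inv_act_cls) (auto simp: T3_iff intro!: cls_in_frac_hom)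
qed

lemma act_seq:
  assumes A: "A \<in> frac_hom X Y" and f: "f \<in> arr" "dom f = Y" and k: "k \<in> arr" "dom k = cod f"
  shows "act (f ;; k) A = act k (act f A)"
proof -
  obtain b g i where s: "(b, g, i) \<in> T3" "i \<in> SDen U" "cod b = X" "dom i = Y" "A = cls (b, g, i)"
    using A by (rule S_rep)
  have g: "b \<in> Den U" "g \<in> arr" "dom b = dom g" "cod g = cod i"
    using s by (auto simp: T3_iff)
  obtain h i' where po: "h \<in> arr" "i' \<in> SDen U" "dom h = cod i" "dom i' = cod f"
    "cod h = cod i'" "i ;; h = f ;; i'"
    by (rule SDen_square[OF s(2) f(1)]) (use s f in auto)
  obtain l i'' where po': "l \<in> arr" "i'' \<in> SDen U" "dom l = cod i'" "dom i'' = cod k"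
    "cod l = cod i''" "i' ;; l = k ;; i''"
    by (rule SDen_square[OF po(2) k(1)]) (use k po in auto)
  have 1: "act f A = cls (b, g ;; h, i')"
    unfolding s(5) by (rule act_cls) (use s f po in auto)
  have "act k (act f A) = cls (b, (g ;; h) ;; l, i'')"
    unfolding 1 by (rule act_cls) (use s g k po po' in \<open>auto simp: T3_iff\<close>)
  moreover have "i ;; h ;; l = f ;; i' ;; l"
    by (rule seq_eq_extend) (use s f po po' in auto)
  then have "act (f ;; k) A = cls (b, g ;; (h ;; l), i'')"
    unfolding s(5) by (intro act_cls) (use s f k po po' in auto)
  ultimately show ?thesis using g po po' by simp
qed

lemma act_one:
  assumes "A \<in> frac_hom X Y"
  shows "act (one Y) A = A"
  using assms
proof (rule frac_homE)
  fix b f a assume s: "(b, f, a) \<in> T3" "cod b = X" "dom a = Y" "A = cls (b, f, a)"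
  have "Y \<in> objs (base U)" using s by (auto simp: T3_iff)
  then have "act (one Y) A = cls (b, f ;; one (cod f), a)"
    unfolding s(4) by (intro act_cls) (use s in \<open>auto simp: T3_iff\<close>)
  then show ?thesis using s by (simp add: T3_iff)
qed

lemma inv_act_one:
  assumes "A \<in> frac_hom X Y"
  shows "inv_act (one Y) A = A"
  using assms
proof (rule frac_homE)
  fix b f a assume s: "(b, f, a) \<in> T3" "cod b = X" "dom a = Y" "A = cls (b, f, a)"
  have "Y \<in> objs (base U)" using s by (auto simp: T3_iff)
  then show ?thesis unfolding s(4) using s(1-3) by (subst inv_act_cls) (auto simp: T3_iff)
qed

lemma inv_act_seq:
  assumes A: "A \<in> frac_hom X Y" and d: "d \<in> Den U" "e \<in> Den U" "cod d = dom e" "cod e = Y"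
  shows "inv_act (d ;; e) A = inv_act d (inv_act e A)"
  using A
proof (rule frac_homE)
  fix b f a assume s: "(b, f, a) \<in> T3" "cod b = X" "dom a = Y" "A = cls (b, f, a)"
  have a: "a \<in> Den U" using s by (simp add: T3_iff)
  have t: "(b, f, e ;; a) \<in> T3" using s d by (auto simp: T3_iff)
  show ?thesis unfolding s(4)
    using s d a t by (simp add: inv_act_cls)
qed

lemma act_inv_act:
  assumes A: "A \<in> frac_hom X Y" and d: "d \<in> Den U" "cod d = Y"
  shows "act d (inv_act d A) = A"
  using A
proof (rule frac_homE)
  fix b f a assume s: "(b, f, a) \<in> T3" "cod b = X" "dom a = Y" "A = cls (b, f, a)"
  have a: "a \<in> Den U" using s by (simp add: T3_iff)
  have "act d (cls (b, f, d ;; a)) = cls (b, f ;; one (cod f), a)"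
    by (rule act_cls) (use s d a in \<open>auto simp: T3_iff\<close>)
  then show ?thesis using s d a by (simp add: inv_act_cls T3_iff)
qed

text \<open>A weak pushout along \<open>d\<close> gives \<open>i h = d i'\<close>, so after undoing
  \<open>d\<close> there remains the extension of \<open>(b, g, i)\<close> by
  \<open>h\<close>.\<close>

lemma inv_act_act:
  assumes A: "A \<in> frac_hom X Y" and d: "d \<in> Den U" "dom d = Y"
  shows "inv_act d (act d A) = A"
proof -
  obtain b g i where s: "(b, g, i) \<in> T3" "i \<in> SDen U" "cod b = X" "dom i = Y" "A = cls (b, g, i)"
    using A by (rule S_rep)
  have g: "b \<in> Den U" "g \<in> arr" "dom b = dom g" "cod g = cod i"
    using s by (auto simp: T3_iff)
  obtain h i' where po: "h \<in> arr" "i' \<in> SDen U" "dom h = cod i" "dom i' = cod d"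
    "cod h = cod i'" "i ;; h = d ;; i'"
    by (rule SDen_square[OF s(2) Den_arr[OF d(1)]]) (use s d in auto)
  have 1: "act d A = cls (b, g ;; h, i')"
    unfolding s(5) by (rule act_cls) (use s d po in auto)
  have "(b, g ;; h, i') \<in> T3" using s g po by (auto simp: T3_iff)
  then have "inv_act d (act d A) = cls (b, g ;; h, d ;; i')"
    unfolding 1 using d po by (simp add: inv_act_cls)
  moreover have "(b, g, i) \<approx> (b, g ;; h, d ;; i')"
    by (rule eqv_right_eq[where c = h]) (use s g d po in auto)
  ultimately show ?thesis using s(5) cls_eqI by simp
qed

text \<open>Write \<open>B\<close> as the result of applying \<open>i\<close> to
  \<open>inv_act i B\<close>; then the commuting square can be used for \<open>act\<close> alone,
  and \<open>i'\<close> is undone at the end.\<close>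

lemma act_inv_act_commute:
  assumes A: "A \<in> frac_hom X Y" and i: "i \<in> Den U" "dom i = Y" and i': "i' \<in> Den U"
    and f: "f \<in> arr" "dom f = Y" "f' \<in> arr" "dom f' = cod i" "cod f = dom i'" "cod f' = cod i'"
    and sq: "i ;; f' = f ;; i'"
    and B: "B \<in> frac_hom X (cod i)"
  shows "inv_act i' (act f' B) = act f (inv_act i B)"
proof -
  have iB: "inv_act i B \<in> frac_hom X Y" by (rule inv_act_in[OF B]) (use i in auto)
  have "act f' B = act f' (act i (inv_act i B))" using B i by (simp add: act_inv_act)
  also have "\<dots> = act (i ;; f') (inv_act i B)" using act_seq[OF iB] i f by simp
  also have "\<dots> = act i' (act f (inv_act i B))" unfolding sq using act_seq[OF iB] i' f by simp
  finally show ?thesis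
    using inv_act_act[OF act_in[OF iB f(1,2)]] i' f by simp
qed

subsection \<open>Composition of double fractions\<close>

text \<open>The union runs over the representatives of \<open>B\<close>. By
  \<open>fcomp_invariant\<close> they all contribute the same set, so the union is this common
  value.\<close>

definition fcomp where
  "fcomp A B = \<Union>{inv_act a (act f (inv_act b A)) |b f a. (b, f, a) \<in> B}"

text \<open>By two-out-of-three the arrow \<open>c\<close> of an extension is itself a denominator,
  so its action and the undoing of it cancel between the neighbouring operators.\<close>

lemma fcomp_invariant:
  assumes A: "A \<in> frac_hom X Y" and "s \<approx> s'" "src3 s = Y" "s = (b, f, a)" "s' = (b', f', a')"
  shows "inv_act a (act f (inv_act b A)) = inv_act a' (act f' (inv_act b' A))"
  using assms(2-)
proof (induction arbitrary: b f a b' f' a')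
  case (extend_right b1 f1 a1 c)
  note t = T3D[OF extend_right.hyps(1)]
  have c: "c \<in> Den U" using extend_right.hyps t by (intro Den_cancel_left[of a1 c]) auto
  have 1: "inv_act b1 A \<in> frac_hom X (dom f1)"
    by (rule inv_act_in[OF A]) (use t extend_right.prems in auto)
  have 2: "act f1 (inv_act b1 A) \<in> frac_hom X (cod f1)" by (rule act_in[OF 1]) (use t in auto)
  have 3: "act c (act f1 (inv_act b1 A)) \<in> frac_hom X (cod c)"
    by (rule act_in[OF 2]) (use extend_right.hyps in auto)
  have "inv_act (a1 ;; c) (act (f1 ;; c) (inv_act b1 A))
      = inv_act a1 (inv_act c (act c (act f1 (inv_act b1 A))))"
    using act_seq[OF 1, of f1 c] inv_act_seq[OF 3, of a1 c] t c extend_right.hyps by simp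
  also have "\<dots> = inv_act a1 (act f1 (inv_act b1 A))"
    using inv_act_act[OF 2 c] extend_right.hyps by simp
  finally show ?case using extend_right.prems by simp
next
  case (extend_left b1 f1 a1 c)
  note t = T3D[OF extend_left.hyps(1)]
  have c: "c \<in> Den U" using extend_left.hyps t by (intro Den_cancel_right[of c b1]) auto
  have 1: "inv_act b1 A \<in> frac_hom X (dom f1)"
    by (rule inv_act_in[OF A]) (use t extend_left.prems in auto)
  have 2: "inv_act c (inv_act b1 A) \<in> frac_hom X (dom c)"
    by (rule inv_act_in[OF 1]) (use c extend_left.hyps in auto)
  have "act (c ;; f1) (inv_act (c ;; b1) A) = act f1 (act c (inv_act c (inv_act b1 A)))"
    using act_seq[OF 2, of c f1] inv_act_seq[OF A, of c b1] t c extend_left.hyps extend_left.prems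
    by simp
  also have "\<dots> = act f1 (inv_act b1 A)"
    using act_inv_act[OF 1 c] extend_left.hyps by simp
  finally show ?case using extend_left.prems by simp
next
  case (refl s)
  then show ?case by simp
next
  case (sym s t)
  have "src3 s = Y" using eqv_T3[OF sym.hyps] sym.prems by simp
  from sym.IH[OF this sym.prems(3,2)] show ?case by simp
next
  case (trans s u s')
  obtain x y z where u: "u = (x, y, z)" by (rule prod_cases3)
  have "src3 u = Y" using eqv_T3[OF trans.hyps(1)] trans.prems by simp
  from trans.IH(1)[OF trans.prems(1,2) u] trans.IH(2)[OF this u trans.prems(3)]
  show ?case by simp
qed

lemma fcomp_cls:
  assumes A: "A \<in> frac_hom X Y" and s: "(b, f, a) \<in> T3" "cod b = Y"
  shows "fcomp A (cls (b, f, a)) = inv_act a (act f (inv_act b A))"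
proof -
  have "inv_act a' (act f' (inv_act b' A)) = inv_act a (act f (inv_act b A))"
    if "(b, f, a) \<approx> (b', f', a')" for b' f' a'
    by (rule fcomp_invariant[OF A eqv_sym[OF that]])
      (use s eqv_T3[OF that] in auto)
  then have "{inv_act a' (act f' (inv_act b' A)) |b' f' a'. (b', f', a') \<in> cls (b, f, a)}
      = {inv_act a (act f (inv_act b A))}"
    unfolding in_cls_iff using eqv_refl[OF s(1)] by blast
  then show ?thesis unfolding fcomp_def by simp
qed

lemma fcomp_in:
  assumes A: "A \<in> frac_hom X Y" and B: "B \<in> frac_hom Y Z"
  shows "fcomp A B \<in> frac_hom X Z"
  using B
proof (rule frac_homE)
  fix b f a assume s: "(b, f, a) \<in> T3" "cod b = Y" "dom a = Z" "B = cls (b, f, a)"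
  note t = T3D[OF s(1)]
  show ?thesis unfolding s(4) fcomp_cls[OF A s(1,2)]
    by (intro inv_act_in[OF act_in[OF inv_act_in[OF A]]]) (use t s in auto)
qed

text \<open>Together with \<open>fcomp_act\<close> this makes composition with \<open>A\<close>
  natural in the second argument, which is all that associativity needs.\<close>

lemma fcomp_inv_act:
  assumes A: "A \<in> frac_hom X Y" and B: "B \<in> frac_hom Y Z" and d: "d \<in> Den U" "cod d = Z"
  shows "fcomp A (inv_act d B) = inv_act d (fcomp A B)"
  using B
proof (rule frac_homE)
  fix b f a assume s: "(b, f, a) \<in> T3" "cod b = Y" "dom a = Z" "B = cls (b, f, a)"
  note t = T3D[OF s(1)]
  have 1: "act f (inv_act b A) \<in> frac_hom X (cod a)"
    by (intro act_in[OF inv_act_in[OF A]]) (use t s in auto)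
  have 2: "(b, f, d ;; a) \<in> T3" using t d s by (auto simp: T3_iff)
  have "inv_act d B = cls (b, f, d ;; a)" unfolding s(4) using s d by (simp add: inv_act_cls)
  then have "fcomp A (inv_act d B) = inv_act (d ;; a) (act f (inv_act b A))"
    using fcomp_cls[OF A 2 s(2)] by simp
  also have "\<dots> = inv_act d (fcomp A B)"
    unfolding s(4) fcomp_cls[OF A s(1,2)] by (rule inv_act_seq[OF 1]) (use t d s in auto)
  finally show ?thesis .
qed

lemma fcomp_act:
  assumes A: "A \<in> frac_hom X Y" and B: "B \<in> frac_hom Y Z" and f: "f \<in> arr" "dom f = Z"
  shows "fcomp A (act f B) = act f (fcomp A B)"
proof -
  obtain b g i where s: "(b, g, i) \<in> T3" "i \<in> SDen U" "cod b = Y" "dom i = Z" "B = cls (b, g, i)"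
    using B by (rule S_rep)
  have g: "b \<in> Den U" "g \<in> arr" "dom b = dom g" "cod g = cod i"
    using s by (auto simp: T3_iff)
  obtain h i' where po: "h \<in> arr" "i' \<in> SDen U" "dom h = cod i" "dom i' = cod f"
    "cod h = cod i'" "i ;; h = f ;; i'"
    by (rule SDen_square[OF s(2) f(1)]) (use s f in auto)
  have "act f B = cls (b, g ;; h, i')"
    unfolding s(5) by (rule act_cls) (use s f po in auto)
  moreover have "(b, g ;; h, i') \<in> T3" using g po by (auto simp: T3_iff)
  ultimately have "fcomp A (act f B) = inv_act i' (act (g ;; h) (inv_act b A))"
    using fcomp_cls[OF A _ s(3)] by simp
  moreover have 1: "inv_act b A \<in> frac_hom X (dom g)" by (rule inv_act_in[OF A]) (use g s in auto)
  moreover have 2: "act g (inv_act b A) \<in> frac_hom X (cod i)" by (rule act_in[OF 1]) (use g in auto)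
  moreover have "act (g ;; h) (inv_act b A) = act h (act g (inv_act b A))"
    by (rule act_seq[OF 1]) (use g po in auto)
  moreover have "inv_act i' (act h (act g (inv_act b A))) = act f (inv_act i (act g (inv_act b A)))"
    by (rule act_inv_act_commute[OF inv_act_in[OF 2, of i], of Z]) (use s f po 2 in auto)
  ultimately show ?thesis unfolding s(5) fcomp_cls[OF A s(1,3)] by simp
qed

text \<open>\<open>D\<close> acts by undoing \<open>b\<close>, applying \<open>f\<close> and undoing
  \<open>a\<close>, and \<open>fcomp A\<close> commutes with each of the three.\<close>

lemma fcomp_assoc:
  assumes A: "A \<in> frac_hom W X" and B: "B \<in> frac_hom X Y" and D: "D \<in> frac_hom Y Z"
  shows "fcomp (fcomp A B) D = fcomp A (fcomp B D)"
  using D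
proof (rule frac_homE)
  fix b f a assume s: "(b, f, a) \<in> T3" "cod b = Y" "dom a = Z" "D = cls (b, f, a)"
  note t = T3D[OF s(1)]
  have 1: "inv_act b B \<in> frac_hom X (dom f)" by (rule inv_act_in[OF B]) (use t s in auto)
  have 2: "act f (inv_act b B) \<in> frac_hom X (cod a)" by (rule act_in[OF 1]) (use t in auto)
  show ?thesis
    unfolding s(4) fcomp_cls[OF fcomp_in[OF A B] s(1,2)] fcomp_cls[OF B s(1,2)]
      fcomp_inv_act[OF A 2 t(3) HOL.refl] fcomp_act[OF A 1 t(2) HOL.refl]
      fcomp_inv_act[OF A B t(1) s(2)] ..
qed

abbreviation frac_one where "frac_one X \<equiv> cls (one X, one X, one X)"

lemma loc_cls: "farr (loc U) f = cls (one (dom f), f, one (cod f))"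
  by (simp add: loc_def double_frac_cls)

lemma one_T3: "X \<in> objs (base U) \<Longrightarrow> (one X, one X, one X) \<in> T3"
  by (simp add: T3_iff)

lemma frac_one_in: "X \<in> objs (base U) \<Longrightarrow> frac_one X \<in> frac_hom X X"
  using one_T3[of X] by auto

text \<open>Undoing \<open>b\<close> on the identity gives \<open>(1, 1, b)\<close>, and this equals
  \<open>(b, 1, 1)\<close> since both extend to \<open>(b, b, b)\<close>. The left denominator
  needed for the left unit law arises in this way.\<close>

lemma act_frac_one:
  assumes "f \<in> arr" "b \<in> Den U" "dom b = dom f"
  shows "act f (inv_act b (frac_one (cod b))) = cls (b, f, one (cod f))"
proof -
  let ?b = "cod b"
  have 1: "(one (?b), one (?b), b) \<approx> (b, b, b)"
    by (rule eqv_left_eq[where c = b]) (use assms in \<open>auto simp: T3_iff\<close>)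
  have 2: "(b, one (dom b), one (dom b)) \<approx> (b, b, b)"
    by (rule eqv_right_eq[where c = b]) (use assms in \<open>auto simp: T3_iff\<close>)
  have "inv_act b (frac_one (?b)) = cls (one (?b), one (?b), b)"
    using inv_act_cls[OF one_T3, of "?b" b] assms by simp
  also have "\<dots> = cls (b, one (dom b), one (dom b))" by (rule cls_eqI[OF eqv_join[OF 1 2]])
  finally have "act f (inv_act b (frac_one (?b))) = cls (b, one (dom b) ;; f, one (cod f))"
    by (simp, intro act_cls) (use assms in \<open>auto simp: T3_iff\<close>)
  then show ?thesis using assms by simp
qed

lemma fcomp_one_left:
  assumes "A \<in> frac_hom X Y"
  shows "fcomp (frac_one X) A = A"
  using assms
proof (rule frac_homE)
  fix b f a assume s: "(b, f, a) \<in> T3" "cod b = X" "dom a = Y" "A = cls (b, f, a)"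
  note t = T3D[OF s(1)]
  have X: "X \<in> objs (base U)" using s t by auto
  have "fcomp (frac_one X) A = inv_act a (act f (inv_act b (frac_one X)))"
    unfolding s(4) by (rule fcomp_cls[OF frac_one_in[OF X] s(1,2)])
  also have "\<dots> = inv_act a (cls (b, f, one (cod f)))"
    using act_frac_one[of f b] t s by simp
  also have "\<dots> = A"
  proof -
    have "(b, f, one (cod f)) \<in> T3" using t by (auto simp: T3_iff)
    then have "inv_act a (cls (b, f, one (cod f))) = cls (b, f, a ;; one (cod f))"
      by (rule inv_act_cls[OF _ t(3)]) (use t in auto)
    then show ?thesis using s(4) t by simp
  qed
  finally show ?thesis .
qed

lemma frac_hom_objs:
  assumes "A \<in> frac_hom X Y"
  shows "X \<in> objs (base U)" "Y \<in> objs (base U)"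
  using assms by (auto elim!: frac_homE simp: T3_iff)

lemma fcomp_one_right:
  assumes A: "A \<in> frac_hom X Y"
  shows "fcomp A (frac_one Y) = A"
proof -
  have Y: "Y \<in> objs (base U)" using frac_hom_objs[OF A] by blast
  show ?thesis
    using fcomp_cls[OF A one_T3[OF Y]] Y inv_act_one[OF A] act_one[OF A] by simp
qed

text \<open>Independence of choices without comparing two choices. The square of \<open>q\<close>
  and \<open>q'\<close> turns \<open>(b1, f1, j q)\<close>, which is \<open>s\<close> with
  \<open>b2\<close> undone, into \<open>(q' b1, f1', j)\<close>; the square of \<open>j\<close> and
  \<open>j'\<close> computes the action of \<open>f2\<close> on it; undoing \<open>a2\<close> ends
  the action of \<open>t\<close>.\<close>

lemma frac_composite_cls:
  assumes s: "s \<in> T3" and t: "t \<in> T3" and st: "tgt3 s = src3 t" and r: "frac_composite U s t r"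
  shows "r \<in> T3 \<and> cls r = fcomp (cls s) (cls t)"
proof -
  obtain b1 f1 a1 where s1: "s = (b1, f1, a1)" by (rule prod_cases3)
  obtain b2 f2 a2 where t1: "t = (b2, f2, a2)" by (rule prod_cases3)
  obtain j q q' j' f1' f2' where d: "j \<in> SDen U" "q \<in> TDen U" "q' \<in> TDen U" "j' \<in> SDen U"
    "cod j = dom q" "b2 ;; a1 = j ;; q"
    "comm_square (base U) f1 q f1' q'" "comm_square (op_cat (base U)) f2 j f2' j'"
    "r = (q' ;; b1, f1' ;; f2', a2 ;; j')"
    using r unfolding s1 t1 frac_composite_def Let_def by auto
  have c: "f1' \<in> arr" "cod f1 = cod q" "dom f1' = dom q'" "cod f1' = dom q" "cod q' = dom f1"
     "f1' ;; q = q' ;; f1"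
    "f2' \<in> arr" "dom f2 = dom j" "cod f2' = cod j'" "dom f2' = cod j" "dom j' = cod f2"
     "j ;; f2' = f2 ;; j'"
    using d(7,8) by (auto simp: comm_square_def)
  have g1: "b1 \<in> Den U" "f1 \<in> arr" "a1 \<in> Den U" "dom b1 = dom f1" "cod f1 = cod a1"
    using s s1 by (auto simp: T3_iff)
  have g2: "b2 \<in> Den U" "f2 \<in> arr" "a2 \<in> Den U" "dom b2 = dom f2" "cod f2 = cod a2"
    using t t1 by (auto simp: T3_iff)
  have b: "cod b2 = dom a1" using st s1 t1 by simp
  have A: "cls s \<in> frac_hom (cod b1) (cod b2)" using s b unfolding s1 by auto
  have 1: "(q' ;; b1, f1', j) \<in> T3" using g1(1,2,4) c d(1-5) by (auto simp: T3_iff)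
  have e1: "(q' ;; b1, f1', j) \<approx> (q' ;; b1, q' ;; f1, j ;; q)"
    by (rule eqv_right_eq[where c = q, OF 1]) (use c d(1-5) in auto)
  have e2: "(b1, f1, j ;; q) \<approx> (q' ;; b1, q' ;; f1, j ;; q)"
    by (rule eqv_left_eq[where c = q']) (use g1(1,2,4) c d(1-5) in \<open>auto simp: T3_iff\<close>)
  have "inv_act b2 (cls s) = cls (b1, f1, j ;; q)"
    unfolding s1 using inv_act_cls[of b1 f1 a1 b2] s s1 g2 b d(6) by simp
  also have "\<dots> = cls (q' ;; b1, f1', j)" by (rule cls_eqI[OF eqv_join[OF e2 e1]])
  finally have "act f2 (inv_act b2 (cls s)) = cls (q' ;; b1, f1' ;; f2', j')"
    by (simp, intro act_cls[OF 1]) (use g2(2) c d(1-5) in auto)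
  moreover have 2: "(q' ;; b1, f1' ;; f2', j') \<in> T3"
    using g1(1,2,4) c d(1-5) by (auto simp: T3_iff)
  ultimately have "fcomp (cls s) (cls t) = cls r"
    unfolding t1 d(9) using fcomp_cls[OF A] t t1 inv_act_cls[OF 2, of a2] g2 c d(1-5) by simp
  moreover have "r \<in> T3" using 2 g2(3,5) c(11) d(4) unfolding d(9) by (auto simp: T3_iff)
  ultimately show ?thesis by simp
qed

lemma frac_composite_exists:
  assumes s: "s \<in> T3" and t: "t \<in> T3" and st: "tgt3 s = src3 t"
  shows "\<exists>r. frac_composite U s t r"
proof -
  obtain b1 f1 a1 where s1: "s = (b1, f1, a1)" by (rule prod_cases3)
  obtain b2 f2 a2 where t1: "t = (b2, f2, a2)" by (rule prod_cases3)
  have g1: "b1 \<in> Den U" "f1 \<in> arr" "a1 \<in> Den U" "dom b1 = dom f1" "cod f1 = cod a1"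
    using s s1 by (auto simp: T3_iff)
  have g2: "b2 \<in> Den U" "f2 \<in> arr" "a2 \<in> Den U" "dom b2 = dom f2" "cod f2 = cod a2"
    using t t1 by (auto simp: T3_iff)
  have b: "cod b2 = dom a1" using st s1 t1 by simp
  have "b2 ;; a1 \<in> Den U" using g1 g2 b by simp
  then obtain j q where jq: "j \<in> SDen U" "q \<in> TDen U" "cod j = dom q" "b2 ;; a1 = j ;; q"
    by (rule Den_factor)
  have dj: "dom f2 = dom j" "cod f1 = cod q"
    using src_seq[of j q] src_seq[of b2 a1] tgt_seq[of j q] tgt_seq[of b2 a1] jq g1 g2 b by auto
  obtain f2' j' where po: "f2' \<in> arr" "j' \<in> SDen U" "dom f2' = cod j" "dom j' = cod f2"
    "cod f2' = cod j'" "j ;; f2' = f2 ;; j'"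
    by (rule SDen_square[OF jq(1) g2(2) dj(1)])
  obtain f1' q' where pb: "f1' \<in> arr" "q' \<in> TDen U" "cod f1' = dom q" "cod q' = dom f1"
    "dom f1' = dom q'" "f1' ;; q = q' ;; f1"
    by (rule TDen_square[OF jq(2) g1(2) dj(2)])
  have "comm_square (base U) f1 q f1' q'" "comm_square (op_cat (base U)) f2 j f2' j'"
    using po pb jq(1,2) dj g1(2) g2(2) by (auto simp: comm_square_def)
  then show ?thesis
    unfolding s1 t1 frac_composite_def Let_def prod.case using jq po(2) pb(2) by blast
qed

section \<open>The category of double fractions\<close>

lemma Frac_arrs: "arrs (Frac U) = {cls s |s. s \<in> T3}"
  unfolding Frac_def quotient_def by (auto simp: cls_def)

lemma Frac_objs [simp]: "objs (Frac U) = objs (base U)"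
  by (simp add: Frac_def)

lemma Frac_ident: "ident (Frac U) X = frac_one X"
  by (simp add: Frac_def double_frac_cls)

lemma Frac_src:
  assumes "A \<in> frac_hom X Y"
  shows "src (Frac U) A = X"
  using assms
proof (rule frac_homE)
  fix b f a assume s: "(b, f, a) \<in> T3" "cod b = X" "dom a = Y" "A = cls (b, f, a)"
  have "(\<exists>(b', f', a') \<in> A. Z = cod b') \<longleftrightarrow> Z = X" for Z
  proof -
    have "cod b' = X" if "(b', f', a') \<in> A" for b' f' a'
      using eqv_T3[of "(b, f, a)" "(b', f', a')"] that s by (simp add: in_cls_iff)
    moreover have "(b, f, a) \<in> A" "cod b = X" using s eqv_refl by (simp_all add: in_cls_iff)
    ultimately show ?thesis by blast
  qed
  then show ?thesis by (simp add: Frac_def)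
qed

lemma Frac_tgt:
  assumes "A \<in> frac_hom X Y"
  shows "tgt (Frac U) A = Y"
  using assms
proof (rule frac_homE)
  fix b f a assume s: "(b, f, a) \<in> T3" "cod b = X" "dom a = Y" "A = cls (b, f, a)"
  have "(\<exists>(b', f', a') \<in> A. Z = dom a') \<longleftrightarrow> Z = Y" for Z
  proof -
    have "dom a' = Y" if "(b', f', a') \<in> A" for b' f' a'
      using eqv_T3[of "(b, f, a)" "(b', f', a')"] that s by (simp add: in_cls_iff)
    moreover have "(b, f, a) \<in> A" "dom a = Y" using s eqv_refl by (simp_all add: in_cls_iff)
    ultimately show ?thesis by blast
  qed
  then show ?thesis by (simp add: Frac_def)
qed

lemma Frac_hom: "hom (Frac U) X Y = frac_hom X Y"
proof (intro set_eqI iffI)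
  fix A assume A: "A \<in> hom (Frac U) X Y"
  then obtain s where "s \<in> T3" "A = cls s" by (auto simp: hom_def Frac_arrs)
  then have "A \<in> frac_hom (src3 s) (tgt3 s)" unfolding frac_hom_def by blast
  moreover from this have "src3 s = X" "tgt3 s = Y"
    using A Frac_src Frac_tgt by (auto simp: hom_def)
  ultimately show "A \<in> frac_hom X Y" by simp
next
  fix A assume A: "A \<in> frac_hom X Y"
  then show "A \<in> hom (Frac U) X Y"
    using Frac_src[OF A] Frac_tgt[OF A] by (auto simp: hom_def Frac_arrs frac_hom_def)
qed

lemma Frac_cmp:
  assumes A: "A \<in> frac_hom X Y" and B: "B \<in> frac_hom Y Z"
  shows "cmp (Frac U) A B = fcomp A B"
proof -
  obtain s where s: "s \<in> T3" "src3 s = X" "tgt3 s = Y" "A = cls s"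
    using A by (auto simp: frac_hom_def)
  obtain t where t: "t \<in> T3" "src3 t = Y" "tgt3 t = Z" "B = cls t"
    using B by (auto simp: frac_hom_def)
  \<comment> \<open>All representatives and all choices lead to one class, as the definite
    description in \<open>Frac\<close> demands.\<close>
  have *: "double_frac U b f a = fcomp A B"
    if "s' \<in> A" "t' \<in> B" "frac_composite U s' t' (b, f, a)" for s' t' b f a
  proof -
    have "s \<approx> s'" "t \<approx> t'" using that s t by (auto simp: in_cls_iff)
    then have "s' \<in> T3" "t' \<in> T3" "tgt3 s' = src3 t'" "cls s' = A" "cls t' = B"
      using eqv_T3 cls_eqI s t by (auto; metis)+
    then show ?thesis
      using frac_composite_cls[of s' t', OF _ _ _ that(3)] by (simp add: double_frac_cls)
  qed
  obtain b f a where r: "frac_composite U s t (b, f, a)"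
    using frac_composite_exists[OF s(1) t(1)] s t by auto
  have st: "s \<in> A" "t \<in> B"
    unfolding s(4) t(4) in_cls_iff by (rule eqv_refl[OF s(1)] eqv_refl[OF t(1)])+
  have "(THE \<gamma>. \<exists>s \<in> A. \<exists>t \<in> B. \<exists>b f a. frac_composite U s t (b, f, a) \<and> \<gamma> = double_frac U b f a)
      = fcomp A B"
  proof (rule the_equality)
    show "\<exists>s \<in> A. \<exists>t \<in> B. \<exists>b f a. frac_composite U s t (b, f, a) \<and> fcomp A B = double_frac U b f a"
      using r st *[OF st r] by metis
  qed (use * in blast)
  then show ?thesis by (simp add: Frac_def)
qed

lemma frac_hom_of_arr: "A \<in> arrs (Frac U) \<Longrightarrow> A \<in> frac_hom (src (Frac U) A) (tgt (Frac U) A)"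
  using Frac_hom unfolding hom_def by fastforce

lemma category_Frac: "category (Frac U)"
proof
  fix f assume f: "f \<in> arrs (Frac U)"
  note f' = frac_hom_of_arr[OF f]
  show "src (Frac U) f \<in> objs (Frac U)" "tgt (Frac U) f \<in> objs (Frac U)"
    using frac_hom_objs[OF f'] by auto
  then show "cmp (Frac U) (ident (Frac U) (src (Frac U) f)) f = f"
      "cmp (Frac U) f (ident (Frac U) (tgt (Frac U) f)) = f"
    using Frac_cmp[OF frac_one_in f'] Frac_cmp[OF f' frac_one_in]
      fcomp_one_left[OF f'] fcomp_one_right[OF f'] by (simp_all add: Frac_ident)
  fix g assume g: "g \<in> arrs (Frac U)" and fg: "tgt (Frac U) f = src (Frac U) g"
  have g': "g \<in> frac_hom (tgt (Frac U) f) (tgt (Frac U) g)" using frac_hom_of_arr[OF g] fg by simp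
  show "cmp (Frac U) f g \<in> hom (Frac U) (src (Frac U) f) (tgt (Frac U) g)"
    unfolding Frac_cmp[OF f' g'] Frac_hom by (rule fcomp_in[OF f' g'])
  fix h assume h: "h \<in> arrs (Frac U)" and gh: "tgt (Frac U) g = src (Frac U) h"
  have h': "h \<in> frac_hom (tgt (Frac U) g) (tgt (Frac U) h)" using frac_hom_of_arr[OF h] gh by simp
  show "cmp (Frac U) (cmp (Frac U) f g) h = cmp (Frac U) f (cmp (Frac U) g h)"
    unfolding Frac_cmp[OF f' g'] Frac_cmp[OF g' h'] Frac_cmp[OF fcomp_in[OF f' g'] h']
      Frac_cmp[OF f' fcomp_in[OF g' h']]
    by (rule fcomp_assoc[OF f' g' h'])
next
  fix X assume "X \<in> objs (Frac U)"
  then show "ident (Frac U) X \<in> hom (Frac U) X X"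
    unfolding Frac_hom Frac_ident using frac_one_in by simp
qed

end

section \<open>The localisation property\<close>

context category
begin

definition inv_arr where
  "inv_arr x = (SOME y. y \<in> hom C (tgt C x) (src C x) \<and>
     x ;; y = ident C (src C x) \<and> y ;; x = ident C (tgt C x))"

lemma inv_arr_props:
  assumes "is_iso C x"
  shows "x \<in> arrs C" "inv_arr x \<in> arrs C" "src C (inv_arr x) = tgt C x" "tgt C (inv_arr x) = src C x"
    "x ;; inv_arr x = ident C (src C x)" "inv_arr x ;; x = ident C (tgt C x)"
proof -
  have "inv_arr x \<in> hom C (tgt C x) (src C x) \<and>
     x ;; inv_arr x = ident C (src C x) \<and> inv_arr x ;; x = ident C (tgt C x)"
    unfolding inv_arr_def by (rule someI_ex) (use assms in \<open>auto simp: is_iso_def\<close>)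
  then show "inv_arr x \<in> arrs C" "src C (inv_arr x) = tgt C x" "tgt C (inv_arr x) = src C x"
    "x ;; inv_arr x = ident C (src C x)" "inv_arr x ;; x = ident C (tgt C x)"
    by (auto simp: hom_def)
  show "x \<in> arrs C" using assms by (simp add: is_iso_def)
qed

lemma iso_inv_extend:
  assumes "is_iso C x" "z \<in> arrs C"
  shows "src C z = src C x \<Longrightarrow> x ;; inv_arr x ;; z = z" "src C z = tgt C x \<Longrightarrow> inv_arr x ;; x ;; z = z"
  using cmp_assoc[of x "inv_arr x" z] cmp_assoc[of "inv_arr x" x z] inv_arr_props[OF assms(1)] assms(2)
  by simp_all

end

lemma is_functorD:
  assumes "is_functor C D F"
  shows "category C" "category D" "X \<in> objs C \<Longrightarrow> fobj F X \<in> objs D"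
    "f \<in> arrs C \<Longrightarrow> farr F f \<in> arrs D" "f \<in> arrs C \<Longrightarrow> src D (farr F f) = fobj F (src C f)"
    "f \<in> arrs C \<Longrightarrow> tgt D (farr F f) = fobj F (tgt C f)"
    "X \<in> objs C \<Longrightarrow> farr F (ident C X) = ident D (fobj F X)"
    "\<lbrakk>f \<in> arrs C; g \<in> arrs C; tgt C f = src C g\<rbrakk> \<Longrightarrow> farr F (cmp C f g) = cmp D (farr F f) (farr F g)"
  using assms unfolding is_functor_def hom_def by auto

context uni_fractionable_category
begin

lemma T3_from_arr: "f \<in> arr \<Longrightarrow> (one (dom f), f, one (cod f)) \<in> T3"
  by (simp add: T3_iff)

lemma loc_in: "f \<in> arr \<Longrightarrow> farr (loc U) f \<in> frac_hom (dom f) (cod f)"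
  unfolding loc_cls using T3_from_arr[of f] by auto

lemma fcomp_loc:
  assumes A: "A \<in> frac_hom X Y" and f: "f \<in> arr" "dom f = Y"
  shows "fcomp A (farr (loc U) f) = act f A"
proof -
  have Y: "Y \<in> objs (base U)" using frac_hom_objs[OF A] by blast
  have "fcomp A (farr (loc U) f) = inv_act (one (cod f)) (act f (inv_act (one (dom f)) A))"
    unfolding loc_cls by (rule fcomp_cls[OF A T3_from_arr[OF f(1)]]) (use f in auto)
  also have "\<dots> = act f A"
    using inv_act_one[OF A] inv_act_one[OF act_in[OF A f HOL.refl]] f by simp
  finally show ?thesis .
qed

lemma act_from_arr:
  assumes "f \<in> arr" "g \<in> arr" "cod f = dom g" "b \<in> Den U" "dom b = dom f"
  shows "act g (cls (b, f, one (cod f))) = cls (b, f ;; g, one (cod g))"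
  by (rule act_cls) (use assms in \<open>auto simp: T3_iff\<close>)

lemma functor_loc: "is_functor (base U) (Frac U) (loc U)"
  unfolding is_functor_def
proof (intro conjI ballI impI)
  show "category (base U)" by (rule cat)
  show "category (Frac U)" by (rule category_Frac)
  show "\<And>X. X \<in> objs (base U) \<Longrightarrow> fobj (loc U) X \<in> objs (Frac U)" by (simp add: loc_def)
  show "\<And>f. f \<in> arr \<Longrightarrow> farr (loc U) f \<in> hom (Frac U) (fobj (loc U) (dom f)) (fobj (loc U) (cod f))"
    using loc_in by (simp add: Frac_hom loc_def)
  show "\<And>X. X \<in> objs (base U) \<Longrightarrow> farr (loc U) (one X) = ident (Frac U) (fobj (loc U) X)"
    unfolding Frac_ident loc_cls by (simp add: loc_def)
  fix f g assume fg: "f \<in> arr" "g \<in> arr" "cod f = dom g"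
  have g: "farr (loc U) g \<in> frac_hom (cod f) (cod g)" using loc_in[OF fg(2)] fg by simp
  have "act g (farr (loc U) f) = farr (loc U) (f ;; g)"
    using act_from_arr[OF fg(1,2,3), of "one (dom f)"] fg by (simp add: loc_cls)
  then show "farr (loc U) (f ;; g) = cmp (Frac U) (farr (loc U) f) (farr (loc U) g)"
    using Frac_cmp[OF loc_in[OF fg(1)] g] fcomp_loc[OF loc_in[OF fg(1)] fg(2)] fg by simp
qed

lemma loc_inverts:
  assumes d: "d \<in> Den U"
  shows "is_iso (Frac U) (farr (loc U) d)"
proof -
  let ?e = "cls (one (cod d), one (cod d), d)"
  have t: "(one (cod d), one (cod d), d) \<in> T3" using d by (simp add: T3_iff)
  have e: "?e \<in> frac_hom (cod d) (dom d)" using t d by auto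
  have l: "farr (loc U) d \<in> frac_hom (dom d) (cod d)" using loc_in d by simp
  have "act d ?e = cls (one (cod d), one (cod d) ;; one (cod d), one (cod d))"
    by (rule act_cls[OF t]) (use d in auto)
  then have 1: "fcomp ?e (farr (loc U) d) = frac_one (cod d)"
    using fcomp_loc[OF e, of d] d by simp
  have "?e = inv_act d (frac_one (cod d))"
    using inv_act_cls[OF one_T3, of "cod d" d] d by simp
  then have "fcomp (farr (loc U) d) ?e = inv_act d (farr (loc U) d)"
    using fcomp_inv_act[OF l frac_one_in[of "cod d"], of d] fcomp_one_right[OF l] d by simp
  also have "\<dots> = inv_act d (act d (frac_one (dom d)))"
    using fcomp_loc[OF frac_one_in[of "dom d"], of d] fcomp_one_left[OF l] d by simp
  also have "\<dots> = frac_one (dom d)"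
    by (rule inv_act_act[OF frac_one_in]) (use d in auto)
  finally have 2: "fcomp (farr (loc U) d) ?e = frac_one (dom d)" .
  show ?thesis
    unfolding is_iso_def
  proof (intro conjI bexI[of _ ?e])
    show "farr (loc U) d \<in> arrs (Frac U)" using l unfolding Frac_hom[symmetric] by (simp add: hom_def)
    show "?e \<in> hom (Frac U) (tgt (Frac U) (farr (loc U) d)) (src (Frac U) (farr (loc U) d))"
      unfolding Frac_hom Frac_src[OF l] Frac_tgt[OF l] by (rule e)
  qed (use 1 2 in \<open>simp_all add: Frac_cmp[OF e l] Frac_cmp[OF l e] Frac_ident Frac_src[OF l] Frac_tgt[OF l]\<close>)
qed

text \<open>Since \<open>loc b\<close> and \<open>loc a\<close> are invertible, this equation
  determines the fraction from morphisms in the image of \<open>loc\<close>. The uniqueness of the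
  induced functor rests on it.\<close>

lemma loc_factor:
  assumes s: "(b, f, a) \<in> T3"
  shows "fcomp (fcomp (farr (loc U) b) (cls (b, f, a))) (farr (loc U) a) = farr (loc U) f"
proof -
  note t = T3D[OF s(1)]
  have b: "farr (loc U) b \<in> frac_hom (dom b) (cod b)" by (rule loc_in[OF Den_arr[OF t(1)]])
  have s': "cls (b, f, a) \<in> frac_hom (cod b) (dom a)" using s by auto
  have 1: "frac_one (dom b) \<in> frac_hom (dom b) (dom b)" using frac_one_in t by simp
  have f: "act f (frac_one (dom f)) = farr (loc U) f" unfolding loc_cls
    using act_from_arr[of "one (dom f)" f "one (dom f)"] t by simp
  have "farr (loc U) b = act b (frac_one (dom b))" unfolding loc_cls
    using act_from_arr[of "one (dom b)" b "one (dom b)"] t by simp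
  then have "inv_act b (farr (loc U) b) = frac_one (dom f)"
    using inv_act_act[OF 1 t(1)] t by simp
  then have "fcomp (farr (loc U) b) (cls (b, f, a)) = inv_act a (farr (loc U) f)"
    using fcomp_cls[OF b s] f by simp
  moreover have "farr (loc U) f \<in> frac_hom (dom f) (cod a)" using loc_in[OF t(2)] t by simp
  from act_inv_act[OF this t(3)] have "act a (inv_act a (farr (loc U) f)) = farr (loc U) f" by simp
  ultimately show ?thesis using fcomp_loc[OF fcomp_in[OF b s'], of a] t by simp
qed

end

section \<open>The functor induced on the fraction category\<close>

locale inverting_functor = uni_fractionable_category U + E: category E
  for U :: "('o, 'a) den_cat" and E :: "('p, 'b) cat" +
  fixes F :: "('o, 'a, 'p, 'b) functr"
  assumes F: "is_functor (base U) E F"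
    and inverts: "d \<in> Den U \<Longrightarrow> is_iso E (farr F d)"
begin

notation E.seq (infixr "\<bullet>" 70)

lemmas F_simps [simp] = is_functorD(3-8)[OF F]

definition val where "val = (\<lambda>(b, f, a). E.inv_arr (farr F b) \<bullet> farr F f \<bullet> E.inv_arr (farr F a))"

lemma F_inv [simp]:
  assumes "d \<in> Den U"
  shows "E.inv_arr (farr F d) \<in> arrs E" "src E (E.inv_arr (farr F d)) = fobj F (cod d)"
    "tgt E (E.inv_arr (farr F d)) = fobj F (dom d)"
    "farr F d \<bullet> E.inv_arr (farr F d) = ident E (fobj F (dom d))"
    "E.inv_arr (farr F d) \<bullet> farr F d = ident E (fobj F (cod d))"
    "\<lbrakk>z \<in> arrs E; src E z = fobj F (dom d)\<rbrakk> \<Longrightarrow> farr F d \<bullet> E.inv_arr (farr F d) \<bullet> z = z"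
    "\<lbrakk>z \<in> arrs E; src E z = fobj F (cod d)\<rbrakk> \<Longrightarrow> E.inv_arr (farr F d) \<bullet> farr F d \<bullet> z = z"
  using E.inv_arr_props[OF inverts[OF assms]] E.iso_inv_extend[OF inverts[OF assms]] assms by simp_all

text \<open>Characterises \<open>val\<close> by an equation free of inverses. Such an equation can
  be multiplied by the image of a further morphism, which is how extensions of 3-arrows are
  handled.\<close>

lemma val_iff:
  assumes s: "(b, f, a) \<in> T3"
    and v: "v \<in> arrs E" "src E v = fobj F (cod b)" "tgt E v = fobj F (dom a)"
  shows "v = val (b, f, a) \<longleftrightarrow> farr F b \<bullet> v \<bullet> farr F a = farr F f"
proof -
  note t = T3D[OF s(1)]
  have "v = E.inv_arr (farr F b) \<bullet> (farr F b \<bullet> v \<bullet> farr F a) \<bullet> E.inv_arr (farr F a)"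
    using t v by simp
  moreover have "farr F b \<bullet> val (b, f, a) \<bullet> farr F a = farr F f"
    unfolding val_def using t by simp
  ultimately show ?thesis unfolding val_def by auto
qed

lemma val_in:
  assumes "(b, f, a) \<in> T3"
  shows "val (b, f, a) \<in> arrs E" "src E (val (b, f, a)) = fobj F (cod b)"
    "tgt E (val (b, f, a)) = fobj F (dom a)"
  using assms by (auto simp: val_def T3_iff)

lemma val_eqv:
  assumes "s \<approx> t"
  shows "val s = val t"
  using assms
proof induction
  case (extend_right b f a c)
  note t = T3D[OF extend_right.hyps(1)]
  note v = val_in[OF extend_right.hyps(1)]
  have t': "(b, f ;; c, a ;; c) \<in> T3" using t extend_right.hyps by (auto simp: T3_iff)
  have "farr F b \<bullet> val (b, f, a) \<bullet> farr F a = farr F f"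
    using val_iff[OF extend_right.hyps(1) v] by simp
  then have "(farr F b \<bullet> val (b, f, a) \<bullet> farr F a) \<bullet> farr F c = farr F f \<bullet> farr F c" by simp
  then have "farr F b \<bullet> val (b, f, a) \<bullet> farr F (a ;; c) = farr F (f ;; c)"
    using t v extend_right.hyps(2-4) by simp
  then show ?case using val_iff[OF t', of "val (b, f, a)"] v t extend_right.hyps by simp
next
  case (extend_left b f a c)
  note t = T3D[OF extend_left.hyps(1)]
  note v = val_in[OF extend_left.hyps(1)]
  have t': "(c ;; b, c ;; f, a) \<in> T3" using t extend_left.hyps by (auto simp: T3_iff)
  have "farr F b \<bullet> val (b, f, a) \<bullet> farr F a = farr F f"
    using val_iff[OF extend_left.hyps(1) v] by simp
  then have "farr F (c ;; b) \<bullet> val (b, f, a) \<bullet> farr F a = farr F (c ;; f)"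
    using t v extend_left.hyps(2-4) by simp
  then show ?case using val_iff[OF t', of "val (b, f, a)"] v t extend_left.hyps by simp
qed simp_all

definition Gmap where "Gmap A = val (SOME s. s \<in> A)"

lemma Gmap_cls:
  assumes "s \<in> T3"
  shows "Gmap (cls s) = val s"
proof -
  have "(SOME t. t \<in> cls s) \<in> cls s"
    by (rule someI[of _ s]) (use assms eqv_refl in \<open>simp add: in_cls_iff del: split_paired_All\<close>)
  then show ?thesis unfolding Gmap_def in_cls_iff using val_eqv by simp
qed

lemma Gmap_in:
  assumes "A \<in> frac_hom X Y"
  shows "Gmap A \<in> arrs E" "src E (Gmap A) = fobj F X" "tgt E (Gmap A) = fobj F Y"
  using assms by (auto elim!: frac_homE simp: Gmap_cls val_in)

text \<open>Composition of fractions is made of actions and their inverses, so compatibility with a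
  single morphism is the essential case of functoriality; \<open>Gmap_inv_act\<close> and
  \<open>Gmap_fcomp\<close> follow formally.\<close>

lemma Gmap_act:
  assumes A: "A \<in> frac_hom X Y" and f: "f \<in> arr" "dom f = Y"
  shows "Gmap (act f A) = Gmap A \<bullet> farr F f"
proof -
  obtain b g i where s: "(b, g, i) \<in> T3" "i \<in> SDen U" "cod b = X" "dom i = Y" "A = cls (b, g, i)"
    using A by (rule S_rep)
  have g: "b \<in> Den U" "g \<in> arr" "dom b = dom g" "cod g = cod i"
    using s by (auto simp: T3_iff)
  obtain h i' where po: "h \<in> arr" "i' \<in> SDen U" "dom h = cod i" "dom i' = cod f"
    "cod h = cod i'" "i ;; h = f ;; i'"
    by (rule SDen_square[OF s(2) f(1)]) (use s f in auto)
  have 1: "act f A = cls (b, g ;; h, i')"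
    unfolding s(5) by (rule act_cls) (use s f po in auto)
  have t: "(b, g ;; h, i') \<in> T3" using g po by (auto simp: T3_iff)
  let ?v = "val (b, g, i)"
  note v = val_in[OF s(1)]
  have "farr F b \<bullet> ?v \<bullet> farr F i = farr F g" using val_iff[OF s(1) v] by simp
  then have e: "(farr F b \<bullet> ?v \<bullet> farr F i) \<bullet> farr F h = farr F g \<bullet> farr F h" by simp
  have "farr F i \<bullet> farr F h = farr F f \<bullet> farr F i'"
    using po s f is_functorD(8)[OF F, of i h] is_functorD(8)[OF F, of f i'] by simp
  then have "farr F b \<bullet> (?v \<bullet> farr F f) \<bullet> farr F i' = farr F (g ;; h)"
    using e v s g po f by simp
  then have 2: "?v \<bullet> farr F f = val (b, g ;; h, i')"
    using val_iff[OF t, of "?v \<bullet> farr F f"] v s f po by simp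
  have 3: "Gmap A = ?v" unfolding s(5) by (rule Gmap_cls[OF s(1)])
  show ?thesis unfolding 1 3 2 by (rule Gmap_cls[OF t])
qed

lemma Gmap_inv_act:
  assumes A: "A \<in> frac_hom X Y" and d: "d \<in> Den U" "cod d = Y"
  shows "Gmap (inv_act d A) = Gmap A \<bullet> E.inv_arr (farr F d)"
proof -
  have 1: "inv_act d A \<in> frac_hom X (dom d)" by (rule inv_act_in[OF A]) (use d in auto)
  have "Gmap A = Gmap (inv_act d A) \<bullet> farr F d"
    using Gmap_act[OF 1, of d] act_inv_act[OF A d] d by simp
  then show ?thesis using Gmap_in[OF 1] d by simp
qed

lemma Gmap_fcomp:
  assumes A: "A \<in> frac_hom X Y" and B: "B \<in> frac_hom Y Z"
  shows "Gmap (fcomp A B) = Gmap A \<bullet> Gmap B"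
  using B
proof (rule frac_homE)
  fix b f a assume s: "(b, f, a) \<in> T3" "cod b = Y" "dom a = Z" "B = cls (b, f, a)"
  note t = T3D[OF s(1)]
  have 1: "inv_act b A \<in> frac_hom X (dom f)" by (rule inv_act_in[OF A]) (use t s in auto)
  have 2: "act f (inv_act b A) \<in> frac_hom X (cod a)" by (rule act_in[OF 1]) (use t in auto)
  have "Gmap (fcomp A B) = ((Gmap A \<bullet> E.inv_arr (farr F b)) \<bullet> farr F f) \<bullet> E.inv_arr (farr F a)"
    unfolding s(4) fcomp_cls[OF A s(1,2)] Gmap_inv_act[OF 2 t(3) HOL.refl] Gmap_act[OF 1 t(2) HOL.refl]
      Gmap_inv_act[OF A t(1) s(2)] ..
  also have "\<dots> = Gmap A \<bullet> val (b, f, a)"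
    unfolding val_def using Gmap_in[OF A] t s(2) by simp
  finally show ?thesis unfolding s(4) using Gmap_cls[OF s(1)] by simp
qed

lemma Gmap_loc: "f \<in> arr \<Longrightarrow> Gmap (farr (loc U) f) = farr F f"
  unfolding loc_cls
  using Gmap_cls[OF T3_from_arr, of f] val_iff[OF T3_from_arr, of f "farr F f"] by simp

lemma functor_Gmap: "is_functor (Frac U) E \<lparr>fobj = fobj F, farr = Gmap\<rparr>" (is "is_functor _ _ ?G")
  unfolding is_functor_def
proof (intro conjI ballI impI)
  show "category (Frac U)" by (rule category_Frac)
  show "category E" by (rule E.category_axioms)
  show "\<And>X. X \<in> objs (Frac U) \<Longrightarrow> fobj ?G X \<in> objs E" by simp
  show "\<And>A. A \<in> arrs (Frac U) \<Longrightarrow> farr ?G A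
    \<in> hom E (fobj ?G (src (Frac U) A)) (fobj ?G (tgt (Frac U) A))"
    using Gmap_in[OF frac_hom_of_arr] by (simp add: hom_def)
  show "\<And>X. X \<in> objs (Frac U) \<Longrightarrow> farr ?G (ident (Frac U) X)
    = ident E (fobj ?G X)"
  proof -
    fix X assume X: "X \<in> objs (Frac U)"
    then have "frac_one X = farr (loc U) (one X)" by (simp add: loc_cls)
    then show "?thesis X" using Gmap_loc[of "one X"] X by (simp add: Frac_ident)
  qed
  fix A B assume AB: "A \<in> arrs (Frac U)" "B \<in> arrs (Frac U)" "tgt (Frac U) A = src (Frac U) B"
  then have "B \<in> frac_hom (tgt (Frac U) A) (tgt (Frac U) B)" using frac_hom_of_arr[of B] by simp
  then show "farr ?G (cmp (Frac U) A B) =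
       farr ?G A \<bullet> farr ?G B"
    using Gmap_fcomp Frac_cmp frac_hom_of_arr[OF AB(1)] by simp
qed

lemma Gmap_unique:
  assumes G: "is_functor (Frac U) E G" and eq: "functor_eq (base U) (functor_cmp (loc U) G) F"
  shows "functor_eq (Frac U) G \<lparr>fobj = fobj F, farr = Gmap\<rparr>" (is "functor_eq _ _ ?G")
  unfolding functor_eq_def
proof (intro conjI ballI)
  have o: "fobj G X = fobj F X" if "X \<in> objs (base U)" for X
    using eq that by (simp add: functor_eq_def functor_cmp_def loc_def)
  have m: "farr G (farr (loc U) f) = farr F f" if "f \<in> arr" for f
    using eq that by (simp add: functor_eq_def functor_cmp_def)
  show "\<And>X. X \<in> objs (Frac U) \<Longrightarrow> fobj G X = fobj ?G X"
    using o by simp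
  fix A assume "A \<in> arrs (Frac U)"
  then obtain s where "s \<in> T3" "A = cls s" by (auto simp: Frac_arrs)
  then obtain b f a where s: "(b, f, a) \<in> T3" "A = cls (b, f, a)" by (cases s) auto
  note t = T3D[OF s(1)]
  have A: "A \<in> frac_hom (cod b) (dom a)" using s by auto
  have b: "farr (loc U) b \<in> frac_hom (dom b) (cod b)"
    and a: "farr (loc U) a \<in> frac_hom (dom a) (cod a)"
    by (rule loc_in[OF Den_arr[OF t(1)]] loc_in[OF Den_arr[OF t(3)]])+
  have fr: "x \<in> arrs (Frac U)" "src (Frac U) x = X" "tgt (Frac U) x = Y" if "x \<in> frac_hom X Y" for x X Y
    using that Frac_hom by (auto simp: hom_def)
  have "farr (loc U) f = cmp (Frac U) (cmp (Frac U) (farr (loc U) b) A) (farr (loc U) a)"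
    unfolding Frac_cmp[OF b A] Frac_cmp[OF fcomp_in[OF b A] a] unfolding s(2)
    by (rule loc_factor[OF s(1), symmetric])
  then have "farr F f = farr G (cmp (Frac U) (cmp (Frac U) (farr (loc U) b) A) (farr (loc U) a))"
    using m t by metis
  also have "\<dots> = (farr F b \<bullet> farr G A) \<bullet> farr F a"
    using is_functorD(8)[OF G, of "cmp (Frac U) (farr (loc U) b) A" "farr (loc U) a"]
      is_functorD(8)[OF G, of "farr (loc U) b" A] fr[OF b] fr[OF A] fr[OF a]
      fr[OF fcomp_in[OF b A]] Frac_cmp[OF b A] m t by simp
  finally have "farr F b \<bullet> farr G A \<bullet> farr F a = farr F f"
    using is_functorD(4-6)[OF G fr(1)[OF A]] fr[OF A] o t by simp
  then have "farr G A = val (b, f, a)"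
    using val_iff[OF s(1), of "farr G A"] is_functorD(4-6)[OF G fr(1)[OF A]] fr[OF A] o t by simp
  then show "farr G A = farr ?G A"
    using s Gmap_cls by simp
qed

end

context uni_fractionable_category
begin

theorem localisation_Frac:
  "is_localisation TYPE('q) TYPE('c) (base U) (Den U) (Frac U) (loc U)"
  unfolding is_localisation_def
proof (intro conjI allI impI ballI)
  show "is_functor (base U) (Frac U) (loc U)" by (rule functor_loc)
  show "\<And>d. d \<in> Den U \<Longrightarrow> is_iso (Frac U) (farr (loc U) d)" by (rule loc_inverts)
  fix E :: "('q, 'c) cat" and F
  assume a: "is_functor (base U) E F \<and> (\<forall>d \<in> Den U. is_iso E (farr F d))"
  interpret E: category E using a by (simp add: is_functor_def)
  interpret inverting_functor U E F using a by unfold_locales auto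
  show "\<exists>G. is_functor (Frac U) E G \<and> functor_eq (base U) (functor_cmp (loc U) G) F \<and>
      (\<forall>G'. is_functor (Frac U) E G' \<and> functor_eq (base U) (functor_cmp (loc U) G') F \<longrightarrow>
        functor_eq (Frac U) G' G)"
  proof (intro exI[of _ "\<lparr>fobj = fobj F, farr = Gmap\<rparr>"] conjI allI impI)
    show "functor_eq (base U) (functor_cmp (loc U) \<lparr>fobj = fobj F, farr = Gmap\<rparr>) F"
      using Gmap_loc by (simp add: functor_eq_def functor_cmp_def loc_def)
  qed (use functor_Gmap Gmap_unique in auto)
qed

end

section \<open>Uniqueness of localisations\<close>

lemma functor_functor_cmp:
  assumes F: "is_functor C D F" and G: "is_functor D E G"
  shows "is_functor C E (functor_cmp F G)"
  using assms unfolding is_functor_def functor_cmp_def hom_def by auto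

text \<open>Each universal property is needed for two types of targets: for those of the other
  localisation to obtain the comparison functor, and for its own to see that the composite
  endofunctor is the identity.\<close>

lemma localisation_unique:
  fixes H :: "('p, 'b) cat" and L :: "('q, 'c) cat"
  assumes H: "is_localisation TYPE('p) TYPE('b) C D H \<gamma>" "is_localisation TYPE('q) TYPE('c) C D H \<gamma>"
    and L: "is_localisation TYPE('p) TYPE('b) C D L l" "is_localisation TYPE('q) TYPE('c) C D L l"
  shows "\<exists>\<Phi>. is_cat_iso H L \<Phi> \<and> functor_eq C (functor_cmp \<gamma> \<Phi>) l"
proof -
  have fH: "is_functor C H \<gamma>" "\<And>d. d \<in> D \<Longrightarrow> is_iso H (farr \<gamma> d)"
    and fL: "is_functor C L l" "\<And>d. d \<in> D \<Longrightarrow> is_iso L (farr l d)"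
    using H(1) L(1) unfolding is_localisation_def by blast+
  obtain \<Phi> where \<Phi>: "is_functor H L \<Phi>" "functor_eq C (functor_cmp \<gamma> \<Phi>) l"
    using H(2) fL unfolding is_localisation_def by blast
  obtain \<Psi> where \<Psi>: "is_functor L H \<Psi>" "functor_eq C (functor_cmp l \<Psi>) \<gamma>"
    using L(1) fH unfolding is_localisation_def by blast
  have id: "is_functor X X functor_id" if "category X" for X :: "('u, 'v) cat"
  proof -
    interpret category X by (rule that)
    show ?thesis unfolding is_functor_def functor_id_def by (auto simp: that hom_def)
  qed
  obtain G where G: "\<And>G'. is_functor H H G' \<Longrightarrow> functor_eq C (functor_cmp \<gamma> G') \<gamma> \<Longrightarrow> functor_eq H G' G"
    using H(1) fH unfolding is_localisation_def by blast
  obtain K where K: "\<And>G'. is_functor L L G' \<Longrightarrow> functor_eq C (functor_cmp l G') l \<Longrightarrow> functor_eq L G' K"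
    using L(2) fL unfolding is_localisation_def by blast
  have "functor_eq H (functor_cmp \<Phi> \<Psi>) G"
    by (rule G[OF functor_functor_cmp[OF \<Phi>(1) \<Psi>(1)]])
      (use \<Phi>(2) \<Psi>(2) in \<open>auto simp: functor_eq_def functor_cmp_def\<close>)
  moreover have "functor_eq H functor_id G"
    by (rule G[OF id]) (use fH in \<open>auto simp: functor_eq_def functor_cmp_def functor_id_def is_functor_def\<close>)
  ultimately have 1: "functor_eq H (functor_cmp \<Phi> \<Psi>) functor_id" by (auto simp: functor_eq_def)
  have "functor_eq L (functor_cmp \<Psi> \<Phi>) K"
    by (rule K[OF functor_functor_cmp[OF \<Psi>(1) \<Phi>(1)]])
      (use \<Phi>(2) \<Psi>(2) in \<open>auto simp: functor_eq_def functor_cmp_def\<close>)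
  moreover have "functor_eq L functor_id K"
    by (rule K[OF id]) (use fL in \<open>auto simp: functor_eq_def functor_cmp_def functor_id_def is_functor_def\<close>)
  ultimately have 2: "functor_eq L (functor_cmp \<Psi> \<Phi>) functor_id" by (auto simp: functor_eq_def)
  show ?thesis unfolding is_cat_iso_def using \<Phi> \<Psi>(1) 1 2 by blast
qed

section \<open>Saturation\<close>

context uni_fractionable_category
begin

text \<open>An extension multiplies the middle part by \<open>c\<close>, which is a denominator by
  two-out-of-three.\<close>

lemma eqv_Den:
  assumes "s \<approx> t" "s = (b, f, a)" "t = (b', f', a')"
  shows "f \<in> Den U \<longleftrightarrow> f' \<in> Den U"
  using assms
proof (induction arbitrary: b f a b' f' a')
  case (extend_right b1 f1 a1 c)
  note t = T3D[OF extend_right.hyps(1)]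
  have c: "c \<in> Den U" using extend_right.hyps t by (intro Den_cancel_left[of a1 c]) auto
  then have "f1 \<in> Den U \<longleftrightarrow> f1 ;; c \<in> Den U"
    using Den_cancel_right[OF _ c t(2) extend_right.hyps(3)] Den_seq[OF _ c extend_right.hyps(3)]
    by blast
  then show ?case using extend_right.prems by simp
next
  case (extend_left b1 f1 a1 c)
  note t = T3D[OF extend_left.hyps(1)]
  have c: "c \<in> Den U" using extend_left.hyps t by (intro Den_cancel_right[of c b1]) auto
  then have "f1 \<in> Den U \<longleftrightarrow> c ;; f1 \<in> Den U"
    using Den_cancel_left[OF _ c t(2) extend_left.hyps(3)] Den_seq[OF c _ extend_left.hyps(3)]
    by blast
  then show ?case using extend_left.prems by simp
next
  case (trans s u s')
  obtain x y z where "u = (x, y, z)" by (rule prod_cases3)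
  then show ?case using trans by blast
qed auto

lemma eqv_one_Den:
  assumes "cls (b, f, a) = frac_one X" "(b, f, a) \<in> T3" "X \<in> objs (base U)"
  shows "f \<in> Den U"
proof -
  have "(b, f, a) \<approx> (one X, one X, one X)"
    using assms cls_eq_iff[OF assms(2) one_T3[OF assms(3)]] by simp
  from eqv_Den[OF this HOL.refl HOL.refl] show ?thesis using assms(3) by simp
qed

text \<open>If \<open>b\<close>, \<open>g\<close>, \<open>i\<close> represent the inverse of \<open>f\<close>, then the two composites of \<open>f\<close> and its inverse
  have 3-arrows whose middle parts are denominators. These are \<open>f\<^sub>1 g'\<close> and \<open>g f'\<close>, where \<open>g'\<close>
  differs from \<open>g\<close>, \<open>f'\<close> and \<open>f\<^sub>1\<close> differ from \<open>f\<close> by denominators only.\<close>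

theorem saturated_if_two_of_six:
  assumes two_of_six: "\<And>f g h. \<lbrakk>f \<in> arr; g \<in> arr; h \<in> arr; cod f = dom g; cod g = dom h;
    f ;; g \<in> Den U; g ;; h \<in> Den U\<rbrakk> \<Longrightarrow> g \<in> Den U"
  shows "saturated U"
  unfolding saturated_def
proof (intro ballI impI)
  fix f assume f: "f \<in> arr" and iso: "is_iso (Frac U) (farr (loc U) f)"
  have l: "farr (loc U) f \<in> frac_hom (dom f) (cod f)" by (rule loc_in[OF f])
  obtain B where B: "B \<in> frac_hom (cod f) (dom f)"
    "fcomp (farr (loc U) f) B = frac_one (dom f)" "fcomp B (farr (loc U) f) = frac_one (cod f)"
    using iso unfolding is_iso_def Frac_hom Frac_src[OF l] Frac_tgt[OF l] Frac_ident
    using Frac_cmp[OF l] Frac_cmp[OF _ l] by metis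
  obtain b g i where s: "(b, g, i) \<in> T3" "i \<in> SDen U" "cod b = cod f" "dom i = dom f" "B = cls (b, g, i)"
    using B(1) by (rule S_rep)
  have g: "b \<in> Den U" "g \<in> arr" "dom b = dom g" "cod g = cod i" "i \<in> Den U"
    using s by (auto simp: T3_iff)
  obtain f' i' where po: "f' \<in> arr" "i' \<in> SDen U" "dom f' = cod i" "dom i' = cod f"
    "cod f' = cod i'" "i ;; f' = f ;; i'"
    by (rule SDen_square[OF s(2) f]) (use s in auto)
  have "fcomp B (farr (loc U) f) = act f B" by (rule fcomp_loc[OF B(1) f HOL.refl])
  also have "\<dots> = cls (b, g ;; f', i')"
    unfolding s(5) by (rule act_cls) (use s f po in auto)
  finally have 1: "g ;; f' \<in> Den U"
    using B(3) eqv_one_Den[of b "g ;; f'" i' "cod f"] g f po by (simp add: T3_iff)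
  \<comment> \<open>In the composite of \<open>loc f\<close> and \<open>B\<close> the denominator
    \<open>b\<close> is undone before \<open>g\<close> acts. As \<open>b\<close> is arbitrary, it is
    traded for an S-denominator \<open>j\<close>, which has a weak pushout with
    \<open>g\<close>.\<close>
  have 2: "(one (dom f), f, b) \<in> T3" using f g s(3) by (simp add: T3_iff)
  obtain q f1 j p where n: "j \<in> SDen U" "p \<in> TDen U" "q \<in> TDen U" "f1 \<in> arr"
     "cod j = dom p" "cod q = dom f" "dom f1 = dom q" "cod f1 = cod j"
     "b = j ;; p" "f1 ;; p = q ;; f" "(one (dom f), f, b) \<approx> (q ;; one (dom f), f1, j)"
    using 2 by (rule S_normal_form)
  have dj: "dom j = dom g" using n g(3) by auto
  obtain g' j' where po': "g' \<in> arr" "j' \<in> SDen U" "dom g' = cod j" "dom j' = cod g"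
    "cod g' = cod j'" "j ;; g' = g ;; j'"
    by (rule SDen_square[OF n(1) g(2)]) (use dj in auto)
  have 3: "(q ;; one (dom f), f1, j) \<in> T3" using n(11) eqv_T3 by blast
  have "inv_act b (farr (loc U) f) = cls (one (dom f), f, b)"
    unfolding loc_cls using inv_act_cls[OF T3_from_arr[OF f] g(1)] f s(3) g(1) by simp
  also have "\<dots> = cls (q ;; one (dom f), f1, j)" by (rule cls_eqI[OF n(11)])
  finally have "act g (inv_act b (farr (loc U) f)) = cls (q ;; one (dom f), f1 ;; g', j')"
    by (simp, intro act_cls[OF 3]) (use g(2) po' n(1) dj in auto)
  moreover have 4: "(q ;; one (dom f), f1 ;; g', j') \<in> T3"
    using f n(1-8) po' by (auto simp: T3_iff)
  ultimately have "fcomp (farr (loc U) f) B = cls (q ;; one (dom f), f1 ;; g', i ;; j')"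
    unfolding s(5) using fcomp_cls[OF l s(1,3)] inv_act_cls[OF 4 g(5)] po' g(4) by simp
  moreover have "(q ;; one (dom f), f1 ;; g', i ;; j') \<in> T3"
    using 4 g(4,5) po' by (auto simp: T3_iff)
  ultimately have 5: "f1 ;; g' \<in> Den U"
    using B(2) eqv_one_Den[of "q ;; one (dom f)" "f1 ;; g'" "i ;; j'" "dom f"] f by simp
  \<comment> \<open>\<open>g'\<close> is continued by \<open>f''\<close> so that it becomes the
    middle one of three morphisms: \<open>j g' f'' = g f' j''\<close>, hence \<open>g' f''\<close>
    is a denominator because \<open>g f'\<close> is.\<close>
  obtain f'' j'' where po'': "f'' \<in> arr" "j'' \<in> SDen U" "dom f'' = cod j'" "dom j'' = cod f'"
    "cod f'' = cod j''" "j' ;; f'' = f' ;; j''"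
    by (rule SDen_square[OF po'(2) po(1)]) (use po po' g in auto)
  have "j ;; g' ;; f'' = g ;; j' ;; f''"
    by (rule seq_eq_extend) (use n(1) po' po'' g dj in auto)
  also have "\<dots> = (g ;; f') ;; j''" using g po po'' by simp
  finally have "j ;; g' ;; f'' \<in> Den U" using 1 po po'' g by (simp del: seq_assoc)
  then have 6: "g' ;; f'' \<in> Den U"
    by (rule Den_cancel_left) (use n(1) po' po'' in auto)
  have "g' \<in> Den U"
    by (rule two_of_six[of f1 g' f'']) (use 5 6 n(4,8) po' po'' in auto)
  then have "f1 \<in> Den U" by (rule Den_cancel_right[OF 5]) (use n(4,8) po' in auto)
  then have "q ;; f \<in> Den U" unfolding n(10)[symmetric] using n(2,5,8) by auto
  then show "f \<in> Den U" by (rule Den_cancel_left) (use n(3,6) f in auto)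
qed

subsection \<open>Initial objects\<close>

text \<open>Factor \<open>b = i p\<close> and take a weak pushout of \<open>i\<close> and
  \<open>f\<close>: then \<open>(p, f', a i')\<close> extended on the left by \<open>i\<close> is
  \<open>(b, f, a)\<close> extended on the right by \<open>i'\<close>.\<close>

lemma T_rep:
  assumes "A \<in> frac_hom X Y"
  obtains p f a where "(p, f, a) \<in> T3" "p \<in> TDen U" "cod p = X" "dom a = Y" "A = cls (p, f, a)"
proof -
  obtain b f a where s: "(b, f, a) \<in> T3" "cod b = X" "dom a = Y" "A = cls (b, f, a)"
    using assms by (rule frac_homE)
  note t = T3D[OF s(1)]
  obtain i p where ip: "i \<in> SDen U" "p \<in> TDen U" "cod i = dom p" "b = i ;; p"
    using Den_factor[OF t(1)] by blast
  have di: "dom f = dom i" using ip t(4) by auto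
  obtain f' i' where po: "f' \<in> arr" "i' \<in> SDen U" "dom f' = cod i" "dom i' = cod f"
    "cod f' = cod i'" "i ;; f' = f ;; i'"
    by (rule SDen_square[OF ip(1) t(2) di])
  have T: "(p, f', a ;; i') \<in> T3" using po ip(1-3) t(3,5) by (auto simp: T3_iff)
  have 1: "(p, f', a ;; i') \<approx> (b, f ;; i', a ;; i')"
    by (rule eqv_left_eq[OF T, of i]) (use po ip t(1) in auto)
  have "(b, f, a) \<approx> (b, f ;; i', a ;; i')"
    by (rule eqv_right[OF s(1)]) (use po t(3,5) in auto)
  then have "cls (b, f, a) = cls (p, f', a ;; i')" by (rule cls_eqI[OF eqv_join[OF _ 1]])
  then show thesis using that[OF T ip(2)] s(2-4) ip t(3,5) po by simp
qed

text \<open>A section of the left denominator removes it by an extension on the left. This applies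
  to initial \<open>X\<close>, and to cofibrant \<open>X\<close> in a model category, where acyclic
  fibrations onto \<open>X\<close> split.\<close>

lemma split_rep:
  assumes A: "A \<in> frac_hom X Y"
    and split: "\<And>p. \<lbrakk>p \<in> TDen U; cod p = X\<rbrakk> \<Longrightarrow> \<exists>s \<in> arr. dom s = X \<and> cod s = dom p \<and> s ;; p = one X"
  obtains f a where "(one X, f, a) \<in> T3" "dom f = X" "dom a = Y" "A = cls (one X, f, a)"
proof -
  obtain p f a where s: "(p, f, a) \<in> T3" "p \<in> TDen U" "cod p = X" "dom a = Y" "A = cls (p, f, a)"
    using A by (rule T_rep)
  have t: "f \<in> arr" "a \<in> Den U" "dom p = dom f" "cod f = cod a"
    using s by (auto simp: T3_iff)
  obtain r where r: "r \<in> arr" "dom r = X" "cod r = dom p" "r ;; p = one X"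
    using split[OF s(2,3)] by blast
  have X: "X \<in> objs (base U)" using r by auto
  have "(p, f, a) \<approx> (one X, r ;; f, a)"
    by (rule eqv_left_eq[OF s(1), of r]) (use r t X in auto)
  then have "A = cls (one X, r ;; f, a)" unfolding s(5) by (rule cls_eqI)
  moreover have "(one X, r ;; f, a) \<in> T3" using r t X by (auto simp: T3_iff)
  ultimately show thesis using that[of "r ;; f" a] r t s(4) by simp
qed

end

lemma is_initial_iff:
  "is_initial C I \<longleftrightarrow> I \<in> objs C \<and> (\<forall>X \<in> objs C. \<exists>!f. f \<in> hom C I X)"
  by (simp add: is_initial_def is_terminal_def)

context uni_fractionable_category
begin

text \<open>T-denominators into \<open>I\<close> split, because morphisms out of \<open>I\<close>
  with the same target agree. For the same reason \<open>f = u a\<close>, so the remaining fraction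
  is \<open>loc u\<close> extended by \<open>a\<close>.\<close>

lemma initial_Frac:
  assumes I: "is_initial (base U) I"
  shows "is_initial (Frac U) I"
  unfolding is_initial_iff
proof (intro conjI ballI)
  have io: "I \<in> objs (base U)" using I by (simp add: is_initial_iff)
  then show "I \<in> objs (Frac U)" by simp
  fix Y assume Y: "Y \<in> objs (Frac U)"
  have uniq: "f = g" if "f \<in> arr" "g \<in> arr" "dom f = I" "dom g = I" "cod f = cod g" for f g
    using I that unfolding is_initial_iff hom_def by (metis (mono_tags, lifting) mem_Collect_eq tgt_obj)
  obtain u where u: "u \<in> arr" "dom u = I" "cod u = Y"
    using I Y unfolding is_initial_iff hom_def by auto
  show "\<exists>!f. f \<in> hom (Frac U) I Y"
    unfolding Frac_hom
  proof (rule ex1I[of _ "farr (loc U) u"])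
    show "farr (loc U) u \<in> frac_hom I Y" using loc_in[OF u(1)] u by simp
    fix A assume A: "A \<in> frac_hom I Y"
    have "\<exists>s \<in> arr. dom s = I \<and> cod s = dom p \<and> s ;; p = one I" if p: "p \<in> TDen U" "cod p = I" for p
    proof -
      obtain s where s: "s \<in> arr" "dom s = I" "cod s = dom p"
        using I p unfolding is_initial_iff hom_def by (metis (mono_tags, lifting) TDen_Den' Den_arr mem_Collect_eq src_obj)
      moreover have "s ;; p = one I" by (rule uniq) (use s p io in auto)
      ultimately show ?thesis by blast
    qed
    with A obtain f a where f: "(one I, f, a) \<in> T3" "dom f = I" "dom a = Y" "A = cls (one I, f, a)"
      by (rule split_rep)
    have t: "f \<in> arr" "a \<in> Den U" "cod f = cod a" using f by (auto simp: T3_iff)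
    have "f = u ;; a" by (rule uniq) (use f t u in auto)
    then have "(one I, u, one Y) \<approx> (one I, f, a)"
      by (intro eqv_right_eq[where c = a]) (use f t u io Y in \<open>auto simp: T3_iff\<close>)
    then show "A = farr (loc U) u" unfolding f(4) loc_cls using u cls_eqI by simp
  qed
qed

end

section \<open>Duality\<close>

definition op_den_cat :: "('o, 'a) den_cat \<Rightarrow> ('o, 'a) den_cat" where
  "op_den_cat U = \<lparr>base = op_cat (base U), Den = Den U, SDen = TDen U, TDen = SDen U\<rparr>"

lemma op_den_cat_simps [simp]:
  "base (op_den_cat U) = op_cat (base U)" "Den (op_den_cat U) = Den U"
  "SDen (op_den_cat U) = TDen U" "TDen (op_den_cat U) = SDen U"
  by (simp_all add: op_den_cat_def)

lemma category_op_cat: "category C \<Longrightarrow> category (op_cat C)"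
proof -
  assume "category C"
  then interpret category C .
  show ?thesis by unfold_locales (simp_all add: hom_def)
qed

lemma op_closed_under_cmp [simp]: "closed_under_cmp (op_cat C) D \<longleftrightarrow> closed_under_cmp C D"
  by (auto simp: closed_under_cmp_def)

lemma op_multiplicative [simp]: "multiplicative (op_cat C) D \<longleftrightarrow> multiplicative C D"
  by (simp add: multiplicative_def)

lemma op_two_of_three [simp]: "two_of_three (op_cat C) D \<longleftrightarrow> two_of_three C D"
  unfolding two_of_three_def by auto

lemma is_iso_op_cat [simp]: "is_iso (op_cat C) f \<longleftrightarrow> is_iso C f"
  unfolding is_iso_def by auto

lemma op_uni_fractionable:
  assumes "uni_fractionable_category U"
  shows "uni_fractionable_category (op_den_cat U)"
proof -
  interpret uni_fractionable_category U by (rule assms)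
  let ?B = "base (op_den_cat U)"
  let ?U = "op_den_cat U"
  show ?thesis
  proof (rule uni_fractionable_category.intro)
    show "category (?B)" using category_op_cat[OF cat] by simp
    show "semi_saturated (?B) (Den (?U))"
      using Den_semi_saturated by (simp add: semi_saturated_def)
    show "\<And>d. d \<in> Den (?U) \<Longrightarrow> \<exists>i \<in> SDen (?U). \<exists>p \<in> TDen (?U).
        tgt (?B) i = src (?B) p \<and> d = cmp (?B) i p"
      using factorisation by simp metis
  qed (use SDen_multiplicative TDen_multiplicative SDen_Den TDen_Den weak_pullback weak_pushout
       in \<open>auto simp: is_weak_pushout_def\<close>)
qed

definition flip :: "'a three_arrow \<Rightarrow> 'a three_arrow" where
  "flip = (\<lambda>(b, f, a). (a, f, b))"

lemma flip_simp [simp]: "flip (b, f, a) = (a, f, b)" and flip_flip [simp]: "flip (flip s) = s"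
  by (auto simp: flip_def split: prod.split)

lemma op_den_cat_op_den_cat [simp]: "op_den_cat (op_den_cat U) = U"
  by (simp add: op_den_cat_def)

lemma flip_three_arrows: "s \<in> three_arrows U \<Longrightarrow> flip s \<in> three_arrows (op_den_cat U)"
  by (auto simp: three_arrows_def)

lemma flip_frac_equality:
  assumes "(s, t) \<in> frac_equality U"
  shows "(flip s, flip t) \<in> frac_equality (op_den_cat U)"
  using assms
proof induction
  case (extend_right b f a c)
  then show ?case
    using frac_equality.extend_left[of a f b "op_den_cat U" c] flip_three_arrows[of "(b, f, a)" U] by simp
next
  case (extend_left b f a c)
  then show ?case
    using frac_equality.extend_right[of a f b "op_den_cat U" c] flip_three_arrows[of "(b, f, a)" U] by simp
next
  case (refl s)
  then show ?case by (intro frac_equality.refl flip_three_arrows)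
next
  case (sym s t)
  show ?case by (rule frac_equality.sym[OF sym.IH])
next
  case (trans s t u)
  show ?case by (rule frac_equality.trans[OF trans.IH])
qed

text \<open>The recipe for composites is self-dual: \<open>j\<close> changes places with
  \<open>q\<close>, \<open>j'\<close> with \<open>q'\<close>, and \<open>f1'\<close> with
  \<open>f2'\<close>.\<close>

lemma flip_frac_composite:
  assumes "frac_composite U s t r"
  shows "frac_composite (op_den_cat U) (flip t) (flip s) (flip r)"
proof -
  obtain b1 f1 a1 where s1: "s = (b1, f1, a1)" by (rule prod_cases3)
  obtain b2 f2 a2 where t1: "t = (b2, f2, a2)" by (rule prod_cases3)
  obtain j q q' j' f1' f2' where d: "j \<in> SDen U" "q \<in> TDen U" "q' \<in> TDen U" "j' \<in> SDen U"
    "tgt (base U) j = src (base U) q" "cmp (base U) b2 a1 = cmp (base U) j q"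
    "comm_square (base U) f1 q f1' q'" "comm_square (op_cat (base U)) f2 j f2' j'"
    "r = (cmp (base U) q' b1, cmp (base U) f1' f2', cmp (base U) a2 j')"
    using assms unfolding s1 t1 frac_composite_def Let_def by auto
  show ?thesis
    unfolding s1 t1 d(9) frac_composite_def Let_def flip_simp prod.case op_den_cat_simps
      op_cat_simps op_cat_op_cat
    by (rule bexI[of _ q], rule bexI[of _ j], rule bexI[of _ j'], rule bexI[of _ q'],
        rule exI[of _ f2'], rule exI[of _ f1'], intro conjI)
      (use d in simp_all)
qed

section \<open>Comparison of a fraction category with that of the opposite category\<close>

locale op_uni_fractionable_category = uni_fractionable_category U for U :: "('o, 'a) den_cat"
begin

sublocale opU: uni_fractionable_category "op_den_cat U"
  by (rule op_uni_fractionable) (rule uni_fractionable_category_axioms)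

lemma flip_cls: "s \<in> T3 \<Longrightarrow> flip ` cls s = opU.cls (flip s)"
proof (intro set_eqI iffI)
  show "t \<in> opU.cls (flip s)" if "t \<in> flip ` cls s" for t
  proof -
    obtain u where u: "t = flip u" "s \<approx> u" using \<open>t \<in> flip ` cls s\<close> in_cls_iff by blast
    show ?thesis unfolding u(1) opU.in_cls_iff by (rule flip_frac_equality[OF u(2)])
  qed
  show "t \<in> flip ` cls s" if "t \<in> opU.cls (flip s)" for t
  proof (rule image_eqI[of _ _ "flip t"])
    have "(flip s, t) \<in> frac_equality (op_den_cat U)" using that by (simp add: opU.in_cls_iff)
    from flip_frac_equality[OF this] show "flip t \<in> cls s" by (simp add: in_cls_iff)
  qed simp
qed

lemma flip_frac_hom:
  assumes "A \<in> frac_hom X Y"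
  shows "flip ` A \<in> opU.frac_hom Y X"
  using assms
proof (rule frac_homE)
  fix b f a assume s: "(b, f, a) \<in> T3" "cod b = X" "dom a = Y" "A = cls (b, f, a)"
  show ?thesis
    unfolding s(4) flip_cls[OF s(1)] flip_simp
    by (rule opU.cls_in_frac_hom) (use flip_three_arrows[OF s(1)] s(2,3) in simp_all)
qed

lemma flip_frac_hom':
  assumes "A \<in> opU.frac_hom X Y"
  shows "flip ` A \<in> frac_hom Y X"
proof -
  obtain b f a where s: "(b, f, a) \<in> opU.T3" "opU.cod b = X" "opU.dom a = Y" "A = opU.cls (b, f, a)"
    using assms by (rule opU.frac_homE)
  have t: "(a, f, b) \<in> T3" using flip_three_arrows[OF s(1)] by simp
  have "A = flip ` cls (a, f, b)" using flip_cls[OF t] s(4) by simp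
  then have "flip ` A = cls (a, f, b)" by (simp add: image_image)
  then show ?thesis using t s by auto
qed

text \<open>\<open>fcomp\<close> treats its two arguments differently, so the symmetry is seen only
  on a composite 3-arrow, which represents both sides.\<close>

lemma flip_fcomp:
  assumes A: "A \<in> frac_hom X Y" and B: "B \<in> frac_hom Y Z"
  shows "flip ` fcomp A B = opU.fcomp (flip ` B) (flip ` A)"
proof -
  obtain s where s: "s \<in> T3" "src3 s = X" "tgt3 s = Y" "A = cls s"
    using A unfolding frac_hom_def by blast
  obtain t where t: "t \<in> T3" "src3 t = Y" "tgt3 t = Z" "B = cls t"
    using B unfolding frac_hom_def by blast
  obtain r where r: "frac_composite U s t r"
    using frac_composite_exists[OF s(1) t(1)] s t by auto
  have st: "tgt3 s = src3 t" using s t by simp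
  have ts: "opU.tgt3 (flip t) = opU.src3 (flip s)"
    using st by (cases s; cases t) (simp add: tgt3_def src3_def opU.tgt3_def opU.src3_def)
  note 1 = frac_composite_cls[OF s(1) t(1) st r]
  note 2 = opU.frac_composite_cls[OF flip_three_arrows[OF t(1)] flip_three_arrows[OF s(1)] ts
      flip_frac_composite[OF r]]
  show ?thesis
    using 1 2 flip_cls s t by metis
qed

lemma flip_loc: "f \<in> arr \<Longrightarrow> flip ` farr (loc U) f = farr (loc (op_den_cat U)) f"
  unfolding loc_cls opU.loc_cls by (simp add: flip_cls T3_from_arr)

lemma terminal_from_op: "is_initial (Frac (op_den_cat U)) T \<Longrightarrow> is_terminal (Frac U) T"
  unfolding is_initial_iff is_terminal_def Frac_hom opU.Frac_hom
proof (elim conjE, intro conjI ballI)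
  assume T: "T \<in> objs (Frac (op_den_cat U))"
    "\<forall>X \<in> objs (Frac (op_den_cat U)). \<exists>!f. f \<in> opU.frac_hom T X"
  show "T \<in> objs (Frac U)" using T(1) by simp
  fix X assume "X \<in> objs (Frac U)"
  then have "\<exists>!f. f \<in> opU.frac_hom T X" using T(2) by simp
  then obtain A where A: "A \<in> opU.frac_hom T X" "\<And>B. B \<in> opU.frac_hom T X \<Longrightarrow> B = A" by blast
  show "\<exists>!f. f \<in> frac_hom X T"
  proof (rule ex1I[of _ "flip ` A"])
    show "flip ` A \<in> frac_hom X T" by (rule flip_frac_hom'[OF A(1)])
    fix B assume "B \<in> frac_hom X T"
    then have "flip ` B = A" using A(2) flip_frac_hom by blast
    then show "B = flip ` A" by (auto simp: image_image)
  qed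
qed

lemma product_from_op:
  assumes Q: "is_coproduct (Frac (op_den_cat U)) X1 X2 P (farr (loc (op_den_cat U)) p1) (farr (loc (op_den_cat U)) p2)"
    and p: "p1 \<in> hom (base U) P X1" "p2 \<in> hom (base U) P X2"
  shows "is_product (Frac U) X1 X2 P (farr (loc U) p1) (farr (loc U) p2)"
proof -
  let ?ol = "farr (loc (op_den_cat U))"
  let ?l = "farr (loc U)"
  have p': "p1 \<in> arr" "p2 \<in> arr" "dom p1 = P" "dom p2 = P" "cod p1 = X1" "cod p2 = X2"
    using p by (auto simp: hom_def)
  have l: "?l p1 \<in> frac_hom P X1" "?l p2 \<in> frac_hom P X2"
    using loc_in[OF p'(1)] loc_in[OF p'(2)] p'(3-6) by simp_all
  have ol: "?ol p1 \<in> opU.frac_hom X1 P" "?ol p2 \<in> opU.frac_hom X2 P"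
    using flip_frac_hom[OF l(1)] flip_frac_hom[OF l(2)] flip_loc[OF p'(1)] flip_loc[OF p'(2)] by simp_all
  show ?thesis
    unfolding is_product_def Frac_hom
  proof (intro conjI allI ballI)
    fix Z A1 A2 assume A: "A1 \<in> frac_hom Z X1" "A2 \<in> frac_hom Z X2"
    \<comment> \<open>Moves each condition on a mediating fraction to the opposite side; as
      \<open>flip\<close> is injective, it is an equivalence.\<close>
    have cm: "cmp (Frac U) H (?l q) = A \<longleftrightarrow>
        opU.fcomp (?ol q) (flip ` H) = flip ` A"
      if H: "H \<in> frac_hom Z P" and q: "q \<in> arr" "dom q = P" for H q A
    proof -
      have lq: "?l q \<in> frac_hom P (cod q)" using loc_in[OF q(1)] q(2) by simp
      have "inj (flip :: 'a three_arrow \<Rightarrow> _)" by (metis flip_flip injI)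
      then show ?thesis
        unfolding Frac_cmp[OF H lq] flip_loc[OF q(1), symmetric] flip_fcomp[OF H lq, symmetric]
        by (simp add: inj_image_eq_iff)
    qed
    have "\<exists>!H. H \<in> opU.frac_hom P Z \<and> opU.fcomp (?ol p1) H = flip ` A1 \<and>
        opU.fcomp (?ol p2) H = flip ` A2"
    proof -
      have "\<exists>!H. H \<in> opU.frac_hom P Z \<and> cmp (Frac (op_den_cat U)) (?ol p1) H = flip ` A1 \<and>
        cmp (Frac (op_den_cat U)) (?ol p2) H = flip ` A2"
        using Q flip_frac_hom[OF A(1)] flip_frac_hom[OF A(2)]
        unfolding is_coproduct_def is_product_def by (simp add: opU.Frac_hom)
      then show ?thesis using opU.Frac_cmp[OF ol(1)] opU.Frac_cmp[OF ol(2)] by (metis (lifting))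
    qed
    then obtain H where H: "H \<in> opU.frac_hom P Z" "opU.fcomp (?ol p1) H = flip ` A1"
        "opU.fcomp (?ol p2) H = flip ` A2"
      and uniq: "\<And>K. \<lbrakk>K \<in> opU.frac_hom P Z; opU.fcomp (?ol p1) K = flip ` A1;
        opU.fcomp (?ol p2) K = flip ` A2\<rbrakk> \<Longrightarrow> K = H"
    proof (rule ex1E)
      fix H
      assume *: "H \<in> opU.frac_hom P Z \<and> opU.fcomp (?ol p1) H = flip ` A1 \<and>
          opU.fcomp (?ol p2) H = flip ` A2"
        "\<forall>K. K \<in> opU.frac_hom P Z \<and> opU.fcomp (?ol p1) K = flip ` A1 \<and>
          opU.fcomp (?ol p2) K = flip ` A2 \<longrightarrow> K = H"
      show thesis
        by (rule that[OF *(1)[THEN conjunct1] *(1)[THEN conjunct2, THEN conjunct1]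
          *(1)[THEN conjunct2, THEN conjunct2] *(2)[rule_format]]) (intro conjI)
    qed
    have H': "flip ` H \<in> frac_hom Z P" by (rule flip_frac_hom'[OF H(1)])
    have ff: "flip ` flip ` K = K" for K :: "'a three_arrow set" by (simp add: image_image)
    show "\<exists>!h. h \<in> frac_hom Z P \<and> cmp (Frac U) h (?l p1) = A1 \<and> cmp (Frac U) h (?l p2) = A2"
    proof (rule ex1I[of _ "flip ` H"])
      show "flip ` H \<in> frac_hom Z P \<and> cmp (Frac U) (flip ` H) (?l p1) = A1 \<and>
          cmp (Frac U) (flip ` H) (?l p2) = A2"
        using H' cm[OF H' p'(1,3)] cm[OF H' p'(2,4)] H ff by simp
      fix K assume K: "K \<in> frac_hom Z P \<and> cmp (Frac U) K (?l p1) = A1 \<and>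
          cmp (Frac U) K (?l p2) = A2"
      have "flip ` K = H"
        by (rule uniq) (use K flip_frac_hom cm[of K] p' in auto)
      then show "K = flip ` H" using ff by metis
    qed
  qed (use l in auto)
qed

end

section \<open>Model categories\<close>

subsection \<open>Limits\<close>

lemma has_terminal:
  assumes "category C" "has_finite_limits C"
  obtains T where "is_terminal C T"
proof -
  let ?J = "\<lparr>objs = {}, arrs = {}, src = id, tgt = id, ident = id, cmp = (\<lambda>x y. x)\<rparr> :: (nat, nat) cat"
  have "category ?J" by unfold_locales simp_all
  then have "is_functor ?J C D" for D :: "(nat, nat, 'a, 'b) functr"
    using assms(1) by (simp add: is_functor_def)
  then obtain L \<pi> where L: "is_limit ?J C (undefined :: (nat, nat, 'a, 'b) functr) L \<pi>"
    using assms(2) unfolding has_finite_limits_def by (metis (no_types, lifting) cat.select_convs(1,2) finite.emptyI)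
  show thesis
  proof (rule that[of L])
    show "is_terminal C L" using L unfolding is_limit_def is_cone_def is_terminal_def by simp
  qed
qed

lemma has_pullback:
  assumes "category C" "has_finite_limits C" "f \<in> arrs C" "p \<in> arrs C" "tgt C f = tgt C p"
  obtains f' p' where "is_pullback C f p f' p'"
proof -
  interpret category C by (rule assms(1))
  \<comment> \<open>The shape of a cospan: the arrows 0, 1, 2 are the identities, 3 leads from 0 to
    2 and 4 from 1 to 2.\<close>
  let ?J = "\<lparr>objs = {0, 1, 2}, arrs = {0, 1, 2, 3, 4}, src = (\<lambda>a. if a = 3 then 0 else if a = 4 then 1 else a),
    tgt = (\<lambda>a. if a = 3 \<or> a = 4 then 2 else a), ident = id,
    cmp = (\<lambda>a b. if a = 3 \<or> a = 4 then a else b)\<rparr> :: (nat, nat) cat"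
  let ?D = "\<lparr>fobj = (\<lambda>j. if j = 0 then src C f else if j = 1 then src C p else tgt C f),
    farr = (\<lambda>a. if a = 0 then ident C (src C f) else if a = 1 then ident C (src C p)
      else if a = 2 then ident C (tgt C f) else if a = 3 then f else p)\<rparr>"
  have J: "category ?J" by unfold_locales (auto simp: hom_def)
  have "is_functor ?J C ?D"
    unfolding is_functor_def using assms J by (auto simp: hom_def)
  then obtain L \<pi> where L: "is_limit ?J C ?D L \<pi>"
    using assms(2) unfolding has_finite_limits_def by fastforce
  have cone: "is_cone ?J C ?D L \<pi>" using L by (simp add: is_limit_def)
  have \<pi>: "\<pi> 0 \<in> arrs C" "\<pi> 1 \<in> arrs C" "src C (\<pi> 0) = L" "src C (\<pi> 1) = L"
    "tgt C (\<pi> 0) = src C f" "tgt C (\<pi> 1) = src C p" "\<pi> 0 ;; f = \<pi> 2" "\<pi> 1 ;; p = \<pi> 2"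
    using cone unfolding is_cone_def by (auto simp: hom_def)
  show thesis
  \<comment> \<open>In \<open>is_pullback\<close> the first leg ends at the source of
    \<open>p\<close>, which the diagram places at the object 1.\<close>
  proof (rule that[of "\<pi> 1" "\<pi> 0"])
    show "is_pullback C f p (\<pi> 1) (\<pi> 0)"
      unfolding is_pullback_def
    proof (intro conjI allI impI)
      show "comm_square C f p (\<pi> 1) (\<pi> 0)" using \<pi> assms by (simp add: comm_square_def)
      fix u v assume sq: "comm_square C f p u v"
      let ?\<pi> = "\<lambda>j. if j = 0 then v else if j = 1 then u else u ;; p"
      have "is_cone ?J C ?D (src C u) ?\<pi>"
        using sq assms(3-5) unfolding is_cone_def comm_square_def by (auto simp: hom_def)
      then have "\<exists>!h. h \<in> hom C (src C u) L \<and> (\<forall>j \<in> objs ?J. h ;; \<pi> j = ?\<pi> j)"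
        using L unfolding is_limit_def by blast
      \<comment> \<open>The condition at the object 2 follows from the one at 1, since
        \<open>\<pi> 2\<close> is \<open>\<pi> 1\<close> followed by \<open>p\<close>.\<close>
      moreover have "(h \<in> hom C (src C u) L \<and> (\<forall>j \<in> objs ?J. h ;; \<pi> j = ?\<pi> j)) \<longleftrightarrow>
          (h \<in> hom C (src C u) (src C (\<pi> 1)) \<and> h ;; \<pi> 1 = u \<and> h ;; \<pi> 0 = v)" for h
      proof -
        have "h ;; \<pi> 2 = (h ;; \<pi> 1) ;; p" if "h \<in> hom C (src C u) L"
          using that \<pi> assms by (simp add: hom_def flip: \<pi>(8))
        then show ?thesis using \<pi>(4) by auto
      qed
      ultimately show "\<exists>!h. h \<in> hom C (src C u) (src C (\<pi> 1)) \<and> h ;; \<pi> 1 = u \<and> h ;; \<pi> 0 = v"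
        by simp
    qed
  qed
qed

subsection \<open>Dual model categories\<close>

definition op_model :: "('o, 'a) model_data \<Rightarrow> ('o, 'a) model_data" where
  "op_model M = \<lparr>ucat = op_cat (ucat M), cofs = fibs M, fibs = cofs M, weqs = weqs M\<rparr>"

lemma op_model_simps [simp]:
  "ucat (op_model M) = op_cat (ucat M)" "cofs (op_model M) = fibs M" "fibs (op_model M) = cofs M"
  "weqs (op_model M) = weqs M"
  by (simp_all add: op_model_def)

lemma lifts_against_op [simp]: "lifts_against (op_cat C) i p \<longleftrightarrow> lifts_against C p i"
  unfolding lifts_against_def by auto metis+

lemma is_pushout_op [simp]: "is_pushout (op_cat C) f i f' i' \<longleftrightarrow> is_pullback C f i f' i'"
  by (simp add: is_pushout_def)

lemma is_pullback_op [simp]: "is_pullback (op_cat C) f i f' i' \<longleftrightarrow> is_pushout C f i f' i'"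
  by (simp add: is_pushout_def)

lemma op_quillen:
  assumes "quillen_model_category M"
  shows "quillen_model_category (op_model M)"
proof -
  interpret quillen_model_category M by (rule assms)
  let ?C = "ucat (op_model M)"
  show ?thesis
  proof (rule quillen_model_category.intro)
    show "category (?C)" using category_op_cat[OF cat] by simp
    show "has_finite_limits (?C)"
      using finite_colimits by (simp add: has_finite_colimits_def)
    show "has_finite_colimits (?C)"
      using finite_limits by (simp add: has_finite_colimits_def)
    show "\<exists>i \<in> cofs (op_model M). \<exists>p \<in> fibs (op_model M) \<inter> weqs (op_model M).
        tgt (?C) i = src (?C) p \<and> f = cmp (?C) i p"
      if f: "f \<in> arrs (?C)" for f
    proof -
      obtain i p where "i \<in> cofs M \<inter> weqs M" "p \<in> fibs M" "tgt (ucat M) i = src (ucat M) p"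
        "f = cmp (ucat M) i p"
        using fact_accof_fib[of f] f unfolding op_model_simps op_cat_simps by blast
      then show ?thesis by (intro bexI[of _ p] bexI[of _ i]) auto
    qed
    show "\<exists>i \<in> cofs (op_model M) \<inter> weqs (op_model M). \<exists>p \<in> fibs (op_model M).
        tgt (?C) i = src (?C) p \<and> f = cmp (?C) i p"
      if f: "f \<in> arrs (?C)" for f
    proof -
      obtain i p where "i \<in> cofs M" "p \<in> fibs M \<inter> weqs M" "tgt (ucat M) i = src (ucat M) p"
        "f = cmp (ucat M) i p"
        using fact_cof_acfib[of f] f unfolding op_model_simps op_cat_simps by blast
      then show ?thesis by (intro bexI[of _ p] bexI[of _ i]) auto
    qed
    show "\<And>i p. i \<in> cofs (op_model M) \<Longrightarrow> p \<in> fibs (op_model M) \<Longrightarrow>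
        i \<in> weqs (op_model M) \<or> p \<in> weqs (op_model M) \<Longrightarrow> lifts_against (?C) i p"
      using lifting by auto
  qed (unfold op_model_simps op_cat_simps is_pullback_op is_pushout_op is_iso_op_cat
      op_closed_under_cmp op_two_of_three,
      (rule cofs_arrs fibs_arrs weqs_arrs fib_cmp fib_pullback fib_iso cof_cmp cof_pushout cof_iso
        acfib_pullback accof_pushout weq_iso weq_two_of_three; assumption)+)
qed

lemma cofibrant_op [simp]: "cofibrant (op_model M) X \<longleftrightarrow> fibrant M X"
  and fibrant_op [simp]: "fibrant (op_model M) X \<longleftrightarrow> cofibrant M X"
  by (simp_all add: cofibrant_def fibrant_def is_initial_def)

text \<open>\<open>sub M c d\<close> is \<open>ucat M\<close>, \<open>Cof M\<close>, \<open>Fib M\<close> or \<open>Bif M\<close>, depending on the flags \<open>c\<close>, \<open>d\<close>.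
  Passing to the opposite category exchanges them.\<close>

definition sub_objs :: "('o, 'a) model_data \<Rightarrow> bool \<Rightarrow> bool \<Rightarrow> 'o set" where
  "sub_objs M c d = {X. (c \<longrightarrow> cofibrant M X) \<and> (d \<longrightarrow> fibrant M X)}"

definition sub :: "('o, 'a) model_data \<Rightarrow> bool \<Rightarrow> bool \<Rightarrow> ('o, 'a) cat" where
  "sub M c d = full_subcat (ucat M) (sub_objs M c d)"

lemma sub_cases:
  "ucat M = sub M False False" "Cof M = sub M True False" "Fib M = sub M False True"
  "Bif M = sub M True True"
  by (simp_all add: sub_def sub_objs_def Cof_def Fib_def Bif_def full_subcat_def)

lemma full_subcat_simps [simp]:
  "objs (full_subcat C S) = objs C \<inter> S" "src (full_subcat C S) = src C" "tgt (full_subcat C S) = tgt C"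
  "ident (full_subcat C S) = ident C" "cmp (full_subcat C S) = cmp C"
  "f \<in> arrs (full_subcat C S) \<longleftrightarrow> f \<in> arrs C \<and> src C f \<in> S \<and> tgt C f \<in> S"
  by (simp_all add: full_subcat_def)

lemma sub_simps [simp]:
  "objs (sub M c d) = objs (ucat M) \<inter> sub_objs M c d" "src (sub M c d) = src (ucat M)"
  "tgt (sub M c d) = tgt (ucat M)" "ident (sub M c d) = ident (ucat M)" "cmp (sub M c d) = cmp (ucat M)"
  "f \<in> arrs (sub M c d) \<longleftrightarrow> f \<in> arrs (ucat M) \<and> src (ucat M) f \<in> sub_objs M c d \<and> tgt (ucat M) f \<in> sub_objs M c d"
  by (simp_all add: sub_def)

lemma category_full_subcat: "category C \<Longrightarrow> category (full_subcat C S)"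
proof -
  assume "category C"
  then interpret category C .
  show ?thesis by unfold_locales (auto simp: hom_def)
qed

lemma op_sub [simp]: "op_cat (sub M c d) = sub (op_model M) d c"
  unfolding sub_def sub_objs_def full_subcat_def op_cat_def op_model_def
  by (auto simp: cofibrant_op[unfolded op_model_def op_cat_def] fibrant_op[unfolded op_model_def op_cat_def])

lemma op_model_op_model [simp]: "op_model (op_model M) = M"
  by (simp add: op_model_def)

lemma sub_objs_op [simp]: "sub_objs (op_model M) c d = sub_objs M d c"
  by (auto simp: sub_objs_def)

abbreviation den_sub where "den_sub M c d \<equiv> model_den_cat M (sub M c d)"

lemma model_den_cat_simps [simp]:
  "base (model_den_cat M C) = C" "d \<in> Den (model_den_cat M C) \<longleftrightarrow> d \<in> arrs C \<and> d \<in> weqs M"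
  "d \<in> SDen (model_den_cat M C) \<longleftrightarrow> d \<in> arrs C \<and> d \<in> cofs M \<and> d \<in> weqs M"
  "d \<in> TDen (model_den_cat M C) \<longleftrightarrow> d \<in> arrs C \<and> d \<in> fibs M \<and> d \<in> weqs M"
  by (simp_all add: model_den_cat_def)

lemma op_den_sub [simp]: "op_den_cat (den_sub M c d) = den_sub (op_model M) d c"
  unfolding op_den_cat_def model_den_cat_def op_sub[symmetric] by auto

section \<open>Elementary properties of model categories\<close>

context quillen_model_category
begin

sublocale category "ucat M" by (rule cat)

notation seq (infixr ";;" 70)

abbreviation arr where "arr \<equiv> arrs (ucat M)"
abbreviation dom where "dom \<equiv> src (ucat M)"
abbreviation cod where "cod \<equiv> tgt (ucat M)"
abbreviation one where "one \<equiv> ident (ucat M)"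
abbreviation mor where "mor \<equiv> hom (ucat M)"

lemma class_arr [simp]: "f \<in> cofs M \<Longrightarrow> f \<in> arr" "f \<in> fibs M \<Longrightarrow> f \<in> arr" "f \<in> weqs M \<Longrightarrow> f \<in> arr"
  using cofs_arrs fibs_arrs weqs_arrs by blast+

lemma one_iso: "X \<in> objs (ucat M) \<Longrightarrow> is_iso (ucat M) (one X)"
  unfolding is_iso_def by (auto intro!: bexI[of _ "one X"] simp: hom_def)

lemma one_classes [simp]:
  "X \<in> objs (ucat M) \<Longrightarrow> one X \<in> cofs M" "X \<in> objs (ucat M) \<Longrightarrow> one X \<in> fibs M"
  "X \<in> objs (ucat M) \<Longrightarrow> one X \<in> weqs M"
  using one_iso cof_iso fib_iso weq_iso by blast+

lemma cofs_seq [simp]: "\<lbrakk>f \<in> cofs M; g \<in> cofs M; cod f = dom g\<rbrakk> \<Longrightarrow> f ;; g \<in> cofs M"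
  and fibs_seq [simp]: "\<lbrakk>f \<in> fibs M; g \<in> fibs M; cod f = dom g\<rbrakk> \<Longrightarrow> f ;; g \<in> fibs M"
  using cof_cmp fib_cmp unfolding closed_under_cmp_def by blast+

lemma weqs_seq [simp]: "\<lbrakk>f \<in> weqs M; g \<in> weqs M; cod f = dom g\<rbrakk> \<Longrightarrow> f ;; g \<in> weqs M"
  using weq_two_of_three class_arr(3) unfolding two_of_three_def by blast

lemma weqs_cancel_left: "\<lbrakk>f ;; g \<in> weqs M; f \<in> weqs M; g \<in> arr; cod f = dom g\<rbrakk> \<Longrightarrow> g \<in> weqs M"
  and weqs_cancel_right: "\<lbrakk>f ;; g \<in> weqs M; g \<in> weqs M; f \<in> arr; cod f = dom g\<rbrakk> \<Longrightarrow> f \<in> weqs M"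
  using weq_two_of_three class_arr(3) unfolding two_of_three_def by blast+

text \<open>In a factorisation into a cofibration and an acyclic fibration, two-out-of-three makes
  the cofibration acyclic as well.\<close>

lemma weq_factor:
  assumes "w \<in> weqs M"
  obtains i p where "i \<in> cofs M" "i \<in> weqs M" "p \<in> fibs M" "p \<in> weqs M" "cod i = dom p" "w = i ;; p"
proof -
  obtain i p where "i \<in> cofs M" "p \<in> fibs M \<inter> weqs M" "cod i = dom p" "w = i ;; p"
    using fact_cof_acfib[of w] assms by auto
  moreover from this have "i \<in> weqs M" using weqs_cancel_right[of i p] assms by simp
  ultimately show thesis using that[of i p] by simp
qed

lemma pullback_obtain:
  assumes "f \<in> arr" "p \<in> arr" "cod f = cod p"
  obtains f' p' where "is_pullback (ucat M) f p f' p'" "f' \<in> arr" "p' \<in> arr" "dom f' = dom p'"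
    "cod f' = dom p" "cod p' = dom f" "f' ;; p = p' ;; f"
    "\<And>u v. \<lbrakk>u \<in> arr; v \<in> arr; dom u = dom v; cod u = dom p; cod v = dom f; u ;; p = v ;; f\<rbrakk> \<Longrightarrow>
      \<exists>h \<in> arr. dom h = dom u \<and> cod h = dom f' \<and> h ;; f' = u \<and> h ;; p' = v"
    "\<And>h k. \<lbrakk>h \<in> arr; k \<in> arr; dom h = dom k; cod h = dom f'; cod k = dom f'; h ;; f' = k ;; f';
      h ;; p' = k ;; p'\<rbrakk> \<Longrightarrow> h = k"
proof -
  obtain f' p' where pb: "is_pullback (ucat M) f p f' p'"
    using has_pullback[OF cat finite_limits assms] by blast
  have sq: "comm_square (ucat M) f p f' p'"
    and un: "\<And>u v. comm_square (ucat M) f p u v \<Longrightarrow>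
        (\<exists>!h. h \<in> mor (dom u) (dom f') \<and> h ;; f' = u \<and> h ;; p' = v)"
    using pb unfolding is_pullback_def by simp_all
  have s: "f' \<in> arr" "p' \<in> arr" "dom f' = dom p'" "cod f' = dom p" "cod p' = dom f" "f' ;; p = p' ;; f"
    using sq by (auto simp: comm_square_def)
  have ex: "\<exists>h \<in> arr. dom h = dom u \<and> cod h = dom f' \<and> h ;; f' = u \<and> h ;; p' = v"
    if "u \<in> arr" "v \<in> arr" "dom u = dom v" "cod u = dom p" "cod v = dom f" "u ;; p = v ;; f" for u v
  proof -
    have "comm_square (ucat M) f p u v" using that assms by (simp add: comm_square_def)
    from ex1_implies_ex[OF un[OF this]] show ?thesis unfolding hom_def by blast
  qed
  have uq: "h = k"
    if "h \<in> arr" "k \<in> arr" "dom h = dom k" "cod h = dom f'" "cod k = dom f'" "h ;; f' = k ;; f'"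
      "h ;; p' = k ;; p'" for h k
  proof -
    have c: "comm_square (ucat M) f p (k ;; f') (k ;; p')"
      unfolding comm_square_def using that s assms by simp
    have "h \<in> mor (dom (k ;; f')) (dom f') \<and> h ;; f' = k ;; f' \<and> h ;; p' = k ;; p'"
      "k \<in> mor (dom (k ;; f')) (dom f') \<and> k ;; f' = k ;; f' \<and> k ;; p' = k ;; p'"
      using that s by (simp_all add: hom_def)
    then show ?thesis using un[OF c] by blast
  qed
  show thesis by (rule that[OF pb s ex uq])
qed

lemma terminal_obtain: obtains T where "is_terminal (ucat M) T"
  using has_terminal[OF cat finite_limits] .

end

section \<open>Pushouts, fibrant replacement and extension into fibrant objects\<close>

context quillen_model_category
begin

interpretation op: quillen_model_category "op_model M"
  by (rule op_quillen) unfold_locales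

lemma pushout_obtain:
  assumes "f \<in> arr" "i \<in> arr" "dom f = dom i"
  obtains f' i' where "is_pushout (ucat M) f i f' i'" "f' \<in> arr" "i' \<in> arr" "cod f' = cod i'"
    "dom f' = cod i" "dom i' = cod f" "i ;; f' = f ;; i'"
    "\<And>u v. \<lbrakk>u \<in> arr; v \<in> arr; cod u = cod v; dom u = cod i; dom v = cod f; i ;; u = f ;; v\<rbrakk> \<Longrightarrow>
      \<exists>h \<in> arr. cod h = cod u \<and> dom h = cod f' \<and> f' ;; h = u \<and> i' ;; h = v"
    "\<And>h k. \<lbrakk>h \<in> arr; k \<in> arr; cod h = cod k; dom h = cod f'; dom k = cod f'; f' ;; h = f' ;; k;
      i' ;; h = i' ;; k\<rbrakk> \<Longrightarrow> h = k"
proof (rule op.pullback_obtain[of f i, unfolded op_model_simps op_cat_simps is_pullback_op], goal_cases)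
  case (4 f' i')
  show thesis by (rule that[OF 4(2-10)])
qed (rule assms)+

lemma initial_obtain: obtains I where "is_initial (ucat M) I"
  using op.terminal_obtain[of thesis] that unfolding is_initial_def by simp

lemma to_terminal:
  assumes "is_terminal (ucat M) T" "X \<in> objs (ucat M)"
  obtains f where "f \<in> arr" "dom f = X" "cod f = T"
  using assms unfolding is_terminal_def hom_def by auto

lemma terminal_unique:
  assumes "is_terminal (ucat M) T" "f \<in> arr" "g \<in> arr" "dom f = dom g" "cod f = T" "cod g = T"
  shows "f = g"
proof -
  have "\<exists>!h. h \<in> mor (dom f) T"
    using assms(1) src_obj[OF assms(2)] by (simp add: is_terminal_def)
  moreover have "f \<in> mor (dom f) T" "g \<in> mor (dom f) T"
    using assms by (simp_all add: hom_def)
  ultimately show ?thesis by blast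
qed

lemma fibrant_fib:
  assumes "fibrant M (cod p)" "p \<in> fibs M"
  shows "fibrant M (dom p)"
proof -
  obtain T f where f: "is_terminal (ucat M) T" "f \<in> mor (cod p) T" "f \<in> fibs M"
    using assms(1) by (auto simp: fibrant_def)
  have "p ;; f \<in> mor (dom p) T \<and> p ;; f \<in> fibs M"
    using f assms(2) by (auto simp: hom_def)
  then show ?thesis using f(1) assms(2) unfolding fibrant_def by auto
qed

lemma fibrant_obj: "fibrant M X \<Longrightarrow> X \<in> objs (ucat M)"
  and cofibrant_obj: "cofibrant M X \<Longrightarrow> X \<in> objs (ucat M)"
  by (simp_all add: fibrant_def cofibrant_def)

lemma fibrant_replacement:
  assumes "X \<in> objs (ucat M)"
  obtains r where "r \<in> cofs M" "r \<in> weqs M" "dom r = X" "fibrant M (cod r)"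
proof -
  obtain T where T: "is_terminal (ucat M) T" by (rule terminal_obtain)
  obtain f where f: "f \<in> arr" "dom f = X" "cod f = T" using to_terminal[OF T assms] .
  obtain i p where ip: "i \<in> cofs M \<inter> weqs M" "p \<in> fibs M" "cod i = dom p" "f = i ;; p"
    using fact_accof_fib[OF f(1)] by blast
  have "p \<in> mor (cod i) T" using ip f by (auto simp: hom_def)
  then have "fibrant M (cod i)" using ip T unfolding fibrant_def by auto
  moreover have "dom i = X" using ip f by auto
  ultimately show thesis using that[of i] ip by simp
qed

text \<open>Lift against the fibration from \<open>Z\<close> to the terminal object; the square
  commutes because morphisms into that object are unique.\<close>

lemma fibrant_extend:
  assumes k: "k \<in> cofs M" "k \<in> weqs M" and Z: "fibrant M Z" and g: "g \<in> arr" "dom g = dom k" "cod g = Z"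
  obtains h where "h \<in> arr" "dom h = cod k" "cod h = Z" "k ;; h = g"
proof -
  obtain T p where T: "is_terminal (ucat M) T" "p \<in> mor Z T" "p \<in> fibs M"
    using Z by (auto simp: fibrant_def)
  obtain q where q: "q \<in> arr" "dom q = cod k" "cod q = T"
    using to_terminal[OF T(1), of "cod k"] k by auto
  have "g ;; p = k ;; q"
    by (rule terminal_unique[OF T(1)]) (use T(2) q g k in \<open>auto simp: hom_def\<close>)
  moreover have "lifts_against (ucat M) k p" using lifting k T by blast
  moreover have "g \<in> mor (dom k) (dom p)" "q \<in> mor (cod k) (cod p)"
    using g q T(2) by (auto simp: hom_def)
  ultimately obtain h where "h \<in> mor (cod k) (dom p)" "k ;; h = g"
    unfolding lifts_against_def by blast
  then show thesis using that[of h] T(2) by (auto simp: hom_def)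
qed

end

section \<open>Dual statements, and weak pushouts in the subcategories\<close>

context quillen_model_category
begin

interpretation op: quillen_model_category "op_model M"
  by (rule op_quillen) unfold_locales

lemma cofibrant_cof: "\<lbrakk>cofibrant M (dom i); i \<in> cofs M\<rbrakk> \<Longrightarrow> cofibrant M (cod i)"
  using op.fibrant_fib[of i] by simp

lemma cofibrant_lift:
  assumes "p \<in> fibs M" "p \<in> weqs M" "cofibrant M Z" "g \<in> arr" "cod g = cod p" "dom g = Z"
  obtains h where "h \<in> arr" "cod h = dom p" "dom h = Z" "h ;; p = g"
  using op.fibrant_extend[of p Z g thesis] assms by simp

lemma initial_unique:
  assumes "is_initial (ucat M) T" "f \<in> arr" "g \<in> arr" "cod f = cod g" "dom f = T" "dom g = T"
  shows "f = g"
  using op.terminal_unique[of T f g] assms by (simp add: is_initial_def)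

lemma from_initial:
  assumes "is_initial (ucat M) T" "X \<in> objs (ucat M)"
  obtains f where "f \<in> arr" "cod f = X" "dom f = T"
  using op.to_terminal[of T X thesis] assms by (simp add: is_initial_def)

text \<open>A pushout in \<open>ucat M\<close> stays cofibrant, being the target of a cofibration
  out of \<open>cod f\<close>, but it may fail to be fibrant. If fibrancy is demanded, it is
  followed by a fibrant replacement \<open>k\<close>. Morphisms into fibrant objects extend along
  \<open>k\<close>, though not uniquely, which is why the square is only a weak pushout.\<close>

lemma model_weak_pushout:
  assumes i: "i \<in> SDen (den_sub M c d)" and f: "f \<in> arrs (sub M c d)" "dom f = dom i"
  shows "\<exists>f' i'. is_weak_pushout (sub M c d) f i f' i' \<and> i' \<in> SDen (den_sub M c d)"
proof -
  let ?C = "op_cat (sub M c d)"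
  have i': "i \<in> cofs M" "i \<in> weqs M" "dom i \<in> sub_objs M c d" "cod i \<in> sub_objs M c d" using i by auto
  have f': "f \<in> arr" "cod f \<in> sub_objs M c d" using f by auto
  obtain f0 i0 where po: "is_pushout (ucat M) f i f0 i0" "f0 \<in> arr" "i0 \<in> arr" "cod f0 = cod i0"
    "dom f0 = cod i" "dom i0 = cod f" "i ;; f0 = f ;; i0"
    and univ: "\<And>u v. \<lbrakk>u \<in> arr; v \<in> arr; cod u = cod v; dom u = cod i; dom v = cod f; i ;; u = f ;; v\<rbrakk> \<Longrightarrow>
      \<exists>h \<in> arr. cod h = cod u \<and> dom h = cod f0 \<and> f0 ;; h = u \<and> i0 ;; h = v"
    by (rule pushout_obtain[of f i]) (use i' f f' in auto)
  have i0: "i0 \<in> cofs M" "i0 \<in> weqs M" using cof_pushout accof_pushout i' po(1) by blast+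
  obtain k where k: "k \<in> cofs M" "k \<in> weqs M" "dom k = cod i0" "d \<longrightarrow> fibrant M (cod k)"
    and ext: "\<And>g. \<lbrakk>g \<in> arr; dom g = cod i0; d \<longrightarrow> fibrant M (cod g)\<rbrakk> \<Longrightarrow>
      \<exists>h \<in> arr. dom h = cod k \<and> cod h = cod g \<and> k ;; h = g"
  proof (cases d)
    case True
    obtain r where r: "r \<in> cofs M" "r \<in> weqs M" "dom r = cod i0" "fibrant M (cod r)"
      using fibrant_replacement[of "cod i0"] po(3) by auto
    have "\<exists>h \<in> arr. dom h = cod r \<and> cod h = cod g \<and> r ;; h = g"
      if g: "g \<in> arr" "dom g = cod i0" "fibrant M (cod g)" for g
    proof -
      obtain h where "h \<in> arr" "dom h = cod r" "cod h = cod g" "r ;; h = g"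
        by (rule fibrant_extend[OF r(1,2) g(3,1)]) (use g(2) r(3) in simp_all)
      then show ?thesis by blast
    qed
    then show thesis using True r(4) by (intro that[OF r(1-3)]) simp_all
  next
    case False
    show thesis by (rule that[of "one (cod i0)"]) (use po(3) False in auto)
  qed
  have sq: "i ;; f0 ;; k = f ;; i0 ;; k" by (rule seq_eq_extend) (use po i' f f' k in auto)
  have "c \<longrightarrow> cofibrant M (cod k)"
    using cofibrant_cof[of "i0 ;; k"] f'(2) i0 k po by (auto simp: sub_objs_def)
  then have ck: "cod k \<in> sub_objs M c d" using k by (simp add: sub_objs_def)
  have "is_weak_pushout (sub M c d) f i (f0 ;; k) (i0 ;; k)"
    unfolding is_weak_pushout_def is_weak_pullback_def
  proof (intro conjI allI impI)
    show "comm_square (?C) f i (f0 ;; k) (i0 ;; k)"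
      using i' f f' po k sq ck unfolding comm_square_def op_cat_simps by simp
    fix u v assume "comm_square (?C) f i u v"
    then have uv: "u \<in> arr" "v \<in> arr" "cod u = cod v" "dom u = cod i" "dom v = cod f" "i ;; u = f ;; v"
      "cod u \<in> sub_objs M c d"
      unfolding comm_square_def op_cat_simps by auto
    obtain g where g: "g \<in> arr" "cod g = cod u" "dom g = cod f0" "f0 ;; g = u" "i0 ;; g = v"
      using univ[OF uv(1-6)] by blast
    obtain h where h: "h \<in> arr" "dom h = cod k" "cod h = cod g" "k ;; h = g"
      using ext[of g] g po uv(7) by (auto simp: sub_objs_def)
    have "h \<in> hom (?C) (src (?C) u) (src (?C) (f0 ;; k))"
      unfolding hom_def op_cat_simps using h g uv po k ck by simp
    moreover have "(f0 ;; k) ;; h = u" "(i0 ;; k) ;; h = v" using h g po k by simp_all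
    ultimately show "\<exists>h. h \<in> hom (?C) (src (?C) u) (src (?C) (f0 ;; k)) \<and>
        cmp (?C) h (f0 ;; k) = u \<and> cmp (?C) h (i0 ;; k) = v"
      unfolding op_cat_simps sub_simps by blast
  qed
  moreover have "i0 ;; k \<in> SDen (den_sub M c d)" using i0 k po f' ck by simp
  ultimately show ?thesis by blast
qed

end

section \<open>The uni-fractionable structure, and coproducts of cofibrant objects\<close>

context quillen_model_category
begin

interpretation op: quillen_model_category "op_model M"
  by (rule op_quillen) unfold_locales

lemma model_uni_fractionable: "uni_fractionable_category (den_sub M c d)"
proof (rule uni_fractionable_category.intro)
  let ?B = "base (den_sub M c d)"
  let ?D = "den_sub M c d"
  show "category (?B)" using category_full_subcat[OF cat] by (simp add: sub_def)
  show "semi_saturated (?B) (Den (?D))"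
    unfolding semi_saturated_def multiplicative_def closed_under_cmp_def two_of_three_def
    by (auto intro: weqs_cancel_left weqs_cancel_right)
  show "multiplicative (?B) (SDen (?D))"
    "multiplicative (?B) (TDen (?D))"
    unfolding multiplicative_def closed_under_cmp_def by auto
  show "SDen (?D) \<subseteq> Den (?D)" "TDen (?D) \<subseteq> Den (?D)"
    by auto
  show "\<And>i f. i \<in> SDen (?D) \<Longrightarrow> f \<in> arrs (?B) \<Longrightarrow>
      src (?B) f = src (?B) i \<Longrightarrow>
      \<exists>f' i'. is_weak_pushout (?B) f i f' i' \<and> i' \<in> SDen (?D)"
    using model_weak_pushout by simp
  show "\<exists>f' p'. is_weak_pullback (?B) f p f' p' \<and> p' \<in> TDen (?D)"
    if "p \<in> TDen (?D)" "f \<in> arrs (?B)"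
      "tgt (?B) f = tgt (?B) p" for p f
  proof -
    have T: "SDen (den_sub (op_model M) d c) = TDen (?D)"
      using op_den_cat_simps(3)[of "?D"] by (simp only: op_den_sub)
    have "is_weak_pushout (sub (op_model M) d c) = is_weak_pullback (sub M c d)"
      by (simp add: is_weak_pushout_def fun_eq_iff)
    then show ?thesis
      using op.model_weak_pushout[of p d c f] that
      unfolding T by simp
  qed
  show "\<exists>i \<in> SDen (?D). \<exists>p \<in> TDen (?D).
      tgt (?B) i = src (?B) p \<and> w = cmp (?B) i p"
    if w: "w \<in> Den (?D)" for w
  proof -
    have w': "w \<in> weqs M" "dom w \<in> sub_objs M c d" "cod w \<in> sub_objs M c d" using w by auto
    obtain i p where ip: "i \<in> cofs M" "i \<in> weqs M" "p \<in> fibs M" "p \<in> weqs M" "cod i = dom p" "w = i ;; p"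
      using weq_factor[OF w'(1)] .
    have ep: "dom i = dom w" "cod p = cod w" using ip by auto
    \<comment> \<open>The middle object inherits cofibrancy from the source along \<open>i\<close>
      and fibrancy from the target along \<open>p\<close>.\<close>
    have "cod i \<in> sub_objs M c d"
      using cofibrant_cof[of i] fibrant_fib[of p] ip(1,3,5) ep w' by (auto simp: sub_objs_def)
    moreover have "dom i \<in> sub_objs M c d" "cod p \<in> sub_objs M c d" using ep w' by simp_all
    ultimately have "i \<in> SDen (?D)" "p \<in> TDen (?D)" using ip(1-5) by simp_all
    then show ?thesis using ip(5,6) unfolding model_den_cat_simps(1) sub_simps by blast
  qed
qed

text \<open>A coproduct is a pushout over an initial object. One of its legs is a pushout of the
  cofibration into the other summand, hence a cofibration with cofibrant source, so the coproduct is
  cofibrant.\<close>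

lemma Cof_has_finite_coproducts: "has_finite_coproducts (Cof M)"
  unfolding has_finite_coproducts_def has_finite_products_def
proof (intro conjI ballI)
  let ?C = "op_cat (Cof M)"
  obtain I where I: "is_initial (ucat M) I" by (rule initial_obtain)
  have Io: "I \<in> objs (ucat M)" using I by (simp add: is_initial_def is_terminal_def)
  have Ic: "cofibrant M I"
    unfolding cofibrant_def using I Io by (auto simp: hom_def intro!: exI[of _ I] exI[of _ "one I"])
  show "\<exists>T. is_terminal (?C) T"
  proof (intro exI[of _ I])
    show "is_terminal (?C) I"
      unfolding is_initial_def[symmetric] is_initial_iff
    proof (intro conjI ballI)
      show "I \<in> objs (Cof M)" using Io Ic by (simp add: Cof_def)
      fix X assume X: "X \<in> objs (Cof M)"
      then have "\<exists>!f. f \<in> mor I X" using I by (simp add: is_initial_iff Cof_def)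
      moreover have "hom (Cof M) I X = mor I X"
        using Ic X by (auto simp: Cof_def hom_def)
      ultimately show "\<exists>!f. f \<in> hom (Cof M) I X" by simp
    qed
  qed
  fix X1 X2 assume X: "X1 \<in> objs (?C)" "X2 \<in> objs (?C)"
  then have X': "cofibrant M X1" "cofibrant M X2" "X1 \<in> objs (ucat M)" by (simp_all add: Cof_def)
  \<comment> \<open>The initial object that witnesses the cofibrancy of \<open>X2\<close> is used
    for the pushout, so that \<open>u2\<close> is known to be a cofibration.\<close>
  obtain J u2 where J: "is_initial (ucat M) J" "u2 \<in> mor J X2" "u2 \<in> cofs M"
    using X'(2) by (auto simp: cofibrant_def)
  have u2: "u2 \<in> arr" "dom u2 = J" "cod u2 = X2" using J by (auto simp: hom_def)
  obtain u1 where u1: "u1 \<in> arr" "cod u1 = X1" "dom u1 = J" using from_initial[OF J(1) X'(3)] .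
  obtain e2 e1 where po: "is_pushout (ucat M) u1 u2 e2 e1" "e2 \<in> arr" "e1 \<in> arr" "cod e2 = cod e1"
    "dom e2 = cod u2" "dom e1 = cod u1" "u2 ;; e2 = u1 ;; e1"
    and univ: "\<And>u v. \<lbrakk>u \<in> arr; v \<in> arr; cod u = cod v; dom u = cod u2; dom v = cod u1; u2 ;; u = u1 ;; v\<rbrakk> \<Longrightarrow>
      \<exists>h \<in> arr. cod h = cod u \<and> dom h = cod e2 \<and> e2 ;; h = u \<and> e1 ;; h = v"
    and uniq: "\<And>h k. \<lbrakk>h \<in> arr; k \<in> arr; cod h = cod k; dom h = cod e2; dom k = cod e2; e2 ;; h = e2 ;; k;
      e1 ;; h = e1 ;; k\<rbrakk> \<Longrightarrow> h = k"
    by (rule pushout_obtain[of u1 u2]) (use u1 u2 in auto)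
  have "e1 \<in> cofs M" using cof_pushout[OF J(3) po(1)] .
  then have Q: "cofibrant M (cod e1)" using cofibrant_cof[of e1] po u1 X' by simp
  have "is_product (?C) X1 X2 (cod e1) e1 e2"
    unfolding is_product_def
  proof (intro conjI allI ballI)
    show "e1 \<in> hom (?C) (cod e1) X1" "e2 \<in> hom (?C) (cod e1) X2"
      using po u1 u2 Q X' by (simp_all add: Cof_def hom_def)
    fix Z f1 f2 assume "f1 \<in> hom (?C) Z X1" "f2 \<in> hom (?C) Z X2"
    then have f: "f1 \<in> arr" "dom f1 = X1" "cod f1 = Z" "f2 \<in> arr" "dom f2 = X2" "cod f2 = Z" "cofibrant M Z"
      by (auto simp: Cof_def hom_def)
    have "u2 ;; f2 = u1 ;; f1" by (rule initial_unique[OF J(1)]) (use u1 u2 f in auto)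
    then obtain h where h: "h \<in> arr" "cod h = Z" "dom h = cod e2" "e2 ;; h = f2" "e1 ;; h = f1"
      using univ[of f2 f1] f u1 u2 by auto
    show "\<exists>!h. h \<in> hom (?C) Z (cod e1) \<and> cmp (?C) h e1 = f1 \<and> cmp (?C) h e2 = f2"
    proof (rule ex1I[of _ h])
      show "h \<in> hom (?C) Z (cod e1) \<and> cmp (?C) h e1 = f1 \<and> cmp (?C) h e2 = f2"
        using h po f Q by (simp add: Cof_def hom_def)
      fix k assume k: "k \<in> hom (?C) Z (cod e1) \<and> cmp (?C) k e1 = f1 \<and> cmp (?C) k e2 = f2"
      show "k = h" by (rule uniq) (use k h po in \<open>auto simp: Cof_def hom_def\<close>)
    qed
  qed
  then show "\<exists>P p1 p2. is_product (?C) X1 X2 P p1 p2" by blast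
qed

end

subsection \<open>The two-out-of-six property of closed model categories\<close>

context closed_quillen_model_category
begin

lemma lift_obtain:
  assumes "lifts_against (ucat M) i p" "f \<in> arr" "g \<in> arr" "dom f = dom i" "cod f = dom p"
    "dom g = cod i" "cod g = cod p" "f ;; p = i ;; g"
  obtains h where "h \<in> arr" "dom h = cod i" "cod h = dom p" "i ;; h = f" "h ;; p = g"
  using assms unfolding lifts_against_def hom_def by blast

text \<open>Here \<open>h\<close> is the retract of \<open>g h\<close> along \<open>f\<close>, \<open>g\<close>. Pushing out an acyclic cofibration reduces
  to the case of a fibration \<open>h\<close>, which is then a retract of an acyclic fibration.\<close>

lemma weqs_retract:
  assumes f: "f \<in> arr" "g \<in> arr" "h \<in> arr" "cod f = dom g" "cod g = dom h" "dom f = dom h"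
    and fg: "f ;; g = one (dom h)" and gh: "g ;; h \<in> weqs M"
  shows "h \<in> weqs M"
proof -
  obtain j p where jp: "j \<in> cofs M" "j \<in> weqs M" "p \<in> fibs M" "cod j = dom p" "h = j ;; p"
    using fact_accof_fib[OF f(3)] by auto
  have dj: "dom j = dom h" using jp by auto
  obtain f' j' where po: "is_pushout (ucat M) f j f' j'" "f' \<in> arr" "j' \<in> arr" "cod f' = cod j'"
    "dom f' = cod j" "dom j' = cod f" "j ;; f' = f ;; j'"
    and univ: "\<And>u v. \<lbrakk>u \<in> arr; v \<in> arr; cod u = cod v; dom u = cod j; dom v = cod f; j ;; u = f ;; v\<rbrakk> \<Longrightarrow>
      \<exists>h \<in> arr. cod h = cod u \<and> dom h = cod f' \<and> f' ;; h = u \<and> j' ;; h = v"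
    by (rule pushout_obtain[of f j]) (use f jp(1-4) dj in auto)
  have j': "j' \<in> weqs M" using accof_pushout[OF _ po(1)] jp by simp
  \<comment> \<open>The pushout carries the retraction along \<open>j\<close>: from
    \<open>f g = 1\<close> it induces \<open>g'\<close> with \<open>f' g' = 1\<close>.\<close>
  have "(f ;; g) ;; j = j" using fg dj jp(1-4) by simp
  then have "j ;; one (cod j) = f ;; g ;; j" using f jp(1-4) dj by simp
  then obtain g' where g': "g' \<in> arr" "cod g' = cod j" "dom g' = cod f'" "f' ;; g' = one (cod j)" "j' ;; g' = g ;; j"
    using univ[of "one (cod j)" "g ;; j"] f jp(1-4) dj by auto
  have "j' ;; g' ;; p = g ;; j ;; p"
    by (rule seq_eq_extend) (use g' po f jp(1-4) dj in auto)
  then have "j' ;; g' ;; p \<in> weqs M" using gh by (simp only: jp(5))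
  then have w: "g' ;; p \<in> weqs M"
    by (rule weqs_cancel_left) (use j' g' po jp(1-4) in auto)
  \<comment> \<open>Lifting \<open>u\<close> against the fibration \<open>p\<close> gives
    \<open>r\<close> with \<open>u r = g'\<close> and \<open>r p = v\<close>. As
    \<open>f' u r = 1\<close> and \<open>f' u v = p\<close>, the morphism \<open>p\<close> is a
    retract of the acyclic fibration \<open>v\<close>.\<close>
  obtain u v where uv: "u \<in> cofs M" "u \<in> weqs M" "v \<in> fibs M" "v \<in> weqs M" "cod u = dom v" "g' ;; p = u ;; v"
    using weq_factor[OF w] .
  have duv: "dom u = dom g'" "cod v = cod p"
    using src_seq[of u v] src_seq[of g' p] tgt_seq[of u v] tgt_seq[of g' p] uv g' jp(1-4) by auto
  have lp: "lifts_against (ucat M) u p" using lifting uv jp by blast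
  obtain r where r: "r \<in> arr" "dom r = cod u" "cod r = dom p" "u ;; r = g'" "r ;; p = v"
    by (rule lift_obtain[OF lp, of g' v]) (use g' uv jp duv in auto)
  have "lifts_against (ucat M) i p" if i: "i \<in> cofs M" for i
    unfolding lifts_against_def
  proof (intro ballI impI)
    fix x y assume xy: "x \<in> mor (dom i) (dom p)" "y \<in> mor (cod i) (cod p)" "x ;; p = i ;; y"
    have xy': "x \<in> arr" "dom x = dom i" "cod x = dom p" "y \<in> arr" "dom y = cod i" "cod y = cod p"
      using xy by (auto simp: hom_def)
    have "lifts_against (ucat M) i v" using lifting uv i by blast
    moreover have "x ;; f' ;; u \<in> arr" "dom (x ;; f' ;; u) = dom i" "cod (x ;; f' ;; u) = dom v"
      using xy' po g' duv uv jp by simp_all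
    moreover have "(x ;; f' ;; u) ;; v = i ;; y"
    proof -
      have "(x ;; f' ;; u) ;; v = x ;; f' ;; (u ;; v)" using xy' po g' duv uv jp by simp
      also have "\<dots> = x ;; f' ;; g' ;; p" by (simp only: uv(6))
      also have "f' ;; g' ;; p = p"
        using seq_assoc[of f' g' p] g' po jp(1-4) by simp
      finally have "(x ;; f' ;; u) ;; v = x ;; p" .
      also note xy(3)
      finally show ?thesis .
    qed
    ultimately obtain l where l: "l \<in> arr" "dom l = cod i" "cod l = dom v" "i ;; l = x ;; f' ;; u" "l ;; v = y"
      using lift_obtain[of i v "x ;; f' ;; u" y] xy' duv by metis
    have "i ;; (l ;; r) = (i ;; l) ;; r"
      by (rule seq_assoc[symmetric]) (use l(1-3) r(1-3) i uv(5) in simp_all)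
    also have "\<dots> = x ;; f' ;; (u ;; r)" unfolding l(4) using xy' po g' duv uv jp r by simp
    also have "\<dots> = x" using r(4) g'(4) xy' jp by simp
    finally have "i ;; (l ;; r) = x" .
    moreover have "(l ;; r) ;; p = y" using l r uv jp by simp
    moreover have "l ;; r \<in> mor (cod i) (dom p)" using l r uv by (simp add: hom_def)
    ultimately show "\<exists>h \<in> mor (cod i) (dom p). i ;; h = x \<and> h ;; p = y" by blast
  qed
  moreover have "lifts_against (ucat M) (one (dom p)) q" if "q \<in> fibs M" for q
    using lifting[of "one (dom p)" q] that jp by simp
  moreover have "p = one (dom p) ;; p" using jp by simp
  \<comment> \<open>Closedness enters here: \<open>1 p\<close> is a composite of the form that
    characterises weak equivalences.\<close>
  ultimately have "p \<in> weqs M"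
    unfolding weqs_determined mem_Collect_eq
    using jp(3) by (intro exI[of _ "one (dom p)"] exI[of _ p]) auto
  then show ?thesis using jp by simp
qed

text \<open>A pullback makes \<open>f g\<close> an acyclic cofibration, and a pushout makes it an identity.\<close>

lemma weqs_two_of_six:
  assumes f: "f \<in> arr" "g \<in> arr" "h \<in> arr" "cod f = dom g" "cod g = dom h"
    and fg: "f ;; g \<in> weqs M" and gh: "g ;; h \<in> weqs M"
  shows "g \<in> weqs M"
proof -
  obtain i p where ip: "i \<in> cofs M" "i \<in> weqs M" "p \<in> fibs M" "p \<in> weqs M" "cod i = dom p" "f ;; g = i ;; p"
    using weq_factor[OF fg] .
  have e: "dom i = dom f" "cod p = cod g"
    using src_seq[of i p] src_seq[of f g] tgt_seq[of i p] tgt_seq[of f g] ip f by auto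
  obtain g1 p1 where pb: "is_pullback (ucat M) g p g1 p1" "g1 \<in> arr" "p1 \<in> arr" "dom g1 = dom p1"
    "cod g1 = dom p" "cod p1 = dom g" "g1 ;; p = p1 ;; g"
    and univ1: "\<And>u v. \<lbrakk>u \<in> arr; v \<in> arr; dom u = dom v; cod u = dom p; cod v = dom g; u ;; p = v ;; g\<rbrakk> \<Longrightarrow>
      \<exists>h \<in> arr. dom h = dom u \<and> cod h = dom g1 \<and> h ;; g1 = u \<and> h ;; p1 = v"
    by (rule pullback_obtain[of g p]) (use f ip e in auto)
  have p1: "p1 \<in> weqs M" using acfib_pullback[OF _ pb(1)] ip by simp
  \<comment> \<open>The composite \<open>f1 g1 = i\<close> takes the place of \<open>f g\<close>; it
    is an acyclic cofibration.\<close>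
  obtain f1 where f1: "f1 \<in> arr" "dom f1 = dom i" "cod f1 = dom g1" "f1 ;; g1 = i" "f1 ;; p1 = f"
    using univ1[of i f] ip e f by auto
  have "g1 ;; p ;; h = p1 ;; g ;; h"
    by (rule seq_eq_extend) (use pb f ip e in auto)
  then have 1: "g1 ;; (p ;; h) \<in> weqs M" using gh p1 pb f by simp
  obtain f2 i2 where po: "is_pushout (ucat M) f1 i f2 i2" "f2 \<in> arr" "i2 \<in> arr" "cod f2 = cod i2"
    "dom f2 = cod i" "dom i2 = cod f1" "i ;; f2 = f1 ;; i2"
    and univ2: "\<And>u v. \<lbrakk>u \<in> arr; v \<in> arr; cod u = cod v; dom u = cod i; dom v = cod f1; i ;; u = f1 ;; v\<rbrakk> \<Longrightarrow>
      \<exists>h \<in> arr. cod h = cod u \<and> dom h = cod f2 \<and> f2 ;; h = u \<and> i2 ;; h = v"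
    by (rule pushout_obtain[of f1 i]) (use f1 ip in auto)
  have i2: "i2 \<in> weqs M" using accof_pushout[OF _ po(1)] ip by simp
  \<comment> \<open>Now \<open>f2 g2 = 1\<close>, and \<open>i2 g2 p h = g1 p h = p1 g h\<close> is
    a weak equivalence; hence so is \<open>g2 p h\<close>, and \<open>weqs_retract\<close> applies
    to \<open>p h\<close>.\<close>
  obtain g2 where g2: "g2 \<in> arr" "cod g2 = cod i" "dom g2 = cod f2" "f2 ;; g2 = one (cod i)" "i2 ;; g2 = g1"
    using univ2[of "one (cod i)" g1] f1 ip pb by auto
  have "i2 ;; g2 ;; (p ;; h) = g1 ;; (p ;; h)"
    using seq_assoc[of i2 g2 "p ;; h"] g2 po ip e f by simp
  then have "i2 ;; g2 ;; (p ;; h) \<in> weqs M" using 1 by simp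
  then have 2: "g2 ;; (p ;; h) \<in> weqs M"
    by (rule weqs_cancel_left) (use i2 g2 po ip e f in auto)
  have "p ;; h \<in> weqs M"
    by (rule weqs_retract[of f2 g2]) (use g2 po ip e f 2 in auto)
  then have "h \<in> weqs M" by (rule weqs_cancel_left) (use ip e f in auto)
  then show ?thesis by (rule weqs_cancel_right[OF gh]) (use f in auto)
qed

lemma model_saturated: "saturated (den_sub M c d)"
proof -
  interpret U: uni_fractionable_category "den_sub M c d" by (rule model_uni_fractionable)
  show ?thesis
    by (rule U.saturated_if_two_of_six) (auto intro: weqs_two_of_six)
qed

end

section \<open>Coproducts\<close>

context uni_fractionable_category
begin

lemma fcomp_loc_cls:
  assumes e: "e \<in> arr" and s: "(one (cod e), f, a) \<in> T3"
  shows "fcomp (farr (loc U) e) (cls (one (cod e), f, a)) = cls (one (dom e), e ;; f, a)"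
proof -
  have X: "cod e \<in> objs (base U)" using e by simp
  have t: "f \<in> arr" "a \<in> Den U" "cod e = dom f" "cod f = cod a"
    using s X by (auto simp: T3_iff)
  have 1: "(one (dom e), e ;; f, one (cod f)) \<in> T3" using e t by (simp add: T3_iff)
  have "fcomp (farr (loc U) e) (cls (one (cod e), f, a)) = inv_act a (act f (inv_act (one (cod e)) (farr (loc U) e)))"
    by (rule fcomp_cls[OF loc_in[OF e] s]) (use X in simp)
  also have "inv_act (one (cod e)) (farr (loc U) e) = cls (one (dom e), e, one (cod e))"
    using inv_act_one[OF loc_in[OF e]] by (simp add: loc_cls)
  also have "act f \<dots> = cls (one (dom e), e ;; f, one (cod f))"
    by (rule act_from_arr) (use e t in simp_all)
  also have "inv_act a \<dots> = cls (one (dom e), e ;; f, a)"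
    using inv_act_cls[OF 1 t(2)] t(2,4) by simp
  finally show ?thesis .
qed

text \<open>Both retractions of \<open>s\<close> act as the inverse of \<open>s\<close>. For the two
  ends of a path object this makes homotopic morphisms equal as fractions.\<close>

lemma act_common_section:
  assumes s: "s \<in> Den U" and p: "p0 \<in> arr" "p1 \<in> arr" "cod s = dom p0" "cod s = dom p1"
    "s ;; p0 = one (dom s)" "s ;; p1 = one (dom s)" and A: "A \<in> frac_hom X (cod s)"
  shows "act p0 A = act p1 A"
proof -
  have 1: "inv_act s A \<in> frac_hom X (dom s)" by (rule inv_act_in[OF A]) (use s in auto)
  have "act p A = inv_act s A" if "p \<in> arr" "cod s = dom p" "s ;; p = one (dom s)" for p
  proof -
    have "act p A = act p (act s (inv_act s A))" using act_inv_act[OF A s] by simp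
    also have "\<dots> = act (s ;; p) (inv_act s A)" using act_seq[OF 1, of s p] s that by simp
    also have "\<dots> = inv_act s A" using that(3) act_one[OF 1] by simp
    finally show ?thesis .
  qed
  then show ?thesis using p by simp
qed

end

lemma is_coproduct_sym: "is_coproduct C X1 X2 Q e1 e2 \<Longrightarrow> is_coproduct C X2 X1 Q e2 e1"
  unfolding is_coproduct_def is_product_def by metis

lemma is_coproductD:
  assumes "is_coproduct C X1 X2 Q e1 e2"
  shows "e1 \<in> hom C X1 Q" "e2 \<in> hom C X2 Q"
    "\<lbrakk>f1 \<in> hom C X1 Z; f2 \<in> hom C X2 Z\<rbrakk> \<Longrightarrow> \<exists>!h. h \<in> hom C Q Z \<and> cmp C e1 h = f1 \<and> cmp C e2 h = f2"
  using assms unfolding is_coproduct_def is_product_def by auto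

text \<open>A path object \<open>P\<close> of a bifibrant object \<open>R\<close>, with the product of \<open>R\<close> with itself
  eliminated: \<open>path_lift\<close> says that \<open>(p\<^sub>0, p\<^sub>1)\<close> has the right lifting property against acyclic
  cofibrations.\<close>

locale path_object = quillen_model_category M for M :: "('o, 'a) model_data" +
  fixes R P :: 'o and s p0 p1 :: 'a
  assumes R: "cofibrant M R" "fibrant M R" and P: "cofibrant M P" "fibrant M P"
    and s: "s \<in> weqs M" "dom s = R" "cod s = P"
    and p0: "p0 \<in> arr" "dom p0 = P" "cod p0 = R" "s ;; p0 = one R"
    and p1: "p1 \<in> arr" "dom p1 = P" "cod p1 = R" "s ;; p1 = one R"
    and path_lift: "\<lbrakk>i \<in> cofs M; i \<in> weqs M; H \<in> arr; dom H = dom i; cod H = P;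
      f \<in> mor (cod i) R; g \<in> mor (cod i) R; H ;; p0 = i ;; f; H ;; p1 = i ;; g\<rbrakk> \<Longrightarrow>
      \<exists>K \<in> arr. dom K = cod i \<and> cod K = P \<and> i ;; K = H \<and> K ;; p0 = f \<and> K ;; p1 = g"

text \<open>Factor the diagonal \<open>\<delta>\<close> of the product of \<open>R\<close> with
  itself, formed as a pullback over the terminal object, as an acyclic cofibration \<open>s\<close>
  and a fibration \<open>\<pi>\<close>. The projection \<open>q0\<close> is a fibration onto
  \<open>R\<close>, so the product and with it \<open>P\<close> are fibrant; \<open>s\<close> makes
  \<open>P\<close> cofibrant.\<close>

lemma (in quillen_model_category) path_object_exists:
  assumes R: "cofibrant M R" "fibrant M R"
  obtains P s p0 p1 where "path_object M R P s p0 p1"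
proof -
  obtain T t where T: "is_terminal (ucat M) T" "t \<in> mor R T" "t \<in> fibs M"
    using R(2) by (auto simp: fibrant_def)
  have t: "t \<in> arr" "dom t = R" "cod t = T" using T(2) by (auto simp: hom_def)
  have Ro: "R \<in> objs (ucat M)" using R by (simp add: fibrant_obj)
  obtain q1 q0 where pb: "is_pullback (ucat M) t t q1 q0" "q1 \<in> arr" "q0 \<in> arr" "dom q1 = dom q0"
    "cod q1 = dom t" "cod q0 = dom t" "q1 ;; t = q0 ;; t"
    and univ: "\<And>u v. \<lbrakk>u \<in> arr; v \<in> arr; dom u = dom v; cod u = dom t; cod v = dom t; u ;; t = v ;; t\<rbrakk> \<Longrightarrow>
      \<exists>h \<in> arr. dom h = dom u \<and> cod h = dom q1 \<and> h ;; q1 = u \<and> h ;; q0 = v"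
    and uniq: "\<And>h k. \<lbrakk>h \<in> arr; k \<in> arr; dom h = dom k; cod h = dom q1; cod k = dom q1; h ;; q1 = k ;; q1;
      h ;; q0 = k ;; q0\<rbrakk> \<Longrightarrow> h = k"
    by (rule pullback_obtain[of t t]) (use t in auto)
  have "q0 \<in> fibs M" by (rule fib_pullback[OF T(3) pb(1)])
  then have Qf: "fibrant M (dom q0)" using fibrant_fib[of q0] pb t R by simp
  obtain \<delta> where \<delta>: "\<delta> \<in> arr" "dom \<delta> = R" "cod \<delta> = dom q1" "\<delta> ;; q1 = one R" "\<delta> ;; q0 = one R"
    using univ[of "one R" "one R"] Ro t by auto
  obtain s \<pi> where sp: "s \<in> cofs M \<inter> weqs M" "\<pi> \<in> fibs M" "cod s = dom \<pi>" "\<delta> = s ;; \<pi>"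
    using fact_accof_fib[OF \<delta>(1)] by blast
  have d: "dom s = R" "cod \<pi> = dom q1"
    using src_seq[of s \<pi>] tgt_seq[of s \<pi>] sp \<delta> by auto
  have "path_object M R (cod s) s (\<pi> ;; q0) (\<pi> ;; q1)"
  proof (unfold_locales)
    show "cofibrant M (cod s)" using cofibrant_cof[of s] R sp d by simp
    show "fibrant M (cod s)" using fibrant_fib[of \<pi>] Qf sp d pb by simp
    show "s ;; \<pi> ;; q0 = one R" "s ;; \<pi> ;; q1 = one R"
      using \<delta>(4,5) seq_assoc[of s \<pi> q0] seq_assoc[of s \<pi> q1] sp d pb by auto
    fix i H f g
    assume i: "i \<in> cofs M" "i \<in> weqs M" and H: "H \<in> arr" "dom H = dom i" "cod H = cod s"
      and fg: "f \<in> mor (cod i) R" "g \<in> mor (cod i) R"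
      and eq: "H ;; \<pi> ;; q0 = i ;; f" "H ;; \<pi> ;; q1 = i ;; g"
    have f: "f \<in> arr" "dom f = cod i" "cod f = R" "g \<in> arr" "dom g = cod i" "cod g = R"
      using fg by (auto simp: hom_def)
    have "g ;; t = f ;; t" by (rule terminal_unique[OF T(1)]) (use f t in auto)
    then obtain y where y: "y \<in> arr" "dom y = cod i" "cod y = dom q1" "y ;; q1 = g" "y ;; q0 = f"
      using univ[of g f] f t by auto
    have "H ;; \<pi> = i ;; y"
      by (rule uniq) (use H i y sp(2,3) d pb eq in auto)
    moreover have "lifts_against (ucat M) i \<pi>" using lifting i sp by blast
    moreover have "H \<in> mor (dom i) (dom \<pi>)" "y \<in> mor (cod i) (cod \<pi>)"
      using H sp(3) y d by (simp_all add: hom_def)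
    ultimately obtain K where "K \<in> mor (cod i) (dom \<pi>)" "i ;; K = H" "K ;; \<pi> = y"
      unfolding lifts_against_def by blast
    then show "\<exists>K \<in> arr. dom K = cod i \<and> cod K = cod s \<and> i ;; K = H \<and> K ;; \<pi> ;; q0 = f \<and> K ;; \<pi> ;; q1 = g"
      using y sp(2,3) d pb seq_assoc[of K \<pi> q0] seq_assoc[of K \<pi> q1]
      by (intro bexI[of _ K]) (auto simp: hom_def)
  qed (use R sp d pb t in auto)
  then show thesis by (rule that)
qed

section \<open>Homotopy classes of morphisms into a bifibrant object\<close>

context path_object
begin

definition hstep where "hstep f g \<longleftrightarrow> (\<exists>H \<in> arr. cod H = P \<and> H ;; p0 = f \<and> H ;; p1 = g)"

text \<open>The generated equivalence relation. With one fixed path object, this spares reversing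
  and composing homotopies; in return, statements are proved along chains of steps.\<close>

definition htp where "htp = (\<lambda>f g. hstep f g \<or> hstep g f)\<^sup>*\<^sup>*"

lemma htp_refl [simp]: "htp f f"
  by (simp add: htp_def)

lemma htp_trans: "\<lbrakk>htp f g; htp g h\<rbrakk> \<Longrightarrow> htp f h"
  by (simp add: htp_def)

lemma htp_sym: "htp f g \<Longrightarrow> htp g f"
proof -
  have "symp (\<lambda>f g. hstep f g \<or> hstep g f)" by (auto simp: symp_def)
  then show "htp f g \<Longrightarrow> htp g f" unfolding htp_def using symp_rtranclp sympD by metis
qed

lemma htp_induct [consumes 1, case_names refl step]:
  assumes "htp f g" "Q f" "\<And>u v. \<lbrakk>htp f u; hstep u v \<or> hstep v u; Q u\<rbrakk> \<Longrightarrow> Q v"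
  shows "Q g"
  using assms unfolding htp_def by (rule rtranclp_induct)

lemma hstep_hom:
  assumes "hstep f g"
  shows "f \<in> mor (dom f) R" "g \<in> mor (dom f) R"
  using assms p0 p1 unfolding hstep_def by (auto simp: hom_def)

lemma htp_hom:
  assumes "htp f g" "f \<in> mor X R"
  shows "g \<in> mor X R"
  using assms
proof (induction rule: htp_induct)
  case (step u v)
  then have u: "u \<in> mor X R" "dom u = X" by (auto simp: hom_def)
  show ?case using step(2)
  proof
    assume "hstep u v"
    from hstep_hom(2)[OF this] show ?thesis using u by simp
  next
    assume h: "hstep v u"
    from hstep_hom[OF h] show ?thesis using u by (auto simp: hom_def)
  qed
qed

lemma hstep_pre:
  assumes "hstep f g" "x \<in> arr" "cod x = dom f"
  shows "hstep (x ;; f) (x ;; g)"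
proof -
  obtain H where H: "H \<in> arr" "cod H = P" "H ;; p0 = f" "H ;; p1 = g"
    using assms(1) by (auto simp: hstep_def)
  have "dom f = dom H" using H p0 by auto
  then have "(x ;; H) ;; p0 = x ;; f" "(x ;; H) ;; p1 = x ;; g"
    using H assms p0 p1 by auto
  then show ?thesis unfolding hstep_def using H assms \<open>dom f = dom H\<close> by (intro bexI[of _ "x ;; H"]) auto
qed

lemma htp_pre:
  assumes "htp f g" "f \<in> mor X R" "x \<in> arr" "cod x = X"
  shows "htp (x ;; f) (x ;; g)"
  using assms(1)
proof (induction rule: htp_induct)
  case (step u v)
  have "dom u = X" "dom v = X"
    using htp_hom[OF step(1) assms(2)] hstep_hom[of u v] hstep_hom[of v u] step(2) by (auto simp: hom_def)
  then have "hstep (x ;; u) (x ;; v) \<or> hstep (x ;; v) (x ;; u)"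
    using step(2) hstep_pre assms(3,4) by auto
  then show ?case using step(3) unfolding htp_def by (rule rtranclp.rtrancl_into_rtrancl[rotated])
qed simp

lemma hstep_const:
  assumes "f \<in> mor X R"
  shows "\<exists>H \<in> arr. dom H = X \<and> cod H = P \<and> H ;; p0 = f \<and> H ;; p1 = f"
  using assms s p0 p1 by (intro bexI[of _ "f ;; s"]) (auto simp: hom_def)

text \<open>Precomposition with \<open>d\<close> is a bijection between the homotopy classes of
  morphisms into \<open>R\<close>.\<close>

definition htp_bij where
  "htp_bij d \<longleftrightarrow> (\<forall>v \<in> mor (dom d) R. \<exists>v' \<in> mor (cod d) R. htp (d ;; v') v) \<and>
     (\<forall>u \<in> mor (cod d) R. \<forall>v \<in> mor (cod d) R. htp (d ;; u) (d ;; v) \<longrightarrow> htp u v)"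

lemma htp_bijD:
  assumes "htp_bij d"
  shows "v \<in> mor (dom d) R \<Longrightarrow> \<exists>v' \<in> mor (cod d) R. htp (d ;; v') v"
    "\<lbrakk>u \<in> mor (cod d) R; v \<in> mor (cod d) R; htp (d ;; u) (d ;; v)\<rbrakk> \<Longrightarrow> htp u v"
  using assms by (auto simp: htp_bij_def)

lemma acyclic_cof_extend:
  assumes "i \<in> cofs M" "i \<in> weqs M" "v \<in> mor (dom i) R"
  shows "\<exists>v' \<in> mor (cod i) R. i ;; v' = v"
proof -
  obtain h where "h \<in> arr" "dom h = cod i" "cod h = R" "i ;; h = v"
    by (rule fibrant_extend[OF assms(1,2) R(2), of v]) (use assms(3) in \<open>auto simp: hom_def\<close>)
  then show ?thesis by (auto simp: hom_def)
qed

text \<open>By \<open>path_lift\<close> the homotopy extends along \<open>i\<close> with prescribed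
  ends.\<close>

lemma acyclic_cof_hstep:
  assumes i: "i \<in> cofs M" "i \<in> weqs M" and h: "hstep (i ;; f) (i ;; g)"
    and f: "f \<in> mor (cod i) R" and g: "g \<in> mor (cod i) R"
  shows "hstep f g"
proof -
  obtain H where H: "H \<in> arr" "cod H = P" "H ;; p0 = i ;; f" "H ;; p1 = i ;; g"
    using h by (auto simp: hstep_def)
  have "dom H = dom i"
    using src_seq[of H p0] src_seq[of i f] H p0 i f by (auto simp: hom_def)
  then show ?thesis using path_lift[OF i H(1) _ H(2) f g H(3,4)] by (auto simp: hstep_def)
qed

text \<open>The intermediate morphisms of a chain are defined on the source of \<open>i\<close>
  only, but they extend along \<open>i\<close> because \<open>R\<close> is fibrant. The induction
  therefore speaks of every extension of the current morphism; two extensions of the same morphism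
  are linked by extending a constant homotopy.\<close>

lemma htp_bij_acyclic_cof:
  assumes i: "i \<in> cofs M" "i \<in> weqs M"
  shows "htp_bij i"
  unfolding htp_bij_def
proof (intro conjI ballI impI)
  show "\<exists>v' \<in> mor (cod i) R. htp (i ;; v') v" if "v \<in> mor (dom i) R" for v
    using acyclic_cof_extend[OF i that] htp_refl by metis
  fix f g assume f: "f \<in> mor (cod i) R" and g: "g \<in> mor (cod i) R"
    and h: "htp (i ;; f) (i ;; g)"
  have fi: "i ;; f \<in> mor (dom i) R" using f i by (simp add: hom_def)
  have "\<forall>g \<in> mor (cod i) R. i ;; g = w \<longrightarrow> htp f g" if "htp (i ;; f) w" for w
    using that
  proof (induction rule: htp_induct)
    case refl
    show ?case
    proof (intro ballI impI)
      fix g assume g: "g \<in> mor (cod i) R" "i ;; g = i ;; f"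
      have "hstep (i ;; f) (i ;; g)" using hstep_const[OF fi] g by (auto simp: hstep_def)
      from acyclic_cof_hstep[OF i this f g(1)] show "htp f g" unfolding htp_def by blast
    qed
  next
    case (step u v)
    show ?case
    proof (intro ballI impI)
      fix g assume g: "g \<in> mor (cod i) R" "i ;; g = v"
      obtain g0 where g0: "g0 \<in> mor (cod i) R" "i ;; g0 = u"
        using acyclic_cof_extend[OF i htp_hom[OF step(1) fi]] by blast
      have 1: "htp f g0" using step(3) g0 by blast
      have "hstep g0 g \<or> hstep g g0"
        using step(2) acyclic_cof_hstep[OF i] g g0 by blast
      then show "htp f g" using 1 unfolding htp_def by (rule rtranclp.rtrancl_into_rtrancl[rotated])
    qed
  qed
  then show "htp f g" using h g by blast
qed

lemma htp_bij_seq: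
  assumes d: "htp_bij d" "htp_bij e" "d \<in> arr" "e \<in> arr" "cod d = dom e"
  shows "htp_bij (d ;; e)"
  unfolding htp_bij_def
proof (intro conjI ballI impI)
  fix v assume "v \<in> mor (dom (d ;; e)) R"
  then have "v \<in> mor (dom d) R" using d by simp
  then obtain v1 where v1: "v1 \<in> mor (dom e) R" "htp (d ;; v1) v"
    using htp_bijD(1)[OF d(1)] d(5) by auto
  obtain v2 where v2: "v2 \<in> mor (cod e) R" "htp (e ;; v2) v1"
    using htp_bijD(1)[OF d(2) v1(1)] by blast
  have "e ;; v2 \<in> mor (dom e) R" using v2 d by (simp add: hom_def)
  from htp_pre[OF v2(2) this d(3,5)] have "htp (d ;; e ;; v2) v" using v1(2) htp_trans by blast
  then show "\<exists>v' \<in> mor (cod (d ;; e)) R. htp ((d ;; e) ;; v') v"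
    using v2 d by (intro bexI[of _ v2]) (auto simp: hom_def)
next
  fix u v assume uv: "u \<in> mor (cod (d ;; e)) R" "v \<in> mor (cod (d ;; e)) R"
    "htp ((d ;; e) ;; u) ((d ;; e) ;; v)"
  have uv': "u \<in> mor (cod e) R" "v \<in> mor (cod e) R" using uv d by simp_all
  have eu: "e ;; u \<in> mor (cod d) R" "e ;; v \<in> mor (cod d) R"
    using uv' d by (simp_all add: hom_def)
  have "htp (d ;; (e ;; u)) (d ;; (e ;; v))" using uv(3) uv' d by (simp add: hom_def)
  from htp_bijD(2)[OF d(1) eu this] show "htp u v" by (rule htp_bijD(2)[OF d(2) uv'])
qed

text \<open>As its target is cofibrant, \<open>p\<close> has a section, and precomposition with the
  section cancels \<open>p\<close>.\<close>

lemma acyclic_fib_inj: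
  assumes p: "p \<in> fibs M" "p \<in> weqs M" "cofibrant M (cod p)"
    and uv: "u \<in> mor (cod p) R" "v \<in> mor (cod p) R" "htp (p ;; u) (p ;; v)"
  shows "htp u v"
proof -
  obtain r where r: "r \<in> arr" "cod r = dom p" "dom r = cod p" "r ;; p = one (cod p)"
    by (rule cofibrant_lift[OF p, of "one (cod p)"]) (use p in auto)
  have pu: "p ;; u \<in> mor (dom p) R" using uv(1) p by (simp add: hom_def)
  have "htp (r ;; p ;; u) (r ;; p ;; v)" by (rule htp_pre[OF uv(3) pu r(1,2)])
  moreover have "r ;; p ;; w = w" if "w \<in> mor (cod p) R" for w
    using seq_assoc[of r p w] r p that by (auto simp: hom_def)
  ultimately show ?thesis using uv by simp
qed

text \<open>A section \<open>r\<close> of \<open>p\<close> is a composite of an acyclic cofibration and an acyclic fibration, so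
  precomposition with \<open>r\<close> is injective, hence bijective, hence so is precomposition with \<open>p\<close>.\<close>

lemma htp_bij_acyclic_fib:
  assumes p: "p \<in> fibs M" "p \<in> weqs M" "cofibrant M (cod p)" "cofibrant M (dom p)"
  shows "htp_bij p"
  unfolding htp_bij_def
proof (intro conjI ballI impI)
  show "\<And>u v. u \<in> mor (cod p) R \<Longrightarrow> v \<in> mor (cod p) R \<Longrightarrow>
    htp (p ;; u) (p ;; v) \<Longrightarrow> htp u v"
    by (rule acyclic_fib_inj[OF p(1-3)])
  fix v assume v: "v \<in> mor (dom p) R"
  then have v': "v \<in> arr" "dom v = dom p" "cod v = R" by (auto simp: hom_def)
  obtain r where r: "r \<in> arr" "cod r = dom p" "dom r = cod p" "r ;; p = one (cod p)"
    by (rule cofibrant_lift[OF p(1-3), of "one (cod p)"]) (use p in auto)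
  have "r ;; p \<in> weqs M" using r p by simp
  then have "r \<in> weqs M" by (rule weqs_cancel_right) (use r p in auto)
  then obtain j q where jq: "j \<in> cofs M" "j \<in> weqs M" "q \<in> fibs M" "q \<in> weqs M" "cod j = dom q" "r = j ;; q"
    by (rule weq_factor)
  have dq: "cod q = dom p" using jq r by auto
  have rv: "r ;; v \<in> mor (cod p) R" using r v' by (simp add: hom_def)
  \<comment> \<open>\<open>r v\<close> is the candidate preimage of \<open>v\<close>:
    \<open>p r v\<close> and \<open>v\<close> agree after \<open>r = j q\<close>, and both
    \<open>j\<close> and \<open>q\<close> can be cancelled up to homotopy.\<close>
  have "r ;; p ;; r ;; v = r ;; v"
    using seq_assoc[of r p "r ;; v"] r p v' by simp
  then have "htp (r ;; (p ;; r ;; v)) (r ;; v)" by simp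
  moreover have a: "r ;; x = j ;; q ;; x" if "x \<in> arr" "dom x = dom p" for x
    unfolding jq(6) by (rule seq_assoc) (use jq(1-5) dq that in simp_all)
  have a1: "r ;; v = j ;; q ;; v" and a2: "r ;; (p ;; r ;; v) = j ;; q ;; (p ;; r ;; v)"
    by (rule a; use v' p(1) r(1-3) in simp)+
  ultimately have e: "htp (j ;; (q ;; (p ;; r ;; v))) (j ;; (q ;; v))"
    by (subst a2[symmetric], subst a1[symmetric])
  have prv: "p ;; r ;; v \<in> mor (cod q) R" and vq: "v \<in> mor (cod q) R"
    using p r v' dq by (simp_all add: hom_def)
  then have "q ;; (p ;; r ;; v) \<in> mor (cod j) R" "q ;; v \<in> mor (cod j) R"
    using jq(3,5) unfolding hom_def by simp_all
  from htp_bijD(2)[OF htp_bij_acyclic_cof[OF jq(1,2)] this e]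
  have "htp (q ;; (p ;; r ;; v)) (q ;; v)" .
  with acyclic_fib_inj[OF jq(3,4) _ prv vq] have "htp (p ;; r ;; v) v" using p dq by simp
  then show "\<exists>v' \<in> mor (cod p) R. htp (p ;; v') v" using rv by blast
qed

lemma htp_bij_weq:
  assumes d: "d \<in> weqs M" "cofibrant M (dom d)" "cofibrant M (cod d)"
  shows "htp_bij d"
proof -
  obtain i p where ip: "i \<in> cofs M" "i \<in> weqs M" "p \<in> fibs M" "p \<in> weqs M" "cod i = dom p" "d = i ;; p"
    using weq_factor[OF d(1)] .
  have e: "dom i = dom d" "cod p = cod d" using ip by auto
  have "cofibrant M (dom p)" using cofibrant_cof[of i] ip(1,5) e d by simp
  then have "htp_bij (i ;; p)"
    by (intro htp_bij_seq htp_bij_acyclic_cof htp_bij_acyclic_fib) (use ip(1-5) e d in auto)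
  then show ?thesis using ip(6) by simp
qed

text \<open>Along a chain of homotopies on \<open>X1\<close> each intermediate morphism is extended
  to \<open>Q\<close> with the fixed part on \<open>X2\<close>. A single homotopy on
  \<open>X1\<close> is glued with the constant one \<open>J\<close> on \<open>X2\<close>; this uses
  the coproduct property for morphisms into \<open>P\<close>, so \<open>P\<close> has to lie in the
  subcategory.\<close>

lemma htp_mediate:
  assumes Q: "is_coproduct (sub M c d) X1 X2 Q e1 e2"
    and PR: "P \<in> sub_objs M c d" "R \<in> sub_objs M c d"
    and h: "h \<in> hom (sub M c d) Q R" and k: "k \<in> hom (sub M c d) Q R"
    and eq: "htp (e1 ;; h) (e1 ;; k)" "e2 ;; h = e2 ;; k"
  shows "htp h k"
proof -
  let ?H = "hom (sub M c d)"
  have h': "h \<in> arr" "dom h = Q" "cod h = R" "Q \<in> sub_objs M c d" using h by (auto simp: hom_def)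
  have e: "e1 \<in> arr" "dom e1 = X1" "cod e1 = Q" "e2 \<in> arr" "dom e2 = X2" "cod e2 = Q"
    "X1 \<in> sub_objs M c d" "X2 \<in> sub_objs M c d"
    using is_coproductD(1,2)[OF Q] by (auto simp: hom_def)
  have med: "\<exists>!k. k \<in> ?H Q Z \<and> e1 ;; k = f1 \<and> e2 ;; k = f2"
    if "f1 \<in> mor X1 Z" "f2 \<in> mor X2 Z" "Z \<in> sub_objs M c d" for f1 f2 Z
    using is_coproductD(3)[OF Q, of f1 Z f2] that e by (simp add: hom_def)
  have eh: "e1 ;; h \<in> mor X1 R" "e2 ;; h \<in> mor X2 R"
    using e h' by (simp_all add: hom_def)
  have "\<forall>k \<in> ?H Q R. e1 ;; k = w \<longrightarrow> e2 ;; k = e2 ;; h \<longrightarrow> htp h k" if "htp (e1 ;; h) w" for w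
    using that
  proof (induction rule: htp_induct)
    case refl
    then show ?case using med[OF eh PR(2)] h htp_refl by blast
  next
    case (step u v)
    have u: "u \<in> mor X1 R" by (rule htp_hom[OF step(1) eh(1)])
    obtain k0 where k0: "k0 \<in> ?H Q R" "e1 ;; k0 = u" "e2 ;; k0 = e2 ;; h"
      using med[OF u eh(2) PR(2)] by blast
    have hk0: "htp h k0" using step(3) k0 by blast
    obtain J where J: "J \<in> arr" "dom J = X2" "cod J = P" "J ;; p0 = e2 ;; h" "J ;; p1 = e2 ;; h"
      using hstep_const[OF eh(2)] by blast
    show ?case
    proof (intro ballI impI)
      fix k assume k: "k \<in> ?H Q R" "e1 ;; k = v" "e2 ;; k = e2 ;; h"
      have glue: "hstep x y" if x: "x \<in> ?H Q R" "e2 ;; x = e2 ;; h"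
        and y: "y \<in> ?H Q R" "e2 ;; y = e2 ;; h" and xy: "hstep (e1 ;; x) (e1 ;; y)" for x y
      proof -
        obtain H where H: "H \<in> arr" "cod H = P" "H ;; p0 = e1 ;; x" "H ;; p1 = e1 ;; y"
          using xy by (auto simp: hstep_def)
        have x': "e1 ;; x \<in> mor X1 R" and y': "e1 ;; y \<in> mor X1 R"
          using x(1) y(1) e by (auto simp: hom_def)
        have "dom H = X1" using src_seq[of H p0] H p0 x' by (auto simp: hom_def)
        then obtain K where K: "K \<in> ?H Q P" "e1 ;; K = H" "e2 ;; K = J"
          using med[of H P J] H J PR by (auto simp: hom_def)
        have K': "K \<in> arr" "dom K = Q" "cod K = P" using K(1) by (auto simp: hom_def)
        have Kp: "K ;; p0 \<in> ?H Q R" "K ;; p1 \<in> ?H Q R"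
          using K' p0 p1 PR h' by (simp_all add: hom_def)
        have "e1 ;; K ;; p0 = e1 ;; x" "e2 ;; K ;; p0 = e2 ;; h" "e1 ;; K ;; p1 = e1 ;; y" "e2 ;; K ;; p1 = e2 ;; h"
          using seq_assoc[of e1 K p0] seq_assoc[of e2 K p0] seq_assoc[of e1 K p1] seq_assoc[of e2 K p1]
            K K' e p0 p1 H J by simp_all
        then have "K ;; p0 = x" "K ;; p1 = y"
          using med[OF x' eh(2) PR(2)] med[OF y' eh(2) PR(2)] x y Kp by blast+
        then show ?thesis using K' by (auto simp: hstep_def)
      qed
      have "hstep k0 k \<or> hstep k k0" using glue step(2) k0 k by metis
      then show "htp h k" using hk0 unfolding htp_def by (rule rtranclp.rtrancl_into_rtrancl[rotated])
    qed
  qed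
  then show ?thesis using eq k by simp
qed

text \<open>One component is changed at a time: \<open>m\<close> agrees with \<open>k\<close> on
  \<open>X1\<close> and with \<open>h\<close> on \<open>X2\<close>.\<close>

lemma htp_coproduct:
  assumes Q: "is_coproduct (sub M c d) X1 X2 Q e1 e2"
    and PR: "P \<in> sub_objs M c d" "R \<in> sub_objs M c d"
    and h: "h \<in> hom (sub M c d) Q R" and k: "k \<in> hom (sub M c d) Q R"
    and eq: "htp (e1 ;; h) (e1 ;; k)" "htp (e2 ;; h) (e2 ;; k)"
  shows "htp h k"
proof -
  have e: "e1 \<in> arr" "dom e1 = X1" "cod e1 = Q" "e2 \<in> arr" "dom e2 = X2" "cod e2 = Q"
    "X1 \<in> sub_objs M c d" "X2 \<in> sub_objs M c d"
    using is_coproductD(1,2)[OF Q] by (auto simp: hom_def)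
  have "e1 ;; k \<in> hom (sub M c d) X1 R" "e2 ;; h \<in> hom (sub M c d) X2 R"
    using h k e by (auto simp: hom_def)
  from is_coproductD(3)[OF Q this] obtain m where
    m: "m \<in> hom (sub M c d) Q R" "e1 ;; m = e1 ;; k" "e2 ;; m = e2 ;; h"
    unfolding sub_simps by blast
  have "htp h m" by (rule htp_mediate[OF Q PR h m(1)]) (use m eq in simp_all)
  moreover have "htp m k"
    by (rule htp_mediate[OF is_coproduct_sym[OF Q] PR m(1) k]) (use m eq in simp_all)
  ultimately show ?thesis by (rule htp_trans)
qed

text \<open>If \<open>r : Y \<rightarrow> R\<close> is a weak equivalence, then the 3-arrow \<open>(b, f, a)\<close> from \<open>X\<close> to \<open>Y\<close>
  corresponds to the homotopy classes of those \<open>u : X \<rightarrow> R\<close> that satisfy \<open>inv3\<close>.\<close>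

definition inv3 where
  "inv3 r t u \<longleftrightarrow> (case t of (b, f, a) \<Rightarrow> \<exists>v \<in> mor (cod f) R. htp (a ;; v) r \<and> htp (b ;; u) (f ;; v))"

text \<open>The arrow \<open>x\<close> of an extension is a weak equivalence between cofibrant
  objects, so \<open>htp_bij x\<close> holds. On the right it supplies the new \<open>v\<close>; on
  the left it allows \<open>x\<close> to be cancelled from the homotopy.\<close>

lemma inv3_eqv:
  assumes "(t, t') \<in> frac_equality (den_sub M True d)" "t = (b, f, a)" "t' = (b', f', a')"
    "u \<in> mor (cod b) R"
  shows "inv3 r t u \<longleftrightarrow> inv3 r t' u"
  using assms
proof (induction arbitrary: b f a b' f' a')
  case (extend_right b1 f1 a1 x)
  have t: "b1 \<in> weqs M" "f1 \<in> arr" "a1 \<in> weqs M" "dom b1 = dom f1" "cod f1 = cod a1"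
    "cofibrant M (cod f1)"
    using extend_right.hyps(1) by (auto simp: three_arrows_def sub_objs_def)
  have x: "x \<in> arr" "cod f1 = dom x" "a1 ;; x \<in> weqs M" "cofibrant M (cod x)"
    using extend_right.hyps(2-4) by (auto simp: sub_objs_def)
  have "x \<in> weqs M" by (rule weqs_cancel_left[OF x(3) t(3)]) (use x t in auto)
  then have xb: "htp_bij x" by (rule htp_bij_weq) (use x t in auto)
  have "inv3 r (b1, f1, a1) u \<longleftrightarrow> inv3 r (b1, f1 ;; x, a1 ;; x) u"
  proof
    assume "inv3 r (b1, f1, a1) u"
    then obtain v where v: "v \<in> mor (cod f1) R" "htp (a1 ;; v) r" "htp (b1 ;; u) (f1 ;; v)"
      by (auto simp: inv3_def)
    obtain v' where v': "v' \<in> mor (cod x) R" "htp (x ;; v') v"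
      using htp_bijD(1)[OF xb, of v] v x by auto
    have xv: "x ;; v' \<in> mor (dom x) R" using v' x by (simp add: hom_def)
    have "htp (a1 ;; x ;; v') (a1 ;; v)" "htp (f1 ;; x ;; v') (f1 ;; v)"
      by (rule htp_pre[OF v'(2) xv]; use t x in simp)+
    then have "htp (a1 ;; x ;; v') r" "htp (b1 ;; u) (f1 ;; x ;; v')"
      using v htp_trans htp_sym by blast+
    then show "inv3 r (b1, f1 ;; x, a1 ;; x) u"
      unfolding inv3_def using v' x t by (auto simp: hom_def intro!: bexI[of _ v'])
  next
    assume "inv3 r (b1, f1 ;; x, a1 ;; x) u"
    then obtain v where v: "v \<in> mor (cod x) R" "htp ((a1 ;; x) ;; v) r" "htp (b1 ;; u) ((f1 ;; x) ;; v)"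
      using x t by (auto simp: inv3_def)
    have "x ;; v \<in> mor (cod f1) R" using v(1) x by (simp add: hom_def)
    moreover have "htp (a1 ;; x ;; v) r" "htp (b1 ;; u) (f1 ;; x ;; v)"
      using v x t by (auto simp: hom_def)
    ultimately show "inv3 r (b1, f1, a1) u" unfolding inv3_def prod.case by blast
  qed
  then show ?case using extend_right.prems by simp
next
  case (extend_left b1 f1 a1 x)
  have t: "b1 \<in> weqs M" "f1 \<in> arr" "a1 \<in> weqs M" "dom b1 = dom f1" "cod f1 = cod a1"
    "cofibrant M (dom f1)"
    using extend_left.hyps(1) by (auto simp: three_arrows_def sub_objs_def)
  have x: "x \<in> arr" "cod x = dom f1" "x ;; b1 \<in> weqs M" "cofibrant M (dom x)"
    using extend_left.hyps(2-4) by (auto simp: sub_objs_def)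
  have "x \<in> weqs M" by (rule weqs_cancel_right[OF x(3) t(1)]) (use x t in auto)
  then have xb: "htp_bij x" by (rule htp_bij_weq) (use x t in auto)
  have u: "u \<in> mor (cod b1) R" using extend_left.prems by simp
  then have bu: "b1 ;; u \<in> mor (cod x) R" using t x by (simp add: hom_def)
  have "htp (b1 ;; u) (f1 ;; v) \<longleftrightarrow> htp ((x ;; b1) ;; u) ((x ;; f1) ;; v)" if v: "v \<in> mor (cod f1) R" for v
  proof -
    have fv: "f1 ;; v \<in> mor (cod x) R" using v t x by (simp add: hom_def)
    have "htp (b1 ;; u) (f1 ;; v) \<longleftrightarrow> htp (x ;; (b1 ;; u)) (x ;; (f1 ;; v))"
      using htp_pre[OF _ bu x(1) HOL.refl] htp_bijD(2)[OF xb bu fv] by blast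
    moreover have "x ;; (b1 ;; u) = (x ;; b1) ;; u" "x ;; (f1 ;; v) = (x ;; f1) ;; v"
      using seq_assoc[of x b1 u] seq_assoc[of x f1 v] u v x(1,2) t by (auto simp: hom_def)
    ultimately show ?thesis by simp
  qed
  then have "inv3 r (b1, f1, a1) u \<longleftrightarrow> inv3 r (x ;; b1, x ;; f1, a1) u"
    unfolding inv3_def using x(1,2) t(2) by simp
  then show ?case using extend_left.prems by simp
next
  case (sym s t)
  interpret U: uni_fractionable_category "den_sub M True d" by (rule model_uni_fractionable)
  have "U.src3 s = U.src3 t" using U.eqv_T3[OF sym.hyps] by blast
  then have "cod b' = cod b" using sym.prems by simp
  then have "inv3 r s u = inv3 r t u" using sym.IH[OF sym.prems(2,1)] sym.prems(3) by simp
  then show ?case by simp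
next
  case (trans s t s')
  interpret U: uni_fractionable_category "den_sub M True d" by (rule model_uni_fractionable)
  obtain x y z where t: "t = (x, y, z)" by (rule prod_cases3)
  have "U.src3 s = U.src3 t" using U.eqv_T3[OF trans.hyps(1)] by blast
  then have "cod x = cod b" using trans.prems t by simp
  then show ?case
    using trans.IH(1)[OF trans.prems(1) t trans.prems(3)] trans.IH(2)[OF t trans.prems(2)] trans.prems(3)
    by simp
qed simp

text \<open>\<open>h\<close> satisfies \<open>inv3\<close> for its own fraction, with the identity
  as \<open>v\<close>, hence also for the fraction of \<open>k\<close>. The resulting
  \<open>v\<close> has \<open>r v\<close> homotopic to \<open>r\<close>; cancelling \<open>r\<close>
  makes \<open>v\<close> homotopic to the identity, and then \<open>h\<close> is homotopic to
  \<open>k\<close>.\<close>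

lemma eqv_imp_htp:
  assumes r: "r \<in> weqs M" "cofibrant M (dom r)" "cod r = R" and X: "X \<in> objs (ucat M)"
    and hk: "h \<in> mor X R" "k \<in> mor X R"
    and eq: "((one X, h, r), (one X, k, r)) \<in> frac_equality (den_sub M True d)"
  shows "htp h k"
proof -
  have hk': "h \<in> arr" "dom h = X" "cod h = R" "k \<in> arr" "dom k = X" "cod k = R"
    using hk by (auto simp: hom_def)
  have Ro: "R \<in> objs (ucat M)" using R by (simp add: fibrant_obj)
  have "one R \<in> mor (cod h) R" "htp (r ;; one R) r" "htp (one X ;; h) (h ;; one R)"
    using hk' r Ro by (auto simp: hom_def)
  then have "inv3 r (one X, h, r) h" unfolding inv3_def prod.case by blast
  then have "inv3 r (one X, k, r) h" using inv3_eqv[OF eq HOL.refl HOL.refl] hk X by simp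
  then obtain v where v: "v \<in> mor R R" "htp (r ;; v) r" "htp h (k ;; v)"
    using hk' by (auto simp: inv3_def)
  have rb: "htp_bij r" by (rule htp_bij_weq) (use r R in auto)
  have "htp v (one R)"
    by (rule htp_bijD(2)[OF rb]) (use v r Ro in \<open>auto simp: hom_def\<close>)
  from htp_pre[OF this v(1) hk'(4,6)] have "htp (k ;; v) k" using hk' by simp
  then show ?thesis using v(3) htp_trans by blast
qed

text \<open>The ends of a homotopy \<open>H\<close> are the actions of \<open>p0\<close> and
  \<open>p1\<close> on \<open>loc H\<close>, which agree because both retract \<open>s\<close>;
  undoing \<open>r\<close> preserves the equality.\<close>

lemma htp_imp_eq:
  assumes r: "r \<in> weqs M" "cofibrant M (dom r)" "d \<longrightarrow> fibrant M (dom r)" "cod r = R"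
    and X: "X \<in> objs (ucat M)" "X \<in> sub_objs M True d"
    and hk: "h \<in> mor X R" and eq: "htp h k"
  shows "uni_fractionable_category.cls (den_sub M True d) (one X, h, r) =
    uni_fractionable_category.cls (den_sub M True d) (one X, k, r)"
proof -
  interpret U: uni_fractionable_category "den_sub M True d" by (rule model_uni_fractionable)
  let ?l = "farr (loc (den_sub M True d))"
  have PR: "P \<in> sub_objs M True d" "R \<in> sub_objs M True d" "dom r \<in> sub_objs M True d"
    using P R r by (simp_all add: sub_objs_def)
  have rD: "r \<in> Den (den_sub M True d)" using PR r by simp
  have st: "U.cls (one X, u, r) = U.cls (one X, v, r)" if uv: "hstep u v" and u: "dom u = X" for u v
  proof -
    obtain H where H: "H \<in> arr" "cod H = P" "H ;; p0 = u" "H ;; p1 = v"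
      using uv by (auto simp: hstep_def)
    have dH: "dom H = X" using src_seq[of H p0] H p0 u by simp
    have Hs: "H \<in> arrs (sub M True d)" using H dH X PR by simp
    have A: "?l H \<in> U.frac_hom X P"
      using U.loc_in[of H] Hs H dH by simp
    have ps: "p0 \<in> arrs (sub M True d)" "p1 \<in> arrs (sub M True d)" using p0 p1 PR by simp_all
    have a: "U.act p (?l H) = U.cls (one X, H ;; p, one R)"
      if "p \<in> arrs (sub M True d)" "dom p = P" "cod p = R" for p
      using U.act_from_arr[of H p "one X"] Hs that H dH X unfolding U.loc_cls by simp
    have "U.act p0 (?l H) = U.act p1 (?l H)"
      by (rule U.act_common_section[of s]) (use s p0 p1 PR A ps in simp_all)
    then have e: "U.cls (one X, u, one R) = U.cls (one X, v, one R)"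
      using a[OF ps(1)] a[OF ps(2)] p0 p1 H by simp
    have i: "U.inv_act r (U.cls (one X, w, one R)) = U.cls (one X, w, r)"
      if w: "w \<in> arr" "dom w = X" "cod w = R" for w
    proof -
      have "(one X, w, one R) \<in> U.T3" using w X PR U.T3_iff fibrant_obj[OF R(2)] by simp
      then show ?thesis using U.inv_act_cls[of "one X" w "one R" r] rD r fibrant_obj[OF R(2)] by simp
    qed
    have "u \<in> arr" "cod u = R" "v \<in> arr" "dom v = X" "cod v = R" using H dH p0 p1 by auto
    then show ?thesis using e i[of u] i[of v] u by simp
  qed
  show ?thesis using eq
  proof (induction rule: htp_induct)
    case (step u v)
    have "u \<in> mor X R" by (rule htp_hom[OF step(1) hk])
    then have "dom u = X" "dom v = X"
      using hstep_hom[of u v] hstep_hom[of v u] step(2) by (auto simp: hom_def)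
    then show ?case using st[of u v] st[of v u] step(2,3) by auto
  qed simp
qed

end

section \<open>Coproducts in the fraction category\<close>

context quillen_model_category
begin

text \<open>The left denominator splits off since \<open>X\<close> is cofibrant. With
  \<open>a = i p\<close>, the morphism \<open>f\<close> lifts through \<open>p\<close> by cofibrancy
  of \<open>X\<close>, and \<open>r\<close> extends along \<open>i\<close> by fibrancy of its
  target; this trades \<open>a\<close> for \<open>i\<close> and then \<open>i\<close> for the
  prescribed \<open>r\<close>.\<close>

lemma frac_right_rep:
  assumes r: "r \<in> cofs M" "r \<in> weqs M" "cofibrant M (dom r)" "d \<longrightarrow> fibrant M (dom r)" "fibrant M (cod r)"
    and A: "A \<in> uni_fractionable_category.frac_hom (den_sub M True d) X (dom r)"
  obtains f where "f \<in> hom (sub M True d) X (cod r)"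
    "A = uni_fractionable_category.cls (den_sub M True d) (one X, f, r)"
proof -
  interpret U: uni_fractionable_category "den_sub M True d" by (rule model_uni_fractionable)
  have Xs: "X \<in> objs (ucat M)" "X \<in> sub_objs M True d" using U.frac_hom_objs(1)[OF A] by simp_all
  then have Xc: "cofibrant M X" by (simp add: sub_objs_def)
  have Rs: "cod r \<in> sub_objs M True d" "dom r \<in> sub_objs M True d"
    using cofibrant_cof[of r] r by (simp_all add: sub_objs_def)
  have "\<exists>s \<in> U.arr. U.dom s = X \<and> U.cod s = U.dom p \<and> cmp (base (den_sub M True d)) s p = U.one X"
    if p: "p \<in> TDen (den_sub M True d)" "U.cod p = X" for p
  proof -
    have p': "p \<in> fibs M" "p \<in> weqs M" "cod p = X" "dom p \<in> sub_objs M True d" using p by auto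
    obtain s where "s \<in> arr" "cod s = dom p" "dom s = X" "s ;; p = one X"
      by (rule cofibrant_lift[OF p'(1,2) Xc, of "one X"]) (use p' Xs in auto)
    then show ?thesis using p' Xs by (intro bexI[of _ s]) auto
  qed
  then obtain f a where f: "(U.one X, f, a) \<in> U.T3" "U.dom f = X" "U.dom a = dom r" "A = U.cls (U.one X, f, a)"
    by (rule U.split_rep[OF A])
  have f': "f \<in> arr" "dom f = X" "cod f = cod a" "cod a \<in> sub_objs M True d" and
    a: "a \<in> Den (den_sub M True d)" "dom a = dom r"
    using f(1-3) by (auto simp: U.T3_iff)
  obtain i p where ip: "i \<in> SDen (den_sub M True d)" "p \<in> TDen (den_sub M True d)" "U.cod i = U.dom p"
    "a = cmp (base (den_sub M True d)) i p"
    using U.Den_factor[OF a(1)] .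
  have ip': "i \<in> cofs M" "i \<in> weqs M" "p \<in> fibs M" "p \<in> weqs M" "cod i = dom p" "a = i ;; p"
    "cod i \<in> sub_objs M True d" using ip by auto
  have da: "dom i = dom r" "cod p = cod f"
    using src_seq[of i p] tgt_seq[of i p] ip'(1-5) ip'(6)[symmetric] a(2) f'(3) by simp_all
  obtain g where g: "g \<in> arr" "cod g = dom p" "dom g = X" "g ;; p = f"
    by (rule cofibrant_lift[OF ip'(3,4) Xc f'(1)]) (use da f' in auto)
  obtain t where t: "t \<in> arr" "dom t = cod i" "cod t = cod r" "i ;; t = r"
    by (rule fibrant_extend[OF ip'(1,2) r(5), of r]) (use da r in auto)
  have T: "(one X, g, i) \<in> U.T3" unfolding U.T3_iff using Xs g ip'(1-5,7) ip(1) by simp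
  have "((one X, g, i), (one X, f, a)) \<in> frac_equality (den_sub M True d)"
    by (rule U.eqv_right_eq[OF T, of p]) (use g ip(2) ip' a(1) in simp_all)
  from U.cls_eqI[OF this] have 1: "A = U.cls (one X, g, i)" using f(4) by simp
  have "((one X, g, i), (one X, g ;; t, r)) \<in> frac_equality (den_sub M True d)"
    by (rule U.eqv_right_eq[OF T, of t]) (use g t ip' Rs r in simp_all)
  from U.cls_eqI[OF this] have "A = U.cls (one X, g ;; t, r)" using 1 by simp
  moreover have "g ;; t \<in> hom (sub M True d) X (cod r)"
    using g t ip'(5) Xs Rs by (simp add: hom_def)
  ultimately show thesis by (rule that[rotated])
qed

text \<open>With a fibrant replacement \<open>r\<close> of \<open>Y\<close> fixed, all fractions
  into \<open>Y\<close> have the form \<open>(1, f, r)\<close>, and composing with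
  \<open>loc x\<close> amounts to precomposing \<open>f\<close> with \<open>x\<close>. A mediating
  fraction comes from the coproduct in the subcategory; its uniqueness is the gluing of homotopies
  in \<open>htp_coproduct\<close>.\<close>

lemma loc_coproduct:
  assumes Q: "is_coproduct (sub M True d) X1 X2 Q e1 e2"
  shows "is_coproduct (Frac (den_sub M True d)) X1 X2 Q
    (farr (loc (den_sub M True d)) e1) (farr (loc (den_sub M True d)) e2)"
proof -
  interpret U: uni_fractionable_category "den_sub M True d" by (rule model_uni_fractionable)
  let ?cmp = "cmp (Frac (den_sub M True d))"
  let ?l = "farr (loc (den_sub M True d))"
  let ?C = "sub M True d"
  have e: "e1 \<in> arr" "dom e1 = X1" "cod e1 = Q" "e2 \<in> arr" "dom e2 = X2" "cod e2 = Q"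
    "X1 \<in> sub_objs M True d" "X2 \<in> sub_objs M True d" "Q \<in> sub_objs M True d"
    using is_coproductD(1,2)[OF Q] by (auto simp: hom_def)
  have es: "e1 \<in> arrs (?C)" "e2 \<in> arrs (?C)" using e by simp_all
  have l: "?l e1 \<in> U.frac_hom X1 Q"
    "?l e2 \<in> U.frac_hom X2 Q"
    using U.loc_in[of e1] U.loc_in[of e2] es e by simp_all
  show ?thesis
    unfolding is_coproduct_def is_product_def hom_op_cat U.Frac_hom op_cat_simps
  proof (intro conjI allI ballI)
    fix Y A1 A2 assume A: "A1 \<in> U.frac_hom X1 Y" "A2 \<in> U.frac_hom X2 Y"
    have Y: "Y \<in> objs (ucat M)" "Y \<in> sub_objs M True d" using U.frac_hom_objs(2)[OF A(1)] by simp_all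
    then have Yc: "cofibrant M Y" "d \<longrightarrow> fibrant M Y" by (simp_all add: sub_objs_def)
    obtain r where r: "r \<in> cofs M" "r \<in> weqs M" "dom r = Y" "fibrant M (cod r)"
      using fibrant_replacement[OF Y(1)] .
    have Rc: "cofibrant M (cod r)" using cofibrant_cof[of r] r Yc by simp
    obtain P s p0 p1 where "path_object M (cod r) P s p0 p1"
      using path_object_exists[OF Rc r(4)] .
    then interpret path_object M "cod r" P s p0 p1 .
    have PR: "P \<in> sub_objs M True d" "cod r \<in> sub_objs M True d"
      using P R by (simp_all add: sub_objs_def)
    have rs: "r \<in> Den (den_sub M True d)" using r PR Y by simp
    have rep: "\<exists>f \<in> hom (?C) X (cod r). B = U.cls (one X, f, r)"
      if "B \<in> U.frac_hom X Y" for B X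
      using frac_right_rep[of r d B X] r Yc that by metis
    have T: "(one X, f, r) \<in> U.T3" if "f \<in> hom (?C) X (cod r)" for f X
      unfolding U.T3_iff using that rs r by (auto simp: hom_def)
    have comp: "?cmp (?l x) (U.cls (one Q, h, r)) = U.cls (one X, x ;; h, r)"
      if h: "h \<in> hom (?C) Q (cod r)" and x: "x \<in> arrs (?C)" "dom x = X" "cod x = Q" for h x X
    proof -
      have 1: "U.cls (one Q, h, r) \<in> U.frac_hom Q Y"
        by (rule U.cls_in_frac_hom[OF T[OF h]]) (use r h in \<open>auto simp: hom_def\<close>)
      have 2: "?l x \<in> U.frac_hom X Q" using U.loc_in[of x] x by simp
      show ?thesis unfolding U.Frac_cmp[OF 2 1]
        using U.fcomp_loc_cls[of x h r] x T[OF h] by simp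
    qed
    obtain f1 f2 where f: "f1 \<in> hom (?C) X1 (cod r)" "A1 = U.cls (one X1, f1, r)"
      "f2 \<in> hom (?C) X2 (cod r)" "A2 = U.cls (one X2, f2, r)"
      using rep[OF A(1)] rep[OF A(2)] by blast
    obtain h where h: "h \<in> hom (?C) Q (cod r)" "e1 ;; h = f1" "e2 ;; h = f2"
      using is_coproductD(3)[OF Q f(1,3)] unfolding sub_simps by blast
    show "\<exists>!H. H \<in> U.frac_hom Q Y \<and> ?cmp (?l e1) H = A1 \<and>
        ?cmp (?l e2) H = A2"
    proof (rule ex1I[of _ "U.cls (one Q, h, r)"])
      show "U.cls (one Q, h, r) \<in> U.frac_hom Q Y \<and>
        ?cmp (?l e1) (U.cls (one Q, h, r)) = A1 \<and>
        ?cmp (?l e2) (U.cls (one Q, h, r)) = A2"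
      proof (intro conjI)
        show "U.cls (one Q, h, r) \<in> U.frac_hom Q Y"
          by (rule U.cls_in_frac_hom[OF T[OF h(1)]]) (use r h in \<open>auto simp: hom_def\<close>)
      qed (use comp[OF h(1) es(1) e(2,3)] comp[OF h(1) es(2) e(5,6)] h f in simp_all)
      fix K assume K: "K \<in> U.frac_hom Q Y \<and>
        ?cmp (?l e1) K = A1 \<and>
        ?cmp (?l e2) K = A2"
      then obtain k where k: "k \<in> hom (?C) Q (cod r)" "K = U.cls (one Q, k, r)"
        using rep by blast
      have h': "h \<in> mor Q (cod r)" and k': "k \<in> mor Q (cod r)"
        using h k by (auto simp: hom_def)
      have c: "htp (x ;; h) (x ;; k)"
        if x: "x \<in> arrs (?C)" "dom x = X" "cod x = Q"
          and eq: "?cmp (?l x) K = U.cls (one X, x ;; h, r)" for x X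
      proof (rule eqv_imp_htp[of r X])
        have xh: "x ;; h \<in> hom (?C) X (cod r)" "x ;; k \<in> hom (?C) X (cod r)"
          using x h(1) k(1) by (auto simp: hom_def)
        then show "x ;; h \<in> mor X (cod r)" "x ;; k \<in> mor X (cod r)"
          by (auto simp: hom_def)
        have "U.cls (one X, x ;; h, r) = U.cls (one X, x ;; k, r)"
          using eq comp[OF k(1) x] k(2) by simp
        then show "((one X, x ;; h, r), (one X, x ;; k, r)) \<in> frac_equality (den_sub M True d)"
          using U.cls_eq_iff[OF T[OF xh(1)] T[OF xh(2)]] by simp
        show "X \<in> objs (ucat M)" using x by auto
      qed (use r Yc in simp_all)
      have "htp h k"
        by (rule htp_coproduct[OF Q PR h(1) k(1)])
          (use c[OF es(1) e(2,3)] c[OF es(2) e(5,6)] K f h in simp_all)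
      then have "U.cls (one Q, h, r) = U.cls (one Q, k, r)"
        by (intro htp_imp_eq) (use r Yc h' e in \<open>auto simp: hom_def\<close>)
      then show "K = U.cls (one Q, h, r)" using k by simp
    qed
  qed (use l in simp_all)
qed

lemma preserves_coproducts:
  "preserves_finite_coproducts (sub M True d) (Frac (den_sub M True d)) (loc (den_sub M True d))"
proof -
  interpret U: uni_fractionable_category "den_sub M True d" by (rule model_uni_fractionable)
  have [simp]: "fobj (loc (den_sub M True d)) X = X" for X by (simp add: loc_def)
  show ?thesis
    unfolding preserves_finite_coproducts_def
    using U.functor_loc U.initial_Frac loc_coproduct by auto
qed

end

section \<open>Products by duality\<close>

context quillen_model_category
begin

interpretation op: quillen_model_category "op_model M"
  by (rule op_quillen) unfold_locales

lemma preserves_products: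
  "preserves_finite_products (sub M c True) (Frac (den_sub M c True)) (loc (den_sub M c True))"
proof -
  interpret U: uni_fractionable_category "den_sub M c True" by (rule model_uni_fractionable)
  interpret V: op_uni_fractionable_category "den_sub M c True" by unfold_locales
  let ?D' = "den_sub (op_model M) True c"
  let ?D = "den_sub M c True"
  note op = op.preserves_coproducts[of c, unfolded preserves_finite_coproducts_def]
  have o: "fobj (loc (den_sub N x y)) X = X" for N :: "('o, 'a) model_data" and x y X
    by (simp add: loc_def)
  show ?thesis
    unfolding preserves_finite_products_def o
  proof (intro conjI allI impI)
    show "is_functor (sub M c True) (Frac (?D)) (loc (?D))"
      using U.functor_loc by simp
    fix T assume "is_terminal (sub M c True) T"
    then have "is_initial (sub (op_model M) True c) T" by (simp add: is_initial_def)
    then have "is_initial (Frac (?D')) T" using op unfolding o by blast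
    then show "is_terminal (Frac (?D)) T" using V.terminal_from_op by simp
  next
    fix X1 X2 P p1 p2 assume p: "is_product (sub M c True) X1 X2 P p1 p2"
    then have "is_coproduct (sub (op_model M) True c) X1 X2 P p1 p2" by (simp add: is_coproduct_def)
    then have "is_coproduct (Frac (?D')) X1 X2 P
        (farr (loc (?D')) p1) (farr (loc (?D')) p2)"
      using op unfolding o by blast
    then show "is_product (Frac (?D)) X1 X2 P
        (farr (loc (?D)) p1) (farr (loc (?D)) p2)"
      using V.product_from_op[of X1 X2 P p1 p2] p by (simp add: is_product_def)
  qed
qed

lemma Fib_has_finite_products: "has_finite_products (Fib M)"
proof -
  have "op_cat (Cof (op_model M)) = Fib M" unfolding sub_cases by simp
  then show ?thesis using op.Cof_has_finite_coproducts by (simp add: has_finite_coproducts_def)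
qed

end

theorem mainTheorem2:
  fixes M :: "('o, 'a) model_data"
  assumes "quillen_model_category M"
  shows
    "(\<forall>C \<in> {ucat M, Cof M, Fib M, Bif M}. uni_fractionable_category (model_den_cat M C)) \<and>
     is_localisation TYPE('q) TYPE('c) (ucat M) (weqs M)
       (Frac (model_den_cat M (ucat M))) (loc (model_den_cat M (ucat M))) \<and>
     (\<forall>(Ho :: ('p, 'b) cat) \<gamma>.
        is_localisation TYPE('p) TYPE('b) (ucat M) (weqs M) Ho \<gamma> \<and>
        is_localisation TYPE('o) TYPE('a three_arrow set) (ucat M) (weqs M) Ho \<gamma> \<longrightarrow>
        (\<exists>\<Phi>. is_cat_iso Ho (Frac (model_den_cat M (ucat M))) \<Phi> \<and>
             functor_eq (ucat M) (functor_cmp \<gamma> \<Phi>) (loc (model_den_cat M (ucat M))))) \<and>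
     (closed_quillen_model_category M \<longrightarrow>
        (\<forall>C \<in> {ucat M, Cof M, Fib M, Bif M}. saturated (model_den_cat M C))) \<and>
     has_finite_coproducts (Cof M) \<and> has_finite_products (Fib M) \<and>
     (\<forall>C \<in> {Cof M, Bif M}.
        preserves_finite_coproducts C (Frac (model_den_cat M C)) (loc (model_den_cat M C))) \<and>
     (\<forall>C \<in> {Fib M, Bif M}.
        preserves_finite_products C (Frac (model_den_cat M C)) (loc (model_den_cat M C)))"
proof -
  interpret quillen_model_category M by (rule assms)
  have uni: "\<forall>C \<in> {ucat M, Cof M, Fib M, Bif M}. uni_fractionable_category (model_den_cat M C)"
    unfolding sub_cases using model_uni_fractionable by simp
  then interpret U: uni_fractionable_category "model_den_cat M (ucat M)" by simp
  have "base (model_den_cat M (ucat M)) = ucat M" "Den (model_den_cat M (ucat M)) = weqs M"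
    using weqs_arrs by (auto simp: model_den_cat_def)
  note loc = U.localisation_Frac[unfolded this]
  have "\<forall>C \<in> {ucat M, Cof M, Fib M, Bif M}. saturated (model_den_cat M C)"
    if "closed_quillen_model_category M"
    unfolding sub_cases using closed_quillen_model_category.model_saturated[OF that] by simp
  moreover have "\<forall>C \<in> {Cof M, Bif M}.
      preserves_finite_coproducts C (Frac (model_den_cat M C)) (loc (model_den_cat M C))"
    unfolding sub_cases using preserves_coproducts by simp
  moreover have "\<forall>C \<in> {Fib M, Bif M}.
      preserves_finite_products C (Frac (model_den_cat M C)) (loc (model_den_cat M C))"
    unfolding sub_cases using preserves_products by simp
  ultimately show ?thesis
    \<comment> \<open>The universal property of the fraction category holds for targets of every
      type; here it is used for those of \<open>Ho\<close> and for those of the fraction category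
      itself.\<close>
    using uni loc localisation_unique[OF _ _ loc loc] Cof_has_finite_coproducts
      Fib_has_finite_products by blast
qed

end
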